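(* Let $u \in H^1(\Omega,X)$ be harmonic with boundary value (trace) $u^b$ such that $E(u^b)\in L^1(\partial\Omega)$. Then $$\operatorname*{ess\,sup}_{x\in\Omega}E(u(x)) \leq \operatorname*{ess\,sup}_{x\in\partial\Omega} E(u^b(x)),$$ and the left-hand side is finite if and only if the right-hand side is.
   Context: Standing assumptions. $\Omega\subset\mathbb{R}^d$ is a bounded open domain of class $C^{2,\alpha}$, endowed with Lebesgue measure; $\partial\Omega$ is endowed with the $(d-1)$-dimensional Hausdorff measure $\mathcal{H}^{d-1}$ (essential suprema are taken with respect to these measures). $(X,\mathsf{d})$ is a complete metric space. $E:X\to\mathbb{R}\cup\{+\infty\}$ is lower semicontinuous with dense domain $D(E)=\{x\in X: E(x)<+\infty\}$; $E$ is not assumed bounded from below. $E$ generates an $\mathrm{EVI}_0$-gradient flow from every initial point: there is a one-parameter semigroup $(S_t)_{t\ge 0}$ of maps $S_t:X\to X$ ($S_0=\mathrm{id}$) such that for every $u\in X$ the curve $t\mapsto S_t u$ belongs to $AC_{\mathrm{loc}}((0,\infty),X)\cap C([0,\infty),X)$ and $$\frac12\frac{\mathrm d}{\mathrm dt}\mathsf d^2(S_tu,v)+E(S_tu)\le E(v)\qquad \forall v\in X,\ \text{for a.e. } t>0.$$ Sobolev maps. $L^2(\Omega,X)$ is the set of (a.e.-equivalence classes of) Borel maps $u:\Omega\to X$ with separable essential range ($u(\Omega\setminus N)$ is separable for some Lebesgue-null $N$) such that $\mathsf d(u(\cdot),v)\in L^2(\Omega)$ for some (equivalently any) $v\in X$;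 $L^2(\partial\Omega,X)$ is defined similarly with $\mathcal H^{d-1}$. For $u\in L^2(\Omega,X)$ and $\varepsilon>0$, $$\mathrm{Dir}_\varepsilon(u)=\frac{1}{2C_d\varepsilon^{d+2}}\iint_{\Omega\times\Omega}\mathsf d^2(u(x),u(y))\mathbf 1_{|x-y|\le\varepsilon}\,\mathrm dx\,\mathrm dy,\qquad C_d=\frac1d\int_{B_1}|z|^2\,\mathrm dz,$$ and $\mathrm{Dir}(u)=\lim_{\varepsilon\to0}\mathrm{Dir}_\varepsilon(u)\in[0,+\infty]$ (this limit always exists). $H^1(\Omega,X)=\{u\in L^2(\Omega,X):\mathrm{Dir}(u)<\infty\}$. Trace. Each $u\in H^1(\Omega,X)$ has a trace $u^b\in L^2(\partial\Omega,X)$ (Korevaar–Schoen): given a vector field $\mathcal Z$ transversal to $\partial\Omega$ and pointing inward, let $x_t$ solve $\dot x_t=\mathcal Z(x_t)$ starting at $x_0\in\partial\Omega$; $u$ has a representative such that for a.e. $x_0\in\partial\Omega$ the map $t\mapsto u(x_t)$ is Hölder continuous, and $u^b(x_0)=\lim_{t\downarrow0}u(x_t)$. This does not depend on the representative nor on $\mathcal Z$. Harmonicity. $u\in H^1(\Omega,X)$ is harmonic if $\mathrm{Dir}(u)\le\mathrm{Dir}(v)$ for all $v\in H^1(\Omega,X)$ with $v^b=u^b$. Notation. $E(u)=E\circ u$, $E(u^b)=E\circ u^b$. *)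

theory Defs
  imports "HOL-Analysis.Analysis" "HOL-Probability.Essential_Supremum"
begin

section \<open>Domains of class \<open>C\<^sup>2\<^sup>,\<^sup>\<alpha>\<close>\<close>

definition C2_holder :: "real \<Rightarrow> ('a::euclidean_space \<Rightarrow> real) \<Rightarrow> bool" where
  "C2_holder \<alpha> g \<longleftrightarrow>
     (\<exists>(Dg :: 'a \<Rightarrow> 'a) (D2g :: 'a \<Rightarrow> 'a \<Rightarrow>\<^sub>L 'a) L.
        (\<forall>x. (g has_derivative (\<lambda>h. Dg x \<bullet> h)) (at x)) \<and>
        (\<forall>x. (Dg has_derivative blinfun_apply (D2g x)) (at x)) \<and>
        (\<forall>x y. norm (D2g x - D2g y) \<le> L * dist x y powr \<alpha>))"

text \<open>Near each boundary point the set is the strict epigraph, in some unit direction \<open>e\<close>, of a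
  \<open>C\<^sup>2\<^sup>,\<^sup>\<alpha>\<close> function \<open>g\<close>. Only the values of \<open>g\<close> on the hyperplane orthogonal to \<open>e\<close> matter: its
  argument is the orthogonal projection of \<open>x\<close> to that hyperplane.\<close>

definition C2_holder_boundary :: "real \<Rightarrow> 'a::euclidean_space set \<Rightarrow> bool" where
  "C2_holder_boundary \<alpha> \<Omega> \<longleftrightarrow>
     (\<forall>x0\<in>frontier \<Omega>. \<exists>e r g. norm e = 1 \<and> 0 < r \<and> C2_holder \<alpha> g \<and>
        (\<forall>x\<in>ball x0 r. x \<in> \<Omega> \<longleftrightarrow> g (x - (x \<bullet> e) *\<^sub>R e) < x \<bullet> e))"

definition bounded_C2_holder_domain :: "real \<Rightarrow> 'a::euclidean_space set \<Rightarrow> bool" where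
  "bounded_C2_holder_domain \<alpha> \<Omega> \<longleftrightarrow>
     open \<Omega> \<and> connected \<Omega> \<and> \<Omega> \<noteq> {} \<and> bounded \<Omega> \<and> C2_holder_boundary \<alpha> \<Omega>"


section \<open>Hausdorff measure\<close>

text \<open>The empty set is treated separately because \<open>0 ^ 0 = 1\<close>, which is the right weight for a
  singleton when \<open>s = 0\<close>. Boundedness is required of covering sets because \<^const>\<open>diameter\<close> is
  meaningless for unbounded ones.\<close>

definition hausdorff_weight :: "nat \<Rightarrow> 'a::metric_space set \<Rightarrow> ennreal" where
  "hausdorff_weight s U =
     (if U = {} then 0 else ennreal (unit_ball_vol (real s) * (diameter U / 2) ^ s))"

definition hausdorff_outer :: "nat \<Rightarrow> 'a::metric_space set \<Rightarrow> ennreal" where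
  "hausdorff_outer s A =
     (SUP \<delta>\<in>{0::real<..}.
        INF U\<in>{U :: nat \<Rightarrow> 'a set. A \<subseteq> (\<Union>i. U i) \<and> (\<forall>i. bounded (U i) \<and> diameter (U i) \<le> \<delta>)}.
          (\<Sum>i. hausdorff_weight s (U i)))"

text \<open>\<^const>\<open>hausdorff_outer\<close> is a metric outer measure, hence countably additive on the Borel sets,
  so \<^const>\<open>measure_of\<close> does not fall back to the zero measure here.\<close>

definition hausdorff_measure :: "nat \<Rightarrow> 'a::metric_space measure" where
  "hausdorff_measure s = measure_of UNIV (sets borel) (hausdorff_outer s)"

definition domain_measure :: "'a::euclidean_space set \<Rightarrow> 'a measure" where
  "domain_measure \<Omega> = restrict_space lborel \<Omega>"

definition boundary_measure :: "'a::euclidean_space set \<Rightarrow> 'a measure" where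
  "boundary_measure \<Omega> = restrict_space (hausdorff_measure (DIM('a) - 1)) (frontier \<Omega>)"


section \<open>Metric-space valued Sobolev maps\<close>

text \<open>Equivalence classes are represented by Borel maps on the space of \<open>M\<close>; values elsewhere are
  irrelevant.\<close>

definition L2_map :: "'a measure \<Rightarrow> ('a \<Rightarrow> 'x::metric_space) \<Rightarrow> bool" where
  "L2_map M u \<longleftrightarrow>
     u \<in> borel_measurable M \<and>
     (\<exists>N\<in>null_sets M. separable_space (top_of_set (u ` (space M - N)))) \<and>
     (\<exists>v. integrable M (\<lambda>x. (dist (u x) v)\<^sup>2))"

definition Dir_const :: "'a::euclidean_space itself \<Rightarrow> real" where
  "Dir_const _ = (1 / DIM('a)) * (LINT z:ball (0::'a) 1|lborel. (norm z)\<^sup>2)"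

definition Dir_eps :: "'a::euclidean_space set \<Rightarrow> real \<Rightarrow> ('a \<Rightarrow> 'x::metric_space) \<Rightarrow> ennreal" where
  "Dir_eps \<Omega> \<epsilon> u =
     (\<integral>\<^sup>+x\<in>\<Omega>. (\<integral>\<^sup>+y\<in>\<Omega>. ennreal ((dist (u x) (u y))\<^sup>2) * indicator {y. norm (x - y) \<le> \<epsilon>} y \<partial>lborel) \<partial>lborel)
       / ennreal (2 * Dir_const TYPE('a) * \<epsilon> ^ (DIM('a) + 2))"

definition Dir :: "'a::euclidean_space set \<Rightarrow> ('a \<Rightarrow> 'x::metric_space) \<Rightarrow> ennreal" where
  "Dir \<Omega> u = Lim (at_right 0) (\<lambda>\<epsilon>. Dir_eps \<Omega> \<epsilon> u)"

definition H1_map :: "'a::euclidean_space set \<Rightarrow> ('a \<Rightarrow> 'x::metric_space) \<Rightarrow> bool" where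
  "H1_map \<Omega> u \<longleftrightarrow> L2_map (domain_measure \<Omega>) u \<and> Dir \<Omega> u < \<infinity>"


section \<open>Traces and harmonic maps\<close>

text \<open>For a \<open>C\<^sup>1\<close> boundary this determines the inward unit normal: a direction enters \<open>\<Omega>\<close> if its
  normal component is positive and leaves it if its normal component is negative.\<close>

definition inner_unit_normal :: "'a::euclidean_space set \<Rightarrow> 'a \<Rightarrow> 'a \<Rightarrow> bool" where
  "inner_unit_normal \<Omega> x \<nu> \<longleftrightarrow>
     norm \<nu> = 1 \<and>
     (\<forall>w. 0 < w \<bullet> \<nu> \<longrightarrow> (\<forall>\<^sub>F t in at_right 0. x + t *\<^sub>R w \<in> \<Omega>)) \<and>
     (\<forall>w. w \<bullet> \<nu> < 0 \<longrightarrow> (\<forall>\<^sub>F t in at_right 0. x + t *\<^sub>R w \<notin> \<Omega>))"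

text \<open>Vector fields are Lipschitz, so that integral curves exist and are unique.\<close>

definition inward_transversal :: "'a::euclidean_space set \<Rightarrow> ('a \<Rightarrow> 'a) \<Rightarrow> bool" where
  "inward_transversal \<Omega> Z \<longleftrightarrow>
     (\<exists>L. L-lipschitz_on UNIV Z) \<and>
     (\<forall>x\<in>frontier \<Omega>. \<exists>\<nu>. inner_unit_normal \<Omega> x \<nu> \<and> 0 < Z x \<bullet> \<nu>)"

definition holder_on :: "real set \<Rightarrow> (real \<Rightarrow> 'x::metric_space) \<Rightarrow> bool" where
  "holder_on I f \<longleftrightarrow>
     (\<exists>\<beta>>0. \<exists>C. \<forall>s\<in>I. \<forall>t\<in>I. dist (f s) (f t) \<le> C * \<bar>s - t\<bar> powr \<beta>)"

definition trace_along ::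
  "'a::euclidean_space set \<Rightarrow> ('a \<Rightarrow> 'a) \<Rightarrow> ('a \<Rightarrow> 'x::metric_space) \<Rightarrow> ('a \<Rightarrow> 'x) \<Rightarrow> bool" where
  "trace_along \<Omega> Z u b \<longleftrightarrow>
     (\<exists>u'. (AE x in domain_measure \<Omega>. u' x = u x) \<and>
        (AE x0 in boundary_measure \<Omega>. \<exists>T>0. \<exists>\<gamma>.
           \<gamma> 0 = x0 \<and>
           (\<forall>t\<in>{0..<T}. (\<gamma> has_vector_derivative Z (\<gamma> t)) (at t within {0..<T})) \<and>
           (\<forall>t\<in>{0<..<T}. \<gamma> t \<in> \<Omega>) \<and>
           holder_on {0<..<T} (\<lambda>t. u' (\<gamma> t)) \<and>
           ((\<lambda>t. u' (\<gamma> t)) \<longlongrightarrow> b x0) (at_right 0)))"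

text \<open>The trace is an almost-everywhere class, hence rendered as a relation: \<open>b\<close> is a Borel
  representative of the trace of \<open>u\<close>. The trace does not depend on the transversal field.\<close>

definition is_trace ::
  "'a::euclidean_space set \<Rightarrow> ('a \<Rightarrow> 'x::metric_space) \<Rightarrow> ('a \<Rightarrow> 'x) \<Rightarrow> bool" where
  "is_trace \<Omega> u b \<longleftrightarrow>
     L2_map (boundary_measure \<Omega>) b \<and> (\<exists>Z. inward_transversal \<Omega> Z \<and> trace_along \<Omega> Z u b)"

text \<open>Two maps have the same trace iff they have a common representative of it.\<close>

definition harmonic_map :: "'a::euclidean_space set \<Rightarrow> ('a \<Rightarrow> 'x::metric_space) \<Rightarrow> bool" where
  "harmonic_map \<Omega> u \<longleftrightarrow>
     H1_map \<Omega> u \<and>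
     (\<forall>v. H1_map \<Omega> v \<and> (\<exists>b. is_trace \<Omega> u b \<and> is_trace \<Omega> v b) \<longrightarrow> Dir \<Omega> u \<le> Dir \<Omega> v)"


section \<open>\<open>EVI\<^sub>0\<close> gradient flows\<close>

definition lower_semicontinuous :: "('x::topological_space \<Rightarrow> ereal) \<Rightarrow> bool" where
  "lower_semicontinuous E \<longleftrightarrow> (\<forall>x. E x \<le> Liminf (at x) E)"

definition AC_loc_pos :: "(real \<Rightarrow> 'x::metric_space) \<Rightarrow> bool" where
  "AC_loc_pos \<gamma> \<longleftrightarrow>
     (\<exists>m :: real \<Rightarrow> real.
        (\<forall>a b. 0 < a \<and> a \<le> b \<longrightarrow> set_integrable lborel {a..b} m) \<and>
        (\<forall>s t. 0 < s \<and> s \<le> t \<longrightarrow> dist (\<gamma> s) (\<gamma> t) \<le> (LINT r:{s..t}|lborel. m r)))"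

definition EVI0_flow :: "('x::metric_space \<Rightarrow> ereal) \<Rightarrow> (real \<Rightarrow> 'x \<Rightarrow> 'x) \<Rightarrow> bool" where
  "EVI0_flow E S \<longleftrightarrow>
     S 0 = id \<and>
     (\<forall>s\<ge>0. \<forall>t\<ge>0. S (s + t) = S s \<circ> S t) \<and>
     (\<forall>u. AC_loc_pos (\<lambda>t. S t u) \<and> continuous_on {0..} (\<lambda>t. S t u) \<and>
       (\<forall>v. AE t in lborel. 0 < t \<longrightarrow>
          (\<exists>D. ((\<lambda>s. (dist (S s u) v)\<^sup>2) has_real_derivative D) (at t) \<and>
               ereal (D / 2) + E (S t u) \<le> E v)))"


section \<open>Integrability of extended real functions\<close>

definition L1_ereal :: "'a measure \<Rightarrow> ('a \<Rightarrow> ereal) \<Rightarrow> bool" where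
  "L1_ereal M f \<longleftrightarrow> f \<in> borel_measurable M \<and> (\<integral>\<^sup>+x. e2ennreal \<bar>f x\<bar> \<partial>M) < \<infinity>"

end

theory Submission
  imports Defs
begin

text \<open>
  Let \<open>M\<close> be the essential supremum of \<open>E\<close> along the boundary values, assumed finite. The idea is to
  compare the harmonic map \<open>u\<close> with \<open>f \<circ> u\<close>, where \<open>f\<close> retracts the target onto lower energy by
  running the gradient flow of \<open>E\<close> from \<open>y\<close> for the time \<open>g y\<close>, the first \<open>r\<close> with
  \<open>E (S r y) \<le> M + r\<close>. The evolution variational inequality, integrated over the time by which
  \<open>g y\<close> exceeds \<open>g z\<close>, gives the sharpened contraction estimate
  \<open>(dist (f y) (f z))\<^sup>2 + (g y - g z)\<^sup>2 \<le> (dist y z)\<^sup>2\<close>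
  (\<open>retract_improved_contraction\<close>); moreover \<open>f\<close> is the identity and \<open>g\<close> vanishes precisely
  on the sublevel \<open>E \<le> M\<close>. Since almost every boundary value lies in that sublevel, \<open>f \<circ> u\<close> has
  the same trace as \<open>u\<close>, and summing the estimate over pairs of points yields
  \<open>Dir (f \<circ> u) + Dir (g \<circ> u) \<le> Dir u \<le> Dir (f \<circ> u)\<close>. Hence \<open>Dir (g \<circ> u) = 0\<close>, so \<open>g \<circ> u\<close>
  is constant on the connected domain. The constant is the trace of \<open>g \<circ> u\<close>, which is zero, and
  \<open>g \<circ> u = 0\<close> says that \<open>E \<circ> u \<le> M\<close> (\<open>harmonic_map_sublevel\<close>).

  Three facts from analysis carry this argument.

  \<^item> \<open>Dir\<close> is defined as a limit, so inequalities between approximate energies only become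
    inequalities between Dirichlet energies once the limit is known to exist. Joining two points by a
    chain of \<open>n\<close> points bounds the energy at scale \<open>\<epsilon>\<close> by the energy at scale \<open>\<epsilon> / n\<close>. Near the
    boundary the chain is bent inwards by an amount of order \<open>\<epsilon>\<^sup>2\<close>, which a boundary with Lipschitz
    gradient tolerates; the loss is a factor tending to \<open>1\<close>
    (\<open>pair_energy_almost_decreasing\<close>, \<open>Dir_eps_convergence\<close>).

  \<^item> The boundary has positive Hausdorff measure, so that almost everywhere statements on it have
    witnesses. This requires that the Hausdorff outer measure is a measure on the Borel sets
    (\<open>emeasure_hausdorff_measure\<close>) and that the boundary casts a shadow of positive size
    (\<open>hausdorff_outer_frontier_nonzero\<close>).

  \<^item> A closed condition satisfied almost everywhere by \<open>u\<close> is inherited by its trace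
    (\<open>trace_in_closed\<close>), because from almost every boundary point the flow line of the transversal
    field leaves any given Lebesgue null set (\<open>flow_lines_leave_null_set\<close>).

  The last fact, applied to the closed sublevels of \<open>E\<close>, also gives the reverse inequality of the two
  essential suprema when the interior one is finite. Neither of them is \<open>-\<infinity>\<close>, since both
  measures are nonzero and \<open>E\<close> does not take that value.
\<close>
section \<open>Gradient flows and the retraction onto a sublevel\<close>

text \<open>A null set of bad points may be ignored because the variation of \<open>f\<close> over an open neighbourhood of
  it is controlled by the integral of \<open>m\<close> there, which is as small as desired. Bisection then adds up
  the local estimates.\<close>

lemma AC_antimono:
  fixes f m :: "real \<Rightarrow> real"
  assumes "a \<le> b" and m: "set_integrable lborel {a..b} m"
    and ac: "\<And>s t. a \<le> s \<Longrightarrow> s \<le> t \<Longrightarrow> t \<le> b \<Longrightarrow> \<bar>f t - f s\<bar> \<le> (LINT r:{s..t}|lborel. m r)"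
    and der: "AE t in lborel. a < t \<and> t < b \<longrightarrow> (\<exists>D\<le>0. (f has_real_derivative D) (at t))"
  shows "f b \<le> f a"
proof (rule field_le_epsilon)
  fix e0 :: real assume "0 < e0"
  define e where "e = e0 / (b - a + 1)"
  have e: "0 < e" using \<open>0 < e0\<close> \<open>a \<le> b\<close> by (simp add: e_def)
  define h where "h = (\<lambda>x. indicator {a..b} x *\<^sub>R m x)"
  have h: "integrable lborel h" using m by (simp add: h_def set_integrable_def)
  have [measurable]: "h \<in> borel_measurable lborel" using h by auto
  define \<nu> where "\<nu> = density lborel (\<lambda>x. ennreal \<bar>h x\<bar>)"
  have emn: "emeasure \<nu> A = (\<integral>\<^sup>+x\<in>A. ennreal \<bar>h x\<bar> \<partial>lborel)" if "A \<in> sets borel" for A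
    using that by (simp add: \<nu>_def emeasure_density)
  have fin: "emeasure \<nu> (space \<nu>) \<noteq> \<infinity>"
    using h by (subst emn) (auto simp: \<nu>_def integrable_iff_bounded less_top)
  interpret nu: finite_measure \<nu> using fin by (auto intro: finite_measureI)
  have sb: "sets \<nu> = sets borel" by (simp add: \<nu>_def)
  obtain N0 where N0: "N0 \<in> null_sets lborel"
    "{t. \<not> (a < t \<and> t < b \<longrightarrow> (\<exists>D\<le>0. (f has_real_derivative D) (at t)))} \<subseteq> N0"
    using der by (auto simp: eventually_ae_filter)
  define N where "N = N0 \<union> {a, b}"
  have N: "N \<in> null_sets lborel" unfolding N_def using N0(1)
    by (rule null_sets.Un) (auto intro: finite_imp_null_set_lborel)
  have Nb: "N \<in> sets borel" using N by auto
  \<comment> \<open>The measure \<open>\<nu>\<close> dominates the variation of \<open>f\<close>; outer regularity provides the small neighbourhood \<open>U\<close>.\<close>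
  have "emeasure \<nu> N = 0"
    using N unfolding \<nu>_def null_sets_density_iff[of "\<lambda>x. ennreal \<bar>h x\<bar>" lborel, simplified]
    by (intro null_setsD1, subst null_sets_density_iff) (auto dest: AE_not_in)
  moreover have "emeasure \<nu> N = (INF U\<in>{U. N \<subseteq> U \<and> open U}. emeasure \<nu> U)"
    using outer_regular[OF sb fin Nb] .
  ultimately have "(INF U\<in>{U. N \<subseteq> U \<and> open U}. emeasure \<nu> U) < ennreal e"
    using e by simp
  then obtain U where U: "N \<subseteq> U" "open U" "emeasure \<nu> U < ennreal e"
    by (auto simp: INF_less_iff)
  have [measurable]: "U \<in> sets borel" using U by auto
  have LU: "(LINT r:{s..t}|lborel. m r) \<le> measure \<nu> {s<..t}" if "a \<le> s" "s \<le> t" "t \<le> b" for s t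
  proof -
    have "(LINT r:{s..t}|lborel. m r) = (LINT r:{s..t}|lborel. h r)"
      using that unfolding set_lebesgue_integral_def h_def
      by (intro Bochner_Integration.integral_cong) (auto simp: indicator_def)
    also have "\<dots> \<le> (LINT r:{s<..t}|lborel. \<bar>h r\<bar>)"
      unfolding set_lebesgue_integral_def
    proof (rule integral_mono_AE)
      show "integrable lborel (\<lambda>x. indicat_real {s..t} x *\<^sub>R h x)"
        using h by (intro integrable_mult_indicator) auto
      show "integrable lborel (\<lambda>x. indicat_real {s<..t} x *\<^sub>R \<bar>h x\<bar>)"
        using h by (intro integrable_mult_indicator integrable_abs) auto
      have "AE x in lborel. x \<noteq> s" by (rule AE_lborel_singleton)
      then show "AE x in lborel. indicat_real {s..t} x *\<^sub>R h x \<le> indicat_real {s<..t} x *\<^sub>R \<bar>h x\<bar>"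
        by eventually_elim (auto simp: indicator_def)
    qed
    also have "\<dots> = measure \<nu> {s<..t}"
    proof -
      have "ennreal (LINT r:{s<..t}|lborel. \<bar>h r\<bar>) = (\<integral>\<^sup>+r. ennreal (indicat_real {s<..t} r *\<^sub>R \<bar>h r\<bar>) \<partial>lborel)"
        unfolding set_lebesgue_integral_def using h
        by (intro nn_integral_eq_integral[symmetric] integrable_mult_indicator integrable_abs AE_I2) auto
      also have "\<dots> = emeasure \<nu> {s<..t}"
        by (subst emn) (auto intro!: nn_integral_cong simp: indicator_def)
      finally show ?thesis
        by (simp add: nu.emeasure_eq_measure set_lebesgue_integral_def)
    qed
    finally show ?thesis .
  qed
  \<comment> \<open>The half-open interval makes \<open>P\<close> additive under concatenation.\<close>
  define P where "P = (\<lambda>s t. a \<le> s \<and> t \<le> b \<longrightarrow> f t - f s \<le> e * (t - s) + measure \<nu> (U \<inter> {s<..t}))"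
  have "P a b" using \<open>a \<le> b\<close>
  proof (induction rule: Bolzano)
    case (trans s t r)
    have "measure \<nu> (U \<inter> {s<..r}) = measure \<nu> (U \<inter> {s<..t} \<union> U \<inter> {t<..r})"
      using trans by (intro arg_cong[of _ _ "measure \<nu>"]) auto
    also have "\<dots> = measure \<nu> (U \<inter> {s<..t}) + measure \<nu> (U \<inter> {t<..r})"
      by (intro nu.finite_measure_Union) (auto simp: sb)
    finally show ?case using trans by (auto simp: P_def algebra_simps)
  next
    case (local x)
    show ?case
    proof (cases "x \<in> N")
      case True
      then obtain d where d: "d > 0" "ball x d \<subseteq> U" using U openE by blast
      have "P s t" if "s \<le> x" "x \<le> t" "t - s < d" for s t
      proof -
        have "{s<..t} \<subseteq> ball x d" using that by (auto simp: dist_real_def)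
        then have "U \<inter> {s<..t} = {s<..t}" using d by auto
        moreover have "0 \<le> e * (t - s)" using that e by (intro mult_nonneg_nonneg) auto
        ultimately show ?thesis using ac[of s t] LU[of s t] that unfolding P_def by auto
      qed
      then show ?thesis using d by blast
    next
      case False
      then have "a < x" "x < b" using local by (auto simp: N_def)
      then obtain D where D: "D \<le> 0" "(f has_real_derivative D) (at x)"
        using False N0 by (auto simp: N_def)
      then obtain d where d: "d > 0" "\<And>y. \<bar>y - x\<bar> < d \<Longrightarrow> \<bar>f y - f x - D * (y - x)\<bar> \<le> e * \<bar>y - x\<bar>"
        using e unfolding has_field_derivative_def has_derivative_at_alt by (auto simp: mult.commute)
      have "P s t" if "s \<le> x" "x \<le> t" "t - s < d" for s t
      proof -
        have "f t - f x \<le> e * (t - x)" using d(2)[of t] that mult_nonpos_nonneg[of D "t-x"] D by auto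
        moreover have "f x - f s \<le> e * (x - s)" using d(2)[of s] that mult_nonpos_nonneg[of D "x-s"] D
          by (auto simp: algebra_simps)
        ultimately have "f t - f s \<le> e * (t - s)" by (simp add: algebra_simps)
        then show ?thesis unfolding P_def by (intro impI add_increasing2) auto
      qed
      then show ?thesis using d by blast
    qed
  qed
  then have "f b - f a \<le> e * (b - a) + measure \<nu> (U \<inter> {a<..b})" by (simp add: P_def)
  also have "measure \<nu> (U \<inter> {a<..b}) \<le> measure \<nu> U"
    by (intro nu.finite_measure_mono) (auto simp: sb)
  also have "measure \<nu> U \<le> e" using U(3) e by (simp add: nu.emeasure_eq_measure ennreal_less_iff)
  also have "e * (b - a) + e = e * (b - a + 1)" by (simp add: algebra_simps)
  also have "\<dots> = e0" using \<open>a \<le> b\<close> by (simp add: e_def)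
  finally show "f b \<le> f a + e0" by simp
qed

lemma set_integral_affine:
  fixes m :: "real \<Rightarrow> real"
  assumes "set_integrable lborel {s..t} m" "s \<le> t"
  shows "(LINT r:{s..t}|lborel. c * m r + k) = c * (LINT r:{s..t}|lborel. m r) + k * (t - s)"
    and "set_integrable lborel {s..t} (\<lambda>r. c * m r + k)"
proof -
  have k: "set_integrable lborel {s..t} (\<lambda>r. k)"
    using borel_integrable_atLeastAtMost'[of s t "\<lambda>_. k"] by simp
  have c: "set_integrable lborel {s..t} (\<lambda>r. c * m r)" using assms by simp
  show "set_integrable lborel {s..t} (\<lambda>r. c * m r + k)" using set_integral_add(1)[OF c k] .
  show "(LINT r:{s..t}|lborel. c * m r + k) = c * (LINT r:{s..t}|lborel. m r) + k * (t - s)"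
    using assms by (simp add: set_integral_add(2)[OF c k] set_lebesgue_integral_def[of _ _ "\<lambda>_. k"])
qed

text \<open>Allowing a varying bound \<open>c\<close>, and asking for it only frequently, covers at once closedness of
  sublevels and closedness of the set of times \<open>r\<close> with \<open>E (S r x) \<le> M + r\<close>.\<close>

lemma lsc_le_limit:
  fixes E :: "'x::metric_space \<Rightarrow> ereal"
  assumes "lower_semicontinuous E" and f: "(f \<longlongrightarrow> y) F" and "F \<noteq> bot"
    and c: "(c \<longlongrightarrow> l) F" and ev: "\<exists>\<^sub>F n in F. E (f n) \<le> c n"
  shows "E y \<le> l"
proof (rule ccontr)
  assume "\<not> E y \<le> l"
  then obtain k where k: "l < k" "k < E y" using dense[of l "E y"] by (auto simp: not_le)
  then have "k < Liminf (at y) E" using assms(1) unfolding lower_semicontinuous_def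
    using less_le_trans by blast
  then have "eventually (\<lambda>z. k < E z) (at y)" by (rule less_LiminfD)
  then have "eventually (\<lambda>z. k < E z) (nhds y)" using k by (simp add: eventually_nhds_conv_at)
  then have "eventually (\<lambda>n. k < E (f n)) F" using f by (auto simp: filterlim_iff)
  moreover have "eventually (\<lambda>n. c n < k) F" using c k by (auto intro: order_tendstoD)
  ultimately have "eventually (\<lambda>n. \<not> E (f n) \<le> c n) F" by eventually_elim auto
  then show False using ev by (simp add: frequently_def)
qed

lemma lsc_closed_sublevel:
  fixes E :: "'x::metric_space \<Rightarrow> ereal"
  assumes "lower_semicontinuous E"
  shows "closed {x. E x \<le> c}"
  unfolding closed_sequential_limits
  by (auto intro!: lsc_le_limit[OF assms, of _ _ sequentially "\<lambda>_. c"])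

lemma lsc_borel_measurable:
  fixes E :: "'x::metric_space \<Rightarrow> ereal"
  assumes "lower_semicontinuous E"
  shows "E \<in> borel_measurable borel"
proof (rule borel_measurableI_le)
  show "{x \<in> space borel. E x \<le> y} \<in> sets borel" for y
    using lsc_closed_sublevel[OF assms, of y] by auto
qed

locale EVI_flow =
  fixes E :: "'x::metric_space \<Rightarrow> ereal" and S :: "real \<Rightarrow> 'x \<Rightarrow> 'x"
  assumes lsc: "lower_semicontinuous E"
    and not_minf: "E x \<noteq> - \<infinity>"
    and flow: "EVI0_flow E S"
    and proper: "\<exists>v. E v < \<infinity>"
begin

lemma S_0: "S 0 x = x"
  using flow by (simp add: EVI0_flow_def)

lemma S_continuous: "continuous_on {0..} (\<lambda>t. S t x)"
  using flow by (simp add: EVI0_flow_def)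

lemma S_tendsto: "0 \<le> t \<Longrightarrow> ((\<lambda>r. S r x) \<longlongrightarrow> S t x) (at t within {0..})"
  using S_continuous[of x] by (auto simp: continuous_on_def)

lemma EVI_derivative:
  "AE t in lborel. 0 < t \<longrightarrow>
     (\<exists>D. ((\<lambda>s. (dist (S s x) z)\<^sup>2) has_real_derivative D) (at t) \<and> ereal (D / 2) + E (S t x) \<le> E z)"
  using flow unfolding EVI0_flow_def by blast

text \<open>Any affine lower bound for the energy along the flow turns the differential inequality into an
  estimate between times \<open>b\<close> and \<open>a\<close>, so the energy itself never has to be integrated. Constant bounds
  give the contraction property, the bound \<open>M + r\<close> gives the retraction estimate.\<close>

lemma EVI_integrated_pos:
  assumes "0 < b" "b < a" and ez: "E z \<le> ereal e"
    and lower: "\<And>r. b < r \<Longrightarrow> r < a \<Longrightarrow> ereal (p + q * r) \<le> E (S r x)"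
  shows "(dist (S a x) z)\<^sup>2 + 2 * (p - e) * (a - b) + q * (a\<^sup>2 - b\<^sup>2) \<le> (dist (S b x) z)\<^sup>2"
proof -
  \<comment> \<open>The estimate says that \<open>f a \<le> f b\<close>.\<close>
  define f where "f = (\<lambda>t. (dist (S t x) z)\<^sup>2 + (2 * (p - e) * t + q * t\<^sup>2))"
  from flow have "AC_loc_pos (\<lambda>t. S t x)" unfolding EVI0_flow_def by blast
  then obtain m where m: "\<And>s t. 0 < s \<Longrightarrow> s \<le> t \<Longrightarrow> set_integrable lborel {s..t} m"
    "\<And>s t. 0 < s \<Longrightarrow> s \<le> t \<Longrightarrow> dist (S s x) (S t x) \<le> (LINT r:{s..t}|lborel. m r)"
    unfolding AC_loc_pos_def by blast
  have "compact ((\<lambda>t. dist (S t x) z) ` {b..a})"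
    using assms(1) by (intro compact_continuous_image continuous_intros continuous_on_subset[OF S_continuous]) auto
  then obtain K where K0: "\<And>t. t \<in> {b..a} \<Longrightarrow> \<bar>dist (S t x) z\<bar> \<le> K"
    using compact_imp_bounded by (fastforce simp: bounded_iff)
  then have K: "dist (S t x) z \<le> K" if "t \<in> {b..a}" for t using that by force
  have "0 \<le> K" using K[of b] assms zero_le_dist[of "S b x" z] by (simp add: order_trans[OF zero_le_dist])
  \<comment> \<open>A Lipschitz constant of the polynomial part of \<open>f\<close>.\<close>
  define k where "k = \<bar>2 * (p - e)\<bar> + \<bar>q\<bar> * (2 * a)"
  have "f a \<le> f b"
  proof (rule AC_antimono[where f = f and a = b and b = a and m = "\<lambda>r. 2 * K * m r + k"])
    show "b \<le> a" using assms by simp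
    show "set_integrable lborel {b..a} (\<lambda>r. 2 * K * m r + k)"
      using assms by (intro set_integral_affine m) auto
  next
    fix s t assume st: "b \<le> s" "s \<le> t" "t \<le> a"
    have "\<bar>(dist (S t x) z)\<^sup>2 - (dist (S s x) z)\<^sup>2\<bar>
        = \<bar>dist (S t x) z - dist (S s x) z\<bar> * (dist (S t x) z + dist (S s x) z)"
      by (simp add: power2_eq_square square_diff_square_factored abs_mult)
    also have "\<dots> \<le> dist (S s x) (S t x) * (K + K)"
      using K[of s] K[of t] st dist_triangle[of "S t x" z "S s x"] dist_triangle[of "S s x" z "S t x"]
      by (intro mult_mono add_mono) (auto simp: dist_commute)
    also have "\<dots> \<le> (LINT r:{s..t}|lborel. m r) * (K + K)"
      using m(2)[of s t] st assms \<open>0 \<le> K\<close> by (intro mult_right_mono) auto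
    finally have A: "\<bar>(dist (S t x) z)\<^sup>2 - (dist (S s x) z)\<^sup>2\<bar> \<le> 2 * K * (LINT r:{s..t}|lborel. m r)"
      by (simp add: algebra_simps)
    have "2 * (p - e) * t + q * t\<^sup>2 - (2 * (p - e) * s + q * s\<^sup>2) = (2 * (p - e) + q * (t + s)) * (t - s)"
      by (simp add: power2_eq_square algebra_simps)
    also have "\<bar>\<dots>\<bar> \<le> k * (t - s)"
    proof -
      have "\<bar>2 * (p - e) + q * (t + s)\<bar> \<le> \<bar>2 * (p - e)\<bar> + \<bar>q\<bar> * \<bar>t + s\<bar>"
        by (metis abs_mult abs_triangle_ineq)
      also have "\<dots> \<le> k" unfolding k_def using st assms by (intro add_left_mono mult_left_mono) auto
      finally show ?thesis using st by (simp add: abs_mult mult_right_mono)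
    qed
    finally have B: "\<bar>2 * (p - e) * t + q * t\<^sup>2 - (2 * (p - e) * s + q * s\<^sup>2)\<bar> \<le> k * (t - s)" .
    show "\<bar>f t - f s\<bar> \<le> (LINT r:{s..t}|lborel. 2 * K * m r + k)"
      using A B st assms m(1)[of s t] unfolding f_def by (simp add: set_integral_affine)
  next
    show "AE t in lborel. b < t \<and> t < a \<longrightarrow> (\<exists>D\<le>0. (f has_real_derivative D) (at t))"
      using EVI_derivative[of x z]
    proof eventually_elim
      fix t
      assume *: "0 < t \<longrightarrow> (\<exists>D. ((\<lambda>s. (dist (S s x) z)\<^sup>2) has_real_derivative D) (at t) \<and> ereal (D / 2) + E (S t x) \<le> E z)"
      show "b < t \<and> t < a \<longrightarrow> (\<exists>D\<le>0. (f has_real_derivative D) (at t))"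
      proof
        assume t: "b < t \<and> t < a"
        then obtain D where D: "((\<lambda>s. (dist (S s x) z)\<^sup>2) has_real_derivative D) (at t)"
          "ereal (D / 2) + E (S t x) \<le> E z" using * assms by auto
        have "ereal (D / 2) + ereal (p + q * t) \<le> ereal (D / 2) + E (S t x)"
          using lower t by (intro add_left_mono) auto
        also have "\<dots> \<le> ereal e" using D ez by simp
        finally have "D / 2 + (p + q * t) \<le> e" by simp
        then have "D + (2 * (p - e) + q * (2 * t)) \<le> 0" by (simp add: field_simps)
        moreover have "(f has_real_derivative D + (2 * (p - e) + q * (2 * t))) (at t)"
          unfolding f_def by (rule derivative_eq_intros D refl | simp)+
        ultimately show "\<exists>D\<le>0. (f has_real_derivative D) (at t)" by blast
      qed
    qed
  qed
  then show ?thesis by (simp add: f_def algebra_simps)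
qed

lemma EVI_integrated:
  assumes "0 \<le> b" "b \<le> a" and ez: "E z \<le> ereal e"
    and lower: "\<And>r. b < r \<Longrightarrow> r < a \<Longrightarrow> ereal (p + q * r) \<le> E (S r x)"
  shows "(dist (S a x) z)\<^sup>2 + 2 * (p - e) * (a - b) + q * (a\<^sup>2 - b\<^sup>2) \<le> (dist (S b x) z)\<^sup>2"
proof (cases "b = a")
  case False
  then have "b < a" using assms by simp
  have S: "((\<lambda>t. S t x) \<longlongrightarrow> S b x) (at_right b)"
    using S_tendsto[OF \<open>0 \<le> b\<close>, of x] by (rule tendsto_within_subset) (use assms in auto)
  show ?thesis
  proof (rule tendsto_le[of "at_right b" "\<lambda>r. (dist (S r x) z)\<^sup>2" _ "\<lambda>r. (dist (S a x) z)\<^sup>2 + 2 * (p - e) * (a - r) + q * (a\<^sup>2 - r\<^sup>2)"])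
    show "eventually (\<lambda>r. (dist (S a x) z)\<^sup>2 + 2 * (p - e) * (a - r) + q * (a\<^sup>2 - r\<^sup>2) \<le> (dist (S r x) z)\<^sup>2) (at_right b)"
      using eventually_at_right_less[of b] eventually_at_right_real[OF \<open>b < a\<close>]
    proof eventually_elim
      case (elim r)
      show ?case using elim assms by (intro EVI_integrated_pos lower) auto
    qed
  qed (auto intro!: tendsto_intros S)
qed simp

text \<open>If the energy exceeded \<open>c = E (S s x)\<close> at time \<open>t\<close>, let \<open>a\<close> be the last time before \<open>t\<close> with energy
  at most \<open>c\<close>. After \<open>a\<close> the distance to \<open>S a x\<close> could not increase, so the flow would be stuck at
  \<open>S a x\<close>.\<close>

lemma energy_antimono:
  assumes "0 \<le> s" "s \<le> t"
  shows "E (S t x) \<le> E (S s x)"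
proof (rule ccontr)
  assume neg: "\<not> E (S t x) \<le> E (S s x)"
  define c where "c = E (S s x)"
  define A where "A = {r\<in>{s..t}. S r x \<in> {y. E y \<le> c}}"
  have "closed A" unfolding A_def
    using continuous_closed_preimage[OF continuous_on_subset[OF S_continuous[of x]], of "{s..t}" "{y. E y \<le> c}"]
      lsc_closed_sublevel[OF lsc, of c] assms by (auto simp: vimage_def Int_def)
  moreover have "s \<in> A" using assms by (auto simp: A_def c_def)
  moreover have bd: "bdd_above A" by (auto simp: A_def)
  ultimately have SA: "Sup A \<in> A" using closed_contains_Sup by blast
  define a where "a = Sup A"
  have a: "s \<le> a" "a \<le> t" "E (S a x) \<le> c" using SA by (auto simp: A_def a_def)
  have "a \<noteq> t" using a neg by (auto simp: c_def)
  have above: "c < E (S r x)" if "a < r" "r \<le> t" for r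
    using that a cSup_upper[OF _ bd, of r] by (fastforce simp: A_def a_def not_le[symmetric])
  have "c \<noteq> \<infinity>" using neg unfolding c_def by auto
  then obtain c' where c': "c = ereal c'" using not_minf[of "S s x"] unfolding c_def by (cases "E (S s x)") auto
  have "(dist (S t x) (S a x))\<^sup>2 + 2 * (c' - c') * (t - a) + 0 * (t\<^sup>2 - a\<^sup>2) \<le> (dist (S a x) (S a x))\<^sup>2"
    using above a assms c' by (intro EVI_integrated) (auto intro: less_imp_le)
  then have "S t x = S a x" by simp
  then show False using a neg by (simp add: c_def)
qed

text \<open>The inequality tested with a point of finite energy fails at times of infinite energy, and by
  monotonicity infinite energy at \<open>t\<close> would mean infinite energy on all of \<open>(0, t)\<close>.\<close>

lemma energy_finite:
  assumes "0 < t"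
  obtains c where "E (S t x) = ereal c"
proof -
  obtain v where v: "E v < \<infinity>" using proper by auto
  have "E (S t x) \<noteq> \<infinity>"
  proof
    assume inf: "E (S t x) = \<infinity>"
    have "AE r in lborel. r \<notin> {0<..<t}"
      using EVI_derivative[of x v]
    proof eventually_elim
      case (elim r)
      have "E (S r x) = \<infinity>" if "0 < r" "r < t" using energy_antimono[of r t x] inf that by auto
      then show ?case using elim v by auto
    qed
    then have "emeasure lborel {0<..<t} = 0"
      by (subst (asm) AE_iff_measurable[of "{0<..<t}"]) auto
    then show False using assms by simp
  qed
  then show thesis using that not_minf[of "S t x"] by (cases "E (S t x)") auto
qed

text \<open>Move the two arguments one after the other, each time testing with the current position of the
  other one; the energies of \<open>y\<close> cancel.\<close>

lemma contraction_step:
  assumes "0 < s" "s \<le> t"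
  shows "ereal ((dist (S t x) (S t y))\<^sup>2) + 2 * (t - s) * E (S t x) \<le> ereal ((dist (S s x) (S s y))\<^sup>2) + 2 * (t - s) * E (S s x)"
proof -
  obtain ct where ct: "E (S t x) = ereal ct" using energy_finite[of t x] assms by auto
  obtain cs where cs: "E (S s x) = ereal cs" using energy_finite[of s x] assms by auto
  obtain dt where dt: "E (S t y) = ereal dt" using energy_finite[of t y] assms by auto
  have "(dist (S t x) (S t y))\<^sup>2 + 2 * (ct - dt) * (t - s) + 0 * (t\<^sup>2 - s\<^sup>2) \<le> (dist (S s x) (S t y))\<^sup>2"
    using assms dt ct by (intro EVI_integrated) (auto simp flip: ct intro: energy_antimono)
  moreover have "(dist (S t y) (S s x))\<^sup>2 + 2 * (dt - cs) * (t - s) + 0 * (t\<^sup>2 - s\<^sup>2) \<le> (dist (S s y) (S s x))\<^sup>2"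
    using assms cs dt by (intro EVI_integrated) (auto simp flip: dt intro: energy_antimono)
  ultimately show ?thesis by (simp add: ct cs dist_commute algebra_simps)
qed

text \<open>Over \<open>n\<close> equal steps the energy terms of \<open>contraction_step\<close> telescope, with a prefactor of order
  \<open>1 / n\<close>.\<close>

lemma contraction:
  assumes "0 \<le> t"
  shows "dist (S t x) (S t y) \<le> dist x y"
proof (cases "t = 0")
  case False
  then have t: "0 < t" using assms by simp
  have pos: "(dist (S t x) (S t y))\<^sup>2 \<le> (dist (S s x) (S s y))\<^sup>2" if s: "0 < s" "s < t" for s
  proof -
    define \<phi> where "\<phi> r = real_of_ereal (E (S r x))" for r
    have \<phi>: "E (S r x) = ereal (\<phi> r)" if "0 < r" for r
      using energy_finite[OF that, of x] by (metis \<phi>_def real_of_ereal.simps(1))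
    define \<delta> where "\<delta> r = (dist (S r x) (S r y))\<^sup>2" for r
    have bound: "\<delta> t \<le> \<delta> s + 2 * ((t - s) / real (Suc n)) * (\<phi> s - \<phi> t)" for n
    proof -
      define h where "h = (t - s) / real (Suc n)"
      have h: "0 \<le> h" using s by (simp add: h_def)
      have "\<delta> (s + real k * h) \<le> \<delta> s + 2 * h * (\<phi> s - \<phi> (s + real k * h))" for k
      proof (induction k)
        case (Suc k)
        have "0 < s + real k * h" using s h by (simp add: add_pos_nonneg)
        moreover from this have "0 < s + real (Suc k) * h" using h by (simp add: algebra_simps)
        ultimately have "\<delta> (s + real (Suc k) * h) + 2 * h * \<phi> (s + real (Suc k) * h)
            \<le> \<delta> (s + real k * h) + 2 * h * \<phi> (s + real k * h)"
          using contraction_step[of "s + real k * h" "s + real (Suc k) * h" x y] h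
          by (simp add: \<phi> \<delta>_def algebra_simps)
        then show ?case using Suc by (simp add: algebra_simps)
      qed simp
      from this[of "Suc n"] show ?thesis by (simp add: h_def)
    qed
    have "(\<lambda>n. \<delta> s + 2 * ((t - s) / real (Suc n)) * (\<phi> s - \<phi> t)) \<longlonglongrightarrow> \<delta> s + 2 * ((t - s) * 0) * (\<phi> s - \<phi> t)"
      unfolding divide_inverse by (intro tendsto_intros LIMSEQ_inverse_real_of_nat)
    then have "\<delta> t \<le> \<delta> s" using bound by (intro LIMSEQ_le_const[where a = "\<delta> t"]) auto
    then show ?thesis by (simp add: \<delta>_def)
  qed
  have S: "((\<lambda>r. S r x) \<longlongrightarrow> S 0 x) (at_right 0)" for x
    by (rule tendsto_within_subset[OF S_tendsto]) auto
  have "(dist (S t x) (S t y))\<^sup>2 \<le> (dist (S 0 x) (S 0 y))\<^sup>2"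
  proof (rule tendsto_lowerbound)
    show "((\<lambda>s. (dist (S s x) (S s y))\<^sup>2) \<longlongrightarrow> (dist (S 0 x) (S 0 y))\<^sup>2) (at_right 0)"
      by (intro tendsto_intros S)
    show "eventually (\<lambda>s. (dist (S t x) (S t y))\<^sup>2 \<le> (dist (S s x) (S s y))\<^sup>2) (at_right 0)"
      using eventually_at_right_real[OF t] by eventually_elim (use pos in auto)
  qed simp
  then show ?thesis by (simp add: S_0 power2_le_iff_abs_le)
qed (simp add: S_0)

text \<open>The infimum is attained, as lower semicontinuity and the continuity of the flow make the set of
  admissible times closed. The threshold increasing in \<open>r\<close> ensures that it is reached in finite time
  even if the flow never enters the sublevel \<open>E \<le> M\<close>.\<close>

definition retraction_time :: "real \<Rightarrow> 'x \<Rightarrow> real" where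
  "retraction_time M x = Inf {r. 0 \<le> r \<and> E (S r x) \<le> ereal (M + r)}"

definition retract :: "real \<Rightarrow> 'x \<Rightarrow> 'x" where
  "retract M x = S (retraction_time M x) x"

lemma retraction_time:
  shows retraction_time_nonneg: "0 \<le> retraction_time M x"
    and energy_retract: "E (retract M x) \<le> ereal (M + retraction_time M x)"
    and energy_before: "0 \<le> r \<Longrightarrow> r < retraction_time M x \<Longrightarrow> ereal (M + r) < E (S r x)"
proof -
  define A where "A = {r. 0 \<le> r \<and> E (S r x) \<le> ereal (M + r)}"
  obtain c where c: "E (S 1 x) = ereal c" using energy_finite[of 1 x] by auto
  define r where "r = max 1 (c - M)"
  have "E (S r x) \<le> ereal c" using energy_antimono[of 1 r x] c by (auto simp: r_def)
  also have "ereal c \<le> ereal (M + r)" by (auto simp: r_def)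
  finally have "r \<in> A" by (auto simp: A_def r_def)
  then have ne: "A \<noteq> {}" by auto
  have bd: "bdd_below A" by (rule bdd_belowI[of _ 0]) (auto simp: A_def)
  have cl: "closed A"
    unfolding closed_sequential_limits
  proof (intro allI impI)
    fix f l assume fl: "(\<forall>n. f n \<in> A) \<and> f \<longlonglongrightarrow> l"
    then have f: "\<And>n. 0 \<le> f n" "\<And>n. E (S (f n) x) \<le> ereal (M + f n)" "f \<longlonglongrightarrow> l" by (auto simp: A_def)
    have "0 \<le> l" using f LIMSEQ_le_const by blast
    have "(\<lambda>n. S (f n) x) \<longlonglongrightarrow> S l x"
      using continuous_on_tendsto_compose[OF S_continuous, of f l sequentially x] f \<open>0 \<le> l\<close> by auto
    then have "E (S l x) \<le> ereal (M + l)"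
      by (rule lsc_le_limit[OF lsc, where c = "\<lambda>n. ereal (M + f n)"])
         (use f in \<open>auto intro!: tendsto_intros\<close>)
    then show "l \<in> A" using \<open>0 \<le> l\<close> by (simp add: A_def)
  qed
  have "Inf A \<in> A" using closed_contains_Inf[OF ne bd cl] .
  moreover have "Inf A = retraction_time M x" by (simp add: A_def retraction_time_def)
  ultimately show "0 \<le> retraction_time M x" "E (retract M x) \<le> ereal (M + retraction_time M x)"
    by (auto simp: A_def retract_def)
  show "0 \<le> r \<Longrightarrow> r < retraction_time M x \<Longrightarrow> ereal (M + r) < E (S r x)" for r
    using cInf_lower[OF _ bd, of r] \<open>Inf A = _\<close> by (fastforce simp: A_def not_le[symmetric])
qed

lemma retraction_time_eq_0_iff: "retraction_time M x = 0 \<longleftrightarrow> E x \<le> ereal M"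
  using energy_retract[of M x] energy_before[of 0 M x] retraction_time_nonneg[of M x]
  by (force simp: retract_def S_0)

lemma retract_eq: "E x \<le> ereal M \<Longrightarrow> retract M x = x"
  using retraction_time_eq_0_iff[of M x] by (simp add: retract_def S_0)

text \<open>Let \<open>b \<le> a\<close> be the times of \<open>y\<close> and \<open>x\<close>. Up to time \<open>b\<close> both points flow and their distance does
  not grow. Between \<open>b\<close> and \<open>a\<close> only \<open>x\<close> moves; its energy at time \<open>r\<close> exceeds \<open>M + r\<close> while that of
  the fixed point is at most \<open>M + b\<close>, so half the squared distance decreases by at least the integral
  of \<open>r - b\<close>.\<close>

lemma retract_improved_contraction:
  "(dist (retract M x) (retract M y))\<^sup>2 + (retraction_time M x - retraction_time M y)\<^sup>2 \<le> (dist x y)\<^sup>2"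
proof -
  have *: "(dist (retract M x) (retract M y))\<^sup>2 + (retraction_time M x - retraction_time M y)\<^sup>2 \<le> (dist x y)\<^sup>2"
    if le: "retraction_time M y \<le> retraction_time M x" for x y
  proof -
    define a b where "a = retraction_time M x" and "b = retraction_time M y"
    have ab: "0 \<le> b" "b \<le> a" using le retraction_time_nonneg by (auto simp: a_def b_def)
    have "(dist (S a x) (S b y))\<^sup>2 + 2 * (M - (M + b)) * (a - b) + 1 * (a\<^sup>2 - b\<^sup>2) \<le> (dist (S b x) (S b y))\<^sup>2"
      using ab energy_retract[of M y] energy_before[of _ M x]
      by (intro EVI_integrated) (auto simp: a_def b_def retract_def intro: less_imp_le)
    moreover have "2 * (M - (M + b)) * (a - b) + 1 * (a\<^sup>2 - b\<^sup>2) = (a - b)\<^sup>2"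
      by (simp add: power2_eq_square algebra_simps)
    moreover have "(dist (S b x) (S b y))\<^sup>2 \<le> (dist x y)\<^sup>2"
      using contraction[OF ab(1)] by (intro power_mono) auto
    ultimately show ?thesis unfolding retract_def a_def[symmetric] b_def[symmetric] by linarith
  qed
  show ?thesis using *[of x y] *[of y x] by (cases "retraction_time M y \<le> retraction_time M x")
      (auto simp: dist_commute power2_commute)
qed

end

section \<open>Hausdorff measure\<close>

lemma subadditive_of_countably:
  fixes \<mu> :: "'a set \<Rightarrow> ennreal"
  assumes empty: "\<mu> {} = 0" and csub: "\<And>A. \<mu> (\<Union>i. A i) \<le> (\<Sum>i::nat. \<mu> (A i))"
  shows "\<mu> (X \<union> Y) \<le> \<mu> X + \<mu> Y"
proof -
  define A where "A i = (if i = 0 then X else if i = (1::nat) then Y else {})" for i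
  have "X \<union> Y = (\<Union>i. A i)" by (auto simp: A_def split: if_splits)
  then have "\<mu> (X \<union> Y) \<le> (\<Sum>i. \<mu> (A i))"
    using csub[of A] by simp
  also have "\<dots> = (\<Sum>i\<in>{0, 1}. \<mu> (A i))"
    by (rule suminf_finite) (auto simp: empty A_def)
  finally show ?thesis by (simp add: A_def)
qed

text \<open>The part of \<open>A - F\<close> at distance more than \<open>1 / (n + 1)\<close> from \<open>F\<close> splits off additively. What is left
  is a union of rings around \<open>F\<close>; rings of equal parity are separated from each other, so their
  measures have a finite sum and the tail is negligible.\<close>

lemma metric_outer_measure_closed:
  fixes \<mu> :: "'a::metric_space set \<Rightarrow> ennreal"
  assumes mono: "\<And>A B. A \<subseteq> B \<Longrightarrow> \<mu> A \<le> \<mu> B" and empty: "\<mu> {} = 0"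
    and csub: "\<And>A. \<mu> (\<Union>i. A i) \<le> (\<Sum>i::nat. \<mu> (A i))"
    and metric: "\<And>A B \<eta>. 0 < \<eta> \<Longrightarrow> (\<And>x y. x \<in> A \<Longrightarrow> y \<in> B \<Longrightarrow> \<eta> \<le> dist x y) \<Longrightarrow> \<mu> A + \<mu> B \<le> \<mu> (A \<union> B)"
    and F: "closed F"
  shows "\<mu> (A \<inter> F) + \<mu> (A - F) \<le> \<mu> A"
proof (cases "F = {} \<or> \<mu> A = \<infinity>")
  case True
  then show ?thesis by (auto simp: empty)
next
  case False
  then have F0: "F \<noteq> {}" and fin: "\<mu> A < \<infinity>" by (auto simp: less_top)
  note sub2 = subadditive_of_countably[OF empty csub]
  define d where "d x = infdist x F" for x
  have d_dist: "d y - d x \<le> dist x y" for x y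
    using infdist_triangle[of y F x] by (simp add: d_def dist_commute)
  define r where "r k = inverse (real (Suc k))" for k
  have r0: "0 < r k" for k by (simp add: r_def)
  have rS: "r (Suc k) < r k" for k by (simp add: r_def field_simps)
  have rm: "r m \<le> r k" if "k \<le> m" for k m using that by (simp add: r_def field_simps)
  define Q where "Q n = {x\<in>A. r n < d x}" for n
  define R where "R k = {x\<in>A. r (Suc k) < d x \<and> d x \<le> r k}" for k
  \<comment> \<open>Additivity over every second ring; \<open>j\<close> is the parity.\<close>
  have ringsum: "(\<Sum>i<n. \<mu> (R (2 * i + j))) \<le> \<mu> (\<Union>i<n. R (2 * i + j))" for j n
  proof (induction n)
    case (Suc n)
    have "(\<Sum>i<Suc n. \<mu> (R (2 * i + j))) \<le> \<mu> (\<Union>i<n. R (2 * i + j)) + \<mu> (R (2 * n + j))"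
      using Suc by (simp add: add_mono)
    also have "\<dots> \<le> \<mu> ((\<Union>i<n. R (2 * i + j)) \<union> R (2 * n + j))"
    proof (cases n)
      case (Suc m)
      show ?thesis
      proof (rule metric)
        show "0 < r (Suc (2 * m + j)) - r (2 * n + j)"
          using rS[of "Suc (2 * m + j)"] by (simp add: Suc)
        fix x y assume "x \<in> (\<Union>i<n. R (2 * i + j))" and y: "y \<in> R (2 * n + j)"
        then obtain i where i: "i < n" "x \<in> R (2 * i + j)" by auto
        then have "r (Suc (2 * m + j)) \<le> r (Suc (2 * i + j))" using Suc by (intro rm) auto
        then show "r (Suc (2 * m + j)) - r (2 * n + j) \<le> dist x y"
          using i y d_dist[where x = y and y = x] by (auto simp: R_def dist_commute)
      qed
    qed (simp add: empty)
    also have "(\<Union>i<n. R (2 * i + j)) \<union> R (2 * n + j) = (\<Union>i<Suc n. R (2 * i + j))"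
      by (auto simp: lessThan_Suc)
    finally show ?case .
  qed (simp add: empty)
  have ringsA: "(\<Sum>i<n. \<mu> (R (2 * i + j))) \<le> \<mu> A" for j n
    using order_trans[OF ringsum mono] by (auto simp: R_def)
  have "(\<Sum>k. \<mu> (R k)) \<le> \<mu> A + \<mu> A"
  proof (rule suminf_le_const)
    fix n
    have "(\<Sum>k<n. \<mu> (R k)) \<le> (\<Sum>k<2 * n. \<mu> (R k))" by (intro sum_mono2) auto
    also have "\<dots> = (\<Sum>i<n. \<mu> (R (2 * i + 0))) + (\<Sum>i<n. \<mu> (R (2 * i + 1)))"
      by (induction n) (auto simp: algebra_simps)
    also have "\<dots> \<le> \<mu> A + \<mu> A" by (intro add_mono ringsA)
    finally show "(\<Sum>k<n. \<mu> (R k)) \<le> \<mu> A + \<mu> A" .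
  qed simp
  then have sfin: "(\<Sum>k. \<mu> (R k)) < \<infinity>" using fin by (auto intro: le_less_trans simp: ennreal_add_eq_top less_top)
  show ?thesis
  proof (rule ennreal_le_epsilon)
    fix e :: real assume "0 < e"
    define T where "T n = (\<Sum>k. \<mu> (R (k + n)))" for n
    have split: "(\<Sum>k. \<mu> (R k)) = T n + (\<Sum>k<n. \<mu> (R k))" for n
      unfolding T_def by (rule suminf_offset) simp
    have "\<exists>n. (\<Sum>k. \<mu> (R k)) \<le> (\<Sum>k<n. \<mu> (R k)) + e"
    proof (cases "(\<Sum>k. \<mu> (R k)) = 0")
      case False
      then have "(\<Sum>k. \<mu> (R k)) - e < (\<Sum>k. \<mu> (R k))"
        using sfin \<open>0 < e\<close> by (intro ennreal_between) (auto simp: less_top zero_less_iff_neq_zero)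
      then obtain n where "(\<Sum>k. \<mu> (R k)) - e < (\<Sum>k<n. \<mu> (R k))"
        unfolding suminf_eq_SUP less_SUP_iff by auto
      from less_imp_le[OF this] show ?thesis by (intro exI[of _ n]) (simp add: ennreal_minus_le_iff add.commute)
    qed auto
    then obtain n where "(\<Sum>k. \<mu> (R k)) \<le> (\<Sum>k<n. \<mu> (R k)) + e" by blast
    then have "(\<Sum>k<n. \<mu> (R k)) + T n \<le> (\<Sum>k<n. \<mu> (R k)) + e"
      by (simp only: split[of n] add.commute[of "T n"])
    moreover have "(\<Sum>k<n. \<mu> (R k)) \<noteq> \<infinity>" using split[of n] sfin by (intro less_imp_neq) (simp add: less_top)
    ultimately have T: "T n \<le> e"
      by (simp only: ennreal_add_left_cancel_le) blast
    have "A - F \<subseteq> Q n \<union> (\<Union>k. R (k + n))"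
    proof
      fix x assume x: "x \<in> A - F"
      then have "0 < d x" using F F0 in_closed_iff_infdist_zero[of F x] infdist_nonneg[of x F]
        by (auto simp: d_def less_le)
      then have "\<exists>m. r m < d x" unfolding r_def using reals_Archimedean by blast
      then obtain m0 where "r m0 < d x" "\<forall>k<m0. \<not> r k < d x"
        using exists_least_iff[of "\<lambda>m. r m < d x"] by blast
      then have m0: "r m0 < d x" "\<And>k. k < m0 \<Longrightarrow> d x \<le> r k" by (auto simp: not_less)
      show "x \<in> Q n \<union> (\<Union>k. R (k + n))"
      proof (cases "m0 \<le> n")
        case True
        then show ?thesis using x m0 rm[of m0 n] by (auto simp: Q_def)
      next
        case False
        then obtain k where k: "m0 = Suc (k + n)" by (metis add.commute less_imp_Suc_add not_le)
        then have "x \<in> R (k + n)" using x m0 by (auto simp: R_def)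
        then show ?thesis by blast
      qed
    qed
    then have "\<mu> (A - F) \<le> \<mu> (Q n) + \<mu> (\<Union>k. R (k + n))"
      using order_trans[OF mono sub2] by blast
    also have "\<dots> \<le> \<mu> (Q n) + e"
      using order_trans[OF csub[of "\<lambda>k. R (k + n)"] T[unfolded T_def]] by (intro add_mono) auto
    finally have "\<mu> (A \<inter> F) + \<mu> (A - F) \<le> \<mu> (A \<inter> F) + \<mu> (Q n) + e"
      by (simp add: add_mono add.assoc)
    also have "\<mu> (A \<inter> F) + \<mu> (Q n) \<le> \<mu> (A \<inter> F \<union> Q n)"
    proof (rule metric[of "r n"])
      fix x y assume "x \<in> A \<inter> F" "y \<in> Q n"
      then show "r n \<le> dist x y" using d_dist[of y x] by (auto simp: Q_def d_def dist_commute)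
    qed (rule r0)
    also have "\<mu> (A \<inter> F \<union> Q n) \<le> \<mu> A" by (intro mono) (auto simp: Q_def)
    finally show "\<mu> (A \<inter> F) + \<mu> (A - F) \<le> \<mu> A + e" by (simp add: add_mono)
  qed
qed

text \<open>Closed sets satisfy the Caratheodory criterion, and the sets satisfying it form a \<open>\<sigma>\<close>-algebra on
  which the outer measure is a measure.\<close>

lemma metric_outer_measure_space_borel:
  fixes \<mu> :: "'a::metric_space set \<Rightarrow> ennreal"
  assumes mono: "\<And>A B. A \<subseteq> B \<Longrightarrow> \<mu> A \<le> \<mu> B" and empty: "\<mu> {} = 0"
    and csub: "\<And>A. \<mu> (\<Union>i. A i) \<le> (\<Sum>i::nat. \<mu> (A i))"
    and metric: "\<And>A B \<eta>. 0 < \<eta> \<Longrightarrow> (\<And>x y. x \<in> A \<Longrightarrow> y \<in> B \<Longrightarrow> \<eta> \<le> dist x y) \<Longrightarrow> \<mu> A + \<mu> B \<le> \<mu> (A \<union> B)"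
  shows "measure_space UNIV (sets borel) \<mu>"
proof -
  interpret sigma_algebra UNIV "Pow (UNIV :: 'a set)" by (rule sigma_algebra_Pow)
  have oms: "outer_measure_space (Pow UNIV) \<mu>"
    unfolding outer_measure_space_def positive_def increasing_def countably_subadditive_def
    using mono empty csub by auto
  define L where "L = lambda_system UNIV (Pow UNIV) \<mu>"
  have ms: "measure_space UNIV L \<mu>" unfolding L_def by (rule caratheodory_lemma[OF oms])
  then interpret L: sigma_algebra UNIV L by (simp add: measure_space_def)
  have "F \<in> L" if "closed F" for F
  proof -
    have "\<mu> (A \<inter> F) + \<mu> (A - F) = \<mu> A" for A
    proof (rule antisym)
      show "\<mu> (A \<inter> F) + \<mu> (A - F) \<le> \<mu> A"
        by (rule metric_outer_measure_closed[OF mono empty csub metric that])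
      show "\<mu> A \<le> \<mu> (A \<inter> F) + \<mu> (A - F)"
        using subadditive_of_countably[OF empty csub, of "A \<inter> F" "A - F"] by (simp add: Int_Diff_Un)
    qed
    then show ?thesis unfolding L_def lambda_system_eq by auto
  qed
  then have "sigma_sets UNIV (Collect closed) \<subseteq> L" by (intro L.sigma_sets_subset) auto
  then have "sets borel \<subseteq> L" unfolding borel_eq_closed by (simp add: sets_measure_of)
  moreover have "sigma_algebra UNIV (sets (borel :: 'a measure))"
    using sets.sigma_algebra_axioms[of "borel :: 'a measure"] by simp
  moreover have "countably_additive (sets borel) \<mu>"
  proof (rule countably_additiveI)
    fix A :: "nat \<Rightarrow> 'a set"
    assume A: "range A \<subseteq> sets borel" "disjoint_family A" "\<Union> (range A) \<in> sets borel"
    have "countably_additive L \<mu>" using ms by (simp add: measure_space_def)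
    then show "(\<Sum>i. \<mu> (A i)) = \<mu> (\<Union> (range A))"
      using A(2) subset_trans[OF A(1) \<open>sets borel \<subseteq> L\<close>] subsetD[OF \<open>sets borel \<subseteq> L\<close> A(3)]
      unfolding countably_additive_def by blast
  qed
  ultimately show ?thesis by (simp add: measure_space_def positive_def empty)
qed

lemma hausdorff_weight_empty [simp]: "hausdorff_weight s {} = 0"
  by (simp add: hausdorff_weight_def)

text \<open>The size-\<open>\<delta>\<close> approximation of the Hausdorff outer measure.\<close>

definition hausdorff_pre :: "nat \<Rightarrow> real \<Rightarrow> 'a::metric_space set \<Rightarrow> ennreal" where
  "hausdorff_pre s \<delta> A =
     (INF U\<in>{U :: nat \<Rightarrow> 'a set. A \<subseteq> (\<Union>i. U i) \<and> (\<forall>i. bounded (U i) \<and> diameter (U i) \<le> \<delta>)}.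
          (\<Sum>i. hausdorff_weight s (U i)))"

lemma hausdorff_outer_eq: "hausdorff_outer s A = (SUP \<delta>\<in>{0<..}. hausdorff_pre s \<delta> A)"
  by (simp add: hausdorff_outer_def hausdorff_pre_def)

lemma hausdorff_pre_le:
  assumes "A \<subseteq> (\<Union>i. U i)" "\<And>i. bounded (U i)" "\<And>i. diameter (U i) \<le> \<delta>"
  shows "hausdorff_pre s \<delta> A \<le> (\<Sum>i. hausdorff_weight s (U i))"
  unfolding hausdorff_pre_def using assms by (intro INF_lower) auto

lemma hausdorff_pre_lessE:
  assumes "hausdorff_pre s \<delta> A < c"
  obtains U where "A \<subseteq> (\<Union>i. U i)" "\<And>i. bounded (U i)" "\<And>i. diameter (U i) \<le> \<delta>"
    "(\<Sum>i. hausdorff_weight s (U i)) < c"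
  using assms unfolding hausdorff_pre_def INF_less_iff by auto

lemma hausdorff_pre_antimono: "\<delta> \<le> \<delta>' \<Longrightarrow> hausdorff_pre s \<delta>' A \<le> hausdorff_pre s \<delta> A"
  unfolding hausdorff_pre_def by (intro INF_superset_mono) (auto intro: order_trans)

lemma hausdorff_pre_le_outer: "0 < \<delta> \<Longrightarrow> hausdorff_pre s \<delta> A \<le> hausdorff_outer s A"
  unfolding hausdorff_outer_eq by (intro SUP_upper) auto

lemma hausdorff_outer_mono:
  assumes "A \<subseteq> B"
  shows "hausdorff_outer s A \<le> hausdorff_outer s B"
  unfolding hausdorff_outer_eq hausdorff_pre_def
  using assms by (intro SUP_mono' INF_superset_mono) auto

lemma hausdorff_outer_empty: "hausdorff_outer s {} = 0"
proof -
  have "hausdorff_pre s \<delta> ({} :: 'a set) \<le> 0" if "0 < \<delta>" for \<delta>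
    using hausdorff_pre_le[of "{} :: 'a set" "\<lambda>_. {}" \<delta> s] that by simp
  then show ?thesis unfolding hausdorff_outer_eq by (auto intro!: antisym SUP_least)
qed

lemma hausdorff_pre_countably_subadditive:
  "hausdorff_pre s \<delta> (\<Union>i. A i) \<le> (\<Sum>i::nat. hausdorff_pre s \<delta> (A i))"
proof (rule ennreal_le_epsilon)
  fix e :: real assume fin: "(\<Sum>i::nat. hausdorff_pre s \<delta> (A i)) < top" and "0 < e"
  define h where "h i = ennreal (e * (1/2) ^ Suc i)" for i
  have hpos: "0 < h i" for i using \<open>0 < e\<close> by (simp add: h_def)
  have hs: "(\<Sum>i. h i) = ennreal e"
    unfolding h_def using sums_mult[OF power_half_series, of e] \<open>0 < e\<close>
    by (intro suminf_ennreal_eq) auto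
  have "hausdorff_pre s \<delta> (A i) < hausdorff_pre s \<delta> (A i) + h i" for i
  proof -
    have "hausdorff_pre s \<delta> (A i) < top"
      using fin sum_le_suminf[of "\<lambda>i. hausdorff_pre s \<delta> (A i)" "{i}"] by (simp add: le_less_trans)
    then show ?thesis using hpos[of i] using ennreal_add_left_cancel_less[of "hausdorff_pre s \<delta> (A i)" 0 "h i"]
      by (simp add: less_top)
  qed
  from hausdorff_pre_lessE[OF this] have "\<exists>U. A i \<subseteq> (\<Union>j. U j) \<and> (\<forall>j. bounded (U j) \<and> diameter (U j) \<le> \<delta>) \<and>
      (\<Sum>j::nat. hausdorff_weight s (U j)) < hausdorff_pre s \<delta> (A i) + h i" for i
    by metis
  then obtain U where U: "\<And>i. A i \<subseteq> (\<Union>j. U i j)" "\<And>i j. bounded (U i j)" "\<And>i j. diameter (U i j) \<le> \<delta>"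
    "\<And>i. (\<Sum>j::nat. hausdorff_weight s (U i j)) < hausdorff_pre s \<delta> (A i) + h i"
    by metis
  have "(\<Union>i. A i) \<subseteq> (\<Union>k. case_prod U (prod_decode k))"
  proof clarify
    fix x i assume "x \<in> A i"
    then obtain j where "x \<in> U i j" using U(1) by blast
    then show "x \<in> (\<Union>k. case_prod U (prod_decode k))"
      by (intro UN_I[of "prod_encode (i, j)"]) auto
  qed
  then have "hausdorff_pre s \<delta> (\<Union>i. A i) \<le> (\<Sum>k. hausdorff_weight s (case_prod U (prod_decode k)))"
    using U by (intro hausdorff_pre_le) (auto split: prod.split)
  also have "\<dots> = (\<Sum>i. \<Sum>j. hausdorff_weight s (U i j))"
    by (rule suminf_ennreal_2dimen) simp
  also have "\<dots> \<le> (\<Sum>i. hausdorff_pre s \<delta> (A i) + h i)"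
    using U(4) by (intro suminf_le) (auto intro: less_imp_le)
  also have "\<dots> = (\<Sum>i. hausdorff_pre s \<delta> (A i)) + e"
    by (subst suminf_add[symmetric]) (auto simp: hs)
  finally show "hausdorff_pre s \<delta> (\<Union>i. A i) \<le> (\<Sum>i. hausdorff_pre s \<delta> (A i)) + e" .
qed

lemma hausdorff_outer_countably_subadditive:
  "hausdorff_outer s (\<Union>i. A i) \<le> (\<Sum>i::nat. hausdorff_outer s (A i))"
  unfolding hausdorff_outer_eq[of s "\<Union>i. A i"]
proof (rule SUP_least)
  fix \<delta> :: real assume "\<delta> \<in> {0<..}"
  then have "(\<Sum>i. hausdorff_pre s \<delta> (A i)) \<le> (\<Sum>i. hausdorff_outer s (A i))"
    by (intro suminf_le hausdorff_pre_le_outer) auto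
  then show "hausdorff_pre s \<delta> (\<Union>i. A i) \<le> (\<Sum>i. hausdorff_outer s (A i))"
    by (rule order_trans[OF hausdorff_pre_countably_subadditive])
qed

text \<open>A covering set smaller than the distance of \<open>A\<close> and \<open>B\<close> meets only one of them.\<close>

lemma hausdorff_outer_metric:
  assumes "0 < \<eta>" and sep: "\<And>x y. x \<in> A \<Longrightarrow> y \<in> B \<Longrightarrow> \<eta> \<le> dist x y"
  shows "hausdorff_outer s A + hausdorff_outer s B \<le> hausdorff_outer s (A \<union> B)"
proof -
  have *: "hausdorff_pre s \<delta> A + hausdorff_pre s \<delta> B \<le> hausdorff_outer s (A \<union> B)" if "0 < \<delta>" for \<delta>
  proof -
    define \<gamma> where "\<gamma> = min \<delta> (\<eta> / 2)"
    have \<gamma>: "0 < \<gamma>" "\<gamma> < \<eta>" "\<gamma> \<le> \<delta>" using that \<open>0 < \<eta>\<close> by (auto simp: \<gamma>_def)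
    have "hausdorff_pre s \<gamma> A + hausdorff_pre s \<gamma> B \<le> hausdorff_pre s \<gamma> (A \<union> B)"
      unfolding hausdorff_pre_def[of s \<gamma> "A \<union> B"]
    proof (rule INF_greatest, clarify)
      fix U assume U: "A \<union> B \<subseteq> (\<Union>i. U i)" "\<forall>i::nat. bounded (U i) \<and> diameter (U i) \<le> \<gamma>"
      have one: "U i \<inter> A = {} \<or> U i \<inter> B = {}" for i
      proof (rule ccontr)
        assume "\<not> ?thesis"
        then obtain x y where xy: "x \<in> U i" "x \<in> A" "y \<in> U i" "y \<in> B" by auto
        then have "dist x y \<le> \<gamma>" using U(2) diameter_bounded_bound order_trans by blast
        then show False using sep xy \<gamma> by fastforce
      qed
      define V where "V C i = (if U i \<inter> C = {} then {} else U i)" for C i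
      have "hausdorff_pre s \<gamma> C \<le> (\<Sum>i. hausdorff_weight s (V C i))" if "C \<subseteq> A \<union> B" for C
        proof (rule hausdorff_pre_le)
        show "C \<subseteq> (\<Union>i. V C i)" using U(1) that by (fastforce simp: V_def)
        show "bounded (V C i)" "diameter (V C i) \<le> \<gamma>" for i using U(2) \<gamma> by (auto simp: V_def)
      qed
      then have "hausdorff_pre s \<gamma> A + hausdorff_pre s \<gamma> B
          \<le> (\<Sum>i. hausdorff_weight s (V A i)) + (\<Sum>i. hausdorff_weight s (V B i))"
        by (intro add_mono) auto
      also have "\<dots> = (\<Sum>i. hausdorff_weight s (V A i) + hausdorff_weight s (V B i))"
        by (rule suminf_add) auto
      also have "\<dots> \<le> (\<Sum>i. hausdorff_weight s (U i))"
        using one by (intro suminf_le) (auto simp: V_def)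
      finally show "hausdorff_pre s \<gamma> A + hausdorff_pre s \<gamma> B \<le> (\<Sum>i. hausdorff_weight s (U i))" .
    qed
    also have "\<dots> \<le> hausdorff_outer s (A \<union> B)" using \<gamma> by (intro hausdorff_pre_le_outer)
    finally have small: "hausdorff_pre s \<gamma> A + hausdorff_pre s \<gamma> B \<le> hausdorff_outer s (A \<union> B)" .
    have "hausdorff_pre s \<delta> A + hausdorff_pre s \<delta> B \<le> hausdorff_pre s \<gamma> A + hausdorff_pre s \<gamma> B"
      using \<gamma> by (intro add_mono hausdorff_pre_antimono)
    then show ?thesis using small by (rule order_trans)
  qed
  have "hausdorff_outer s A + hausdorff_outer s B
      = (SUP \<delta>\<in>{0<..}. hausdorff_pre s \<delta> A + hausdorff_pre s \<delta> B)"
    unfolding hausdorff_outer_eq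
  proof (rule SUP_add_directed_ennreal[symmetric])
    fix i j :: real assume "i \<in> {0<..}" "j \<in> {0<..}"
    then show "\<exists>k\<in>{0<..}. hausdorff_pre s i A + hausdorff_pre s j B \<le> hausdorff_pre s k A + hausdorff_pre s k B"
      by (intro bexI[of _ "min i j"] add_mono hausdorff_pre_antimono) auto
  qed
  also have "\<dots> \<le> hausdorff_outer s (A \<union> B)" using * by (intro SUP_least) auto
  finally show ?thesis .
qed

lemma emeasure_hausdorff_measure:
  assumes "A \<in> sets borel"
  shows "emeasure (hausdorff_measure s) A = hausdorff_outer s A"
  unfolding hausdorff_measure_def
proof (intro emeasure_measure_of_sigma)
  have ms: "measure_space UNIV (sets borel) (hausdorff_outer s :: 'a set \<Rightarrow> ennreal)"
    by (rule metric_outer_measure_space_borel)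
       (fact hausdorff_outer_mono hausdorff_outer_empty hausdorff_outer_countably_subadditive hausdorff_outer_metric)+
  then show "sigma_algebra UNIV (sets (borel :: 'a measure))"
    "positive (sets borel) (hausdorff_outer s :: 'a set \<Rightarrow> ennreal)"
    "countably_additive (sets borel) (hausdorff_outer s :: 'a set \<Rightarrow> ennreal)"
    by (auto simp: measure_space_def)
qed (rule assms)

lemma sets_hausdorff_measure: "sets (hausdorff_measure s) = sets borel"
  unfolding hausdorff_measure_def using sets.sigma_sets_eq[of borel] by (simp add: sets_measure_of)

lemma space_hausdorff_measure: "space (hausdorff_measure s) = UNIV"
  by (simp add: hausdorff_measure_def)

text \<open>Covering sets may be replaced by their closures, which have the same diameter, so the intersection
  over all scales of the unions of coverings is a Borel null set.\<close>

lemma hausdorff_null_superset: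
  assumes cov: "\<And>e::real. 0 < e \<Longrightarrow> \<exists>U. A \<subseteq> (\<Union>i. U i) \<and> (\<forall>i. bounded (U i) \<and> diameter (U i) \<le> e) \<and>
      (\<Sum>i::nat. hausdorff_weight s (U i)) \<le> ennreal e"
  obtains B where "B \<in> null_sets (hausdorff_measure s)" "A \<subseteq> B"
proof -
  have "\<exists>U. A \<subseteq> (\<Union>i. U i) \<and> (\<forall>i. bounded (U i) \<and> diameter (U i) \<le> inverse (real (Suc n))) \<and>
      (\<Sum>i::nat. hausdorff_weight s (U i)) \<le> ennreal (inverse (real (Suc n)))" for n
    using cov[of "inverse (real (Suc n))"] by simp
  then obtain U where U: "\<And>n. A \<subseteq> (\<Union>i. U n i)" "\<And>n i. bounded (U n i)"
    "\<And>n i. diameter (U n i) \<le> inverse (real (Suc n))"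
    "\<And>n. (\<Sum>i::nat. hausdorff_weight s (U n i)) \<le> ennreal (inverse (real (Suc n)))"
    by metis
  define B where "B = (\<Inter>n. \<Union>i. closure (U n i))"
  have Bb: "B \<in> sets borel" unfolding B_def by (intro sets.countable_INT sets.countable_UN) auto
  have w: "hausdorff_weight s (closure (U n i)) = hausdorff_weight s (U n i)" for n i
    using U(2) by (simp add: hausdorff_weight_def diameter_closure)
  have pre: "hausdorff_pre s (inverse (real (Suc n))) B \<le> ennreal (inverse (real (Suc n)))" for n
  proof -
    have "hausdorff_pre s (inverse (real (Suc n))) B \<le> (\<Sum>i. hausdorff_weight s (closure (U n i)))"
      using U by (intro hausdorff_pre_le) (auto simp: B_def diameter_closure)
    then show ?thesis using U(4)[of n] by (simp add: w)
  qed
  have "hausdorff_pre s \<delta> B \<le> ennreal e" if "0 < \<delta>" "0 < e" for \<delta> e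
  proof -
    have "0 < min \<delta> e" using that by simp
    then obtain n where n: "inverse (real (Suc n)) < min \<delta> e" using reals_Archimedean by blast
    have "hausdorff_pre s \<delta> B \<le> hausdorff_pre s (inverse (real (Suc n))) B"
      using n by (intro hausdorff_pre_antimono) auto
    also have "\<dots> \<le> ennreal e" using n by (intro order_trans[OF pre] ennreal_leI) auto
    finally show ?thesis .
  qed
  then have "hausdorff_pre s \<delta> B \<le> 0 + ennreal e" if "0 < \<delta>" "0 < e" for \<delta> e
    using that by simp
  then have "hausdorff_pre s \<delta> B \<le> 0" if "0 < \<delta>" for \<delta>
    using that by (blast intro: ennreal_le_epsilon)
  then have "hausdorff_outer s B = 0" unfolding hausdorff_outer_eq by (auto intro!: antisym SUP_least)
  then have "B \<in> null_sets (hausdorff_measure s)"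
    using Bb by (auto simp: null_sets_def emeasure_hausdorff_measure sets_hausdorff_measure)
  moreover have "A \<subseteq> B" proof
    fix x assume "x \<in> A"
    then have "\<exists>i. x \<in> closure (U n i)" for n using U(1)[of n] closure_subset by blast
    then show "x \<in> B" by (simp add: B_def)
  qed
  ultimately show ?thesis using that by blast
qed

text \<open>In a coordinate direction \<open>e\<close>, every line through a ball inside \<open>\<Omega>\<close> meets the boundary, because
  \<open>\<Omega>\<close> is bounded. A covering of the boundary by sets \<open>U i\<close> therefore yields a covering of the ball by
  boxes that are long in direction \<open>e\<close> and as wide as \<open>U i\<close> in the others; the volume of such a box
  is a constant times the Hausdorff weight of \<open>U i\<close>.\<close>

lemma hausdorff_outer_frontier_nonzero:
  fixes \<Omega> :: "'a::euclidean_space set"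
  assumes "open \<Omega>" "bounded \<Omega>" "\<Omega> \<noteq> {}"
  shows "hausdorff_outer (DIM('a) - 1) (frontier \<Omega>) \<noteq> 0"
proof
  assume zero: "hausdorff_outer (DIM('a) - 1) (frontier \<Omega>) = 0"
  define m where "m = DIM('a) - 1"
  obtain p where p: "p \<in> \<Omega>" using assms by auto
  obtain r where r: "r > 0" "ball p r \<subseteq> \<Omega>" using assms p openE by blast
  obtain e :: 'a where e: "e \<in> Basis" using nonempty_Basis by blast
  have ev: "unit_ball_vol (real m) > 0" by simp
  define K where "K = 2 * r * 4 ^ m / unit_ball_vol (real m)"
  have K: "0 < K" using r ev by (simp add: K_def)
  have hit: "\<exists>t. q + t *\<^sub>R e \<in> frontier \<Omega>" if "q \<in> ball p r" for q
  proof -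
    obtain B where B: "\<And>x. x \<in> \<Omega> \<Longrightarrow> norm x \<le> B" using assms by (auto simp: bounded_iff)
    have B0: "0 \<le> B" using B[OF p] by (meson norm_ge_zero order_trans)
    define t where "t = B + norm q + 1"
    have "norm (t *\<^sub>R e) \<le> norm (q + t *\<^sub>R e) + norm q" by (metis add_diff_cancel_left' norm_triangle_ineq4)
    then have "B < norm (q + t *\<^sub>R e)" using e B0 by (simp add: t_def)
    then have out: "q + t *\<^sub>R e \<notin> \<Omega>" using B by force
    have "connected ((\<lambda>t. q + t *\<^sub>R e) ` UNIV)"
      by (intro connected_continuous_image continuous_intros) auto
    moreover have "q \<in> range (\<lambda>t. q + t *\<^sub>R e) \<inter> \<Omega>" using that r by (auto intro: rev_image_eqI[of 0])
    moreover have "q + t *\<^sub>R e \<in> range (\<lambda>t. q + t *\<^sub>R e) - \<Omega>" using out by auto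
    ultimately show ?thesis using connected_Int_frontier[of "range (\<lambda>t. q + t *\<^sub>R e)" \<Omega>] by blast
  qed
  have "emeasure lborel (ball p r) \<le> ennreal \<eta>" if "0 < \<eta>" for \<eta>
  proof -
    have "hausdorff_pre m 1 (frontier \<Omega>) \<le> 0"
      using hausdorff_pre_le_outer[of 1 m "frontier \<Omega>"] zero by (simp add: m_def)
    then have "hausdorff_pre m 1 (frontier \<Omega>) < ennreal (\<eta> / K)" using that K
      by (auto intro!: le_less_trans[of _ 0])
    from hausdorff_pre_lessE[OF this] obtain U where U: "frontier \<Omega> \<subseteq> (\<Union>i. U i)" "\<And>i. bounded (U i)"
      "(\<Sum>i. hausdorff_weight m (U i)) < ennreal (\<eta> / K)"
      by metis
    define D where "D i = diameter (U i)" for i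
    \<comment> \<open>A base point of each covering set, and the box around it.\<close>
    define u where "u i = (SOME x. x \<in> U i)" for i
    have u: "u i \<in> U i" if "x \<in> U i" for x i using that by (auto simp: u_def intro: someI)
    have D0: "0 \<le> D i" for i using U(2) by (simp add: D_def diameter_ge_0)
    define lo hi where
      "lo i = (\<Sum>j\<in>Basis. (if j = e then p \<bullet> e - r else u i \<bullet> j - D i) *\<^sub>R j)"
      and "hi i = (\<Sum>j\<in>Basis. (if j = e then p \<bullet> e + r else u i \<bullet> j + D i) *\<^sub>R j)" for i
    define V where "V i = (if U i = {} then {} else cbox (lo i) (hi i))" for i
    have "ball p r \<subseteq> (\<Union>i. V i)"
    proof
      fix q assume q: "q \<in> ball p r"
      obtain t i where ti: "q + t *\<^sub>R e \<in> U i" using hit[OF q] U(1) by auto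
      have "\<bar>q \<bullet> j - u i \<bullet> j\<bar> \<le> D i" if "j \<in> Basis" "j \<noteq> e" for j
      proof -
        have "\<bar>q \<bullet> j - u i \<bullet> j\<bar> = \<bar>(q + t *\<^sub>R e - u i) \<bullet> j\<bar>"
          using that e by (simp add: inner_diff_left inner_add_left inner_not_same_Basis)
        also have "\<dots> \<le> dist (q + t *\<^sub>R e) (u i)"
          using Basis_le_norm[OF that(1)] by (simp add: dist_norm)
        also have "\<dots> \<le> D i" unfolding D_def using U(2) ti u by (intro diameter_bounded_bound) auto
        finally show ?thesis .
      qed
      moreover have "\<bar>p \<bullet> e - q \<bullet> e\<bar> \<le> r"
        using Basis_le_norm[OF e, of "p - q"] q by (simp add: dist_norm inner_diff_left)
      ultimately have "q \<in> cbox (lo i) (hi i)"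
        unfolding mem_box lo_def hi_def by (auto simp: abs_le_iff) (smt (verit))+
      then show "q \<in> (\<Union>i. V i)" using ti by (auto simp: V_def)
    qed
    then have "emeasure lborel (ball p r) \<le> emeasure lborel (\<Union>i. V i)"
      by (intro emeasure_mono sets.countable_UN) (auto simp: V_def)
    also have "\<dots> \<le> (\<Sum>i. emeasure lborel (V i))"
      by (intro emeasure_subadditive_countably) (auto simp: V_def)
    also have "\<dots> = (\<Sum>i. ennreal K * hausdorff_weight m (U i))"
    proof (intro suminf_cong)
      fix i
      show "emeasure lborel (V i) = ennreal K * hausdorff_weight m (U i)"
      proof (cases "U i = {}")
        case False
        have "emeasure lborel (V i) = ennreal (\<Prod>j\<in>Basis. (hi i - lo i) \<bullet> j)"
          using False D0[of i] r unfolding V_def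
          by (simp, intro emeasure_lborel_cbox) (auto simp: lo_def hi_def)
        also have "(\<Prod>j\<in>Basis. (hi i - lo i) \<bullet> j) = (\<Prod>j\<in>Basis. if j = e then 2 * r else 2 * D i)"
          by (intro prod.cong) (auto simp: lo_def hi_def inner_diff_left)
        also have "\<dots> = 2 * r * (2 * D i) ^ m"
          using e by (subst prod.remove[OF finite_Basis e]) (simp add: m_def)
        also have "\<dots> = K * (unit_ball_vol (real m) * (diameter (U i) / 2) ^ m)"
        proof -
          have "2 * D i = 4 * (D i / 2)" by simp
          then have "(2 * D i) ^ m = 4 ^ m * (D i / 2) ^ m" by (metis power_mult_distrib)
          moreover have "K * unit_ball_vol (real m) = 2 * r * 4 ^ m"
            using nonzero_eq_divide_eq[THEN iffD1, OF less_imp_neq[OF ev, symmetric] K_def] .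
          ultimately have "2 * r * (2 * D i) ^ m = K * unit_ball_vol (real m) * (D i / 2) ^ m" by (simp add: mult.assoc)
          then show ?thesis unfolding D_def by (simp only: mult.assoc)
        qed
        finally show ?thesis using False K D0[of i]
          by (simp add: hausdorff_weight_def ennreal_mult D_def)
      qed (simp add: V_def)
    qed
    also have "\<dots> = ennreal K * (\<Sum>i. hausdorff_weight m (U i))" by simp
    also have "\<dots> \<le> ennreal K * ennreal (\<eta> / K)" using U(3) by (intro mult_left_mono) auto
    also have "\<dots> = ennreal \<eta>" using K that by (simp flip: ennreal_mult)
    finally show ?thesis .
  qed
  then have "emeasure lborel (ball p r) \<le> 0 + ennreal \<eta>" if "0 < \<eta>" for \<eta> using that by simp
  then have "emeasure lborel (ball p r) \<le> 0" by (blast intro: ennreal_le_epsilon)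
  moreover have "emeasure lborel (ball p r) > 0" using r by (simp add: emeasure_ball)
  ultimately show False by simp
qed

lemma null_set_small_cubes:
  fixes N :: "'a::euclidean_space set"
  assumes "negligible N" "bounded N" "0 < \<eta>"
  obtains Q :: "nat \<Rightarrow> 'a set" and s :: "nat \<Rightarrow> real" where
    "N \<subseteq> (\<Union>i. Q i)" "\<And>i. 0 \<le> s i"
    "\<And>i x y. x \<in> Q i \<Longrightarrow> y \<in> Q i \<Longrightarrow> dist x y \<le> DIM('a) * s i"
    "(\<Sum>i. ennreal (s i ^ DIM('a))) \<le> ennreal \<eta>"
proof -
  obtain B where B: "\<And>x. x \<in> N \<Longrightarrow> norm x \<le> B" using assms by (auto simp: bounded_iff)
  define l where "l = max B 0 + 1"
  have l: "0 < l" by (auto simp: l_def)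
  define a b where "a = (-l) *\<^sub>R (One :: 'a)" and "b = l *\<^sub>R (One :: 'a)"
  have ab: "a \<bullet> i = -l" "b \<bullet> i = l" if "i \<in> Basis" for i using that by (auto simp: a_def b_def)
  have "N \<subseteq> cbox a b"
  proof
    fix x assume "x \<in> N"
    have "\<bar>x \<bullet> i\<bar> \<le> l" if "i \<in> Basis" for i
      using Basis_le_norm[OF that, of x] B[OF \<open>x \<in> N\<close>] by (simp add: l_def)
    then show "x \<in> cbox a b" using ab by (auto simp: mem_box abs_le_iff minus_le_iff)
  qed
  have NL: "N \<in> lmeasurable" "measure lebesgue N = 0"
    using assms by (auto simp: negligible_iff_measure)
  obtain \<D> where D: "countable \<D>"
        "\<And>K. K \<in> \<D> \<Longrightarrow> K \<subseteq> cbox a b \<and> K \<noteq> {} \<and> (\<exists>c d. K = cbox c d)"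
        "pairwise (\<lambda>A B. interior A \<inter> interior B = {}) \<D>"
        "\<And>u v. cbox u v \<in> \<D> \<Longrightarrow> \<exists>n. \<forall>i \<in> Basis. v \<bullet> i - u \<bullet> i = (b \<bullet> i - a \<bullet> i)/2^n"
        "N \<subseteq> \<Union>\<D>" "\<Union>\<D> \<in> lmeasurable" "measure lebesgue (\<Union>\<D>) \<le> measure lebesgue N + \<eta>"
    using measurable_outer_intervals_bounded[OF NL(1) \<open>N \<subseteq> cbox a b\<close> \<open>0 < \<eta>\<close>] by metis
  have "\<exists>\<sigma>::real. 0 \<le> \<sigma> \<and> (\<forall>x\<in>K. \<forall>y\<in>K. dist x y \<le> DIM('a) * \<sigma>) \<and> emeasure lborel (interior K) = ennreal (\<sigma> ^ DIM('a))"
    if KD: "K \<in> \<D>" for K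
  proof -
    obtain u v where K: "K = cbox u v" using D(2)[OF KD] by blast
    obtain n where n: "\<forall>i \<in> Basis. v \<bullet> i - u \<bullet> i = (b \<bullet> i - a \<bullet> i)/2^n" using D(4) KD K by blast
    define \<sigma> where "\<sigma> = 2 * l / 2 ^ n"
    have \<sigma>: "0 \<le> \<sigma>" using l by (simp add: \<sigma>_def)
    have vu: "v \<bullet> i - u \<bullet> i = \<sigma>" if "i \<in> Basis" for i using n that ab by (simp add: \<sigma>_def)
    have "dist x y \<le> DIM('a) * \<sigma>" if "x \<in> K" "y \<in> K" for x y
    proof -
      have "dist x y \<le> (\<Sum>i\<in>Basis. \<bar>(x - y) \<bullet> i\<bar>)" unfolding dist_norm by (rule norm_le_l1)
      also have "\<dots> \<le> (\<Sum>i\<in>(Basis :: 'a set). \<sigma>)"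
      proof (rule sum_mono)
        fix i :: 'a assume i: "i \<in> Basis"
        then have "u \<bullet> i \<le> x \<bullet> i" "x \<bullet> i \<le> v \<bullet> i" "u \<bullet> i \<le> y \<bullet> i" "y \<bullet> i \<le> v \<bullet> i"
          using that K by (auto simp: mem_box)
        then show "\<bar>(x - y) \<bullet> i\<bar> \<le> \<sigma>" using vu[OF i] by (auto simp: inner_diff_left)
      qed
      finally show ?thesis by simp
    qed
    moreover have "emeasure lborel (interior K) = ennreal (\<sigma> ^ DIM('a))"
    proof -
      have "emeasure lborel (box u v) = ennreal (\<Prod>i\<in>Basis. (v - u) \<bullet> i)"
      proof (rule emeasure_lborel_box)
        show "u \<bullet> i \<le> v \<bullet> i" if "i \<in> Basis" for i using vu[OF that] \<sigma> by simp
      qed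
      also have "(\<Prod>i\<in>Basis. (v - u) \<bullet> i) = (\<Prod>i\<in>(Basis::'a set). \<sigma>)"
        by (intro prod.cong) (auto simp: inner_diff_left vu)
      finally show ?thesis by (simp add: K)
    qed
    ultimately show ?thesis using \<sigma> by (intro exI[of _ \<sigma>] conjI ballI) assumption+
  qed
  then obtain \<sigma> :: "'a set \<Rightarrow> real" where \<sigma>: "\<And>K. K \<in> \<D> \<Longrightarrow> 0 \<le> \<sigma> K"
    "\<And>K x y. K \<in> \<D> \<Longrightarrow> x \<in> K \<Longrightarrow> y \<in> K \<Longrightarrow> dist x y \<le> DIM('a) * \<sigma> K"
    "\<And>K. K \<in> \<D> \<Longrightarrow> emeasure lborel (interior K) = ennreal (\<sigma> K ^ DIM('a))"
    by metis
  define J where "J = to_nat_on \<D> ` \<D>"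
  define Q where "Q i = (if i \<in> J then from_nat_into \<D> i else {})" for i
  define s where "s i = (if i \<in> J then \<sigma> (from_nat_into \<D> i) else 0)" for i
  have JD: "from_nat_into \<D> i \<in> \<D>" if "i \<in> J" for i
    using that D(1) by (auto simp: J_def)
  have inj: "i = j" if "i \<in> J" "j \<in> J" "from_nat_into \<D> i = from_nat_into \<D> j" for i j
    using that D(1) by (auto simp: J_def)
  show ?thesis
  proof (rule that)
    show "N \<subseteq> (\<Union>i. Q i)"
    proof
      fix x assume "x \<in> N"
      then obtain K where K: "K \<in> \<D>" "x \<in> K" using D(5) by auto
      then have "x \<in> Q (to_nat_on \<D> K)" using D(1) by (auto simp: Q_def J_def)
      then show "x \<in> (\<Union>i. Q i)" by blast
    qed
    show "0 \<le> s i" for i using \<sigma>(1) JD by (auto simp: s_def)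
    show "dist x y \<le> DIM('a) * s i" if "x \<in> Q i" "y \<in> Q i" for i x y
      using that \<sigma>(2) JD by (auto simp: s_def Q_def split: if_splits)
    have disj: "disjoint_family (\<lambda>i. interior (Q i))"
      unfolding disjoint_family_on_def
    proof (intro ballI impI)
      fix i j :: nat assume "i \<noteq> j"
      then show "interior (Q i) \<inter> interior (Q j) = {}"
        using D(3) inj[of i j] JD[of i] JD[of j] by (auto simp: Q_def pairwise_def)
    qed
    have "(\<Sum>i. ennreal (s i ^ DIM('a))) = (\<Sum>i. emeasure lborel (interior (Q i)))"
      using \<sigma>(3) JD by (intro suminf_cong) (auto simp: s_def Q_def)
    also have "\<dots> = emeasure lborel (\<Union>i. interior (Q i))"
      by (rule suminf_emeasure[OF _ disj]) auto
    also have "\<dots> = emeasure lebesgue (\<Union>i. interior (Q i))"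
      by simp
    also have "\<dots> \<le> emeasure lebesgue (\<Union>\<D>)"
    proof (rule emeasure_mono)
      show "(\<Union>i. interior (Q i)) \<subseteq> \<Union>\<D>" using JD interior_subset by (fastforce simp: Q_def split: if_splits)
      show "\<Union>\<D> \<in> sets lebesgue" using D(6) by auto
    qed
    also have "\<dots> \<le> ennreal \<eta>" using D(6,7) NL(2) by (simp add: emeasure_eq_measure2 ennreal_leI)
    finally show "(\<Sum>i. ennreal (s i ^ DIM('a))) \<le> ennreal \<eta>" .
  qed
qed

text \<open>An Eilenberg type inequality. The estimate \<open>sep\<close> says that \<open>\<Phi>\<close> has a Lipschitz inverse on its image
  in \<open>N\<close>. Cover \<open>N\<close> by small cubes. For a fixed time \<open>t\<close> the preimages of the cubes under \<open>\<lambda>x. \<Phi> x t\<close>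
  cover \<open>A\<close>, and only cubes visited at time \<open>t\<close> count. Each cube of side \<open>s\<close> is visited during a time
  interval of length comparable to \<open>s\<close>, so the time integral of the sum of weights \<open>s ^ (d - 1)\<close> is
  comparable to the total volume of the cubes, and some \<open>t\<close> gives a small sum.\<close>

lemma hausdorff_null_of_curves_in_null_set:
  fixes \<Phi> :: "'a::euclidean_space \<Rightarrow> real \<Rightarrow> 'a"
  assumes N: "negligible N" "bounded N" and "0 < T" and "0 < C"
    and inN: "\<And>x t. x \<in> A \<Longrightarrow> 0 < t \<Longrightarrow> t < T \<Longrightarrow> \<Phi> x t \<in> N"
    and sep: "\<And>x y s t. x \<in> A \<Longrightarrow> y \<in> A \<Longrightarrow> 0 < s \<Longrightarrow> s < T \<Longrightarrow> 0 < t \<Longrightarrow> t < T \<Longrightarrow>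
        \<bar>t - s\<bar> \<le> C * dist (\<Phi> x t) (\<Phi> y s) \<and> dist x y \<le> C * dist (\<Phi> x t) (\<Phi> y s)"
  obtains B where "B \<in> null_sets (hausdorff_measure (DIM('a) - 1))" "A \<subseteq> B"
proof (rule hausdorff_null_superset[of A "DIM('a) - 1"])
  fix e :: real assume "0 < e"
  define d where "d = DIM('a)"
  have d: "0 < d" by (simp add: d_def)
  define m where "m = d - 1"
  have dm: "d = Suc m" using d by (simp add: m_def)
  define c where "c = C * d"
  have c: "0 < c" using \<open>0 < C\<close> d by (simp add: c_def)
  have ev: "unit_ball_vol (real m) > 0" by simp
  define W where "W = unit_ball_vol (real m) * (c / 2) ^ m"
  have W: "0 < W" using ev c by (simp add: W_def)
  \<comment> \<open>The first bound makes the covering sets small, the second makes the average over time small.\<close>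
  define \<eta> where "\<eta> = min ((e / c) ^ d) (e * T / (W * (2 * c))) / 2"
  have \<eta>: "0 < \<eta>" "\<eta> < (e / c) ^ d" "\<eta> * (W * (2 * c)) < e * T"
  proof -
    have 1: "0 < (e / c) ^ d" "0 < e * T / (W * (2 * c))" using \<open>0 < e\<close> \<open>0 < T\<close> c W by simp_all
    have 2: "0 < min x y / 2 \<and> min x y / 2 < x \<and> min x y / 2 < y" if "0 < x" "0 < y" for x y :: real
      using that by auto
    note 3 = 2[OF 1, folded \<eta>_def]
    show "0 < \<eta>" "\<eta> < (e / c) ^ d" using 3 by auto
    have "\<eta> < e * T / (W * (2 * c))" using 3 by blast
    then show "\<eta> * (W * (2 * c)) < e * T" using W c by (simp add: pos_less_divide_eq)
  qed
  obtain Q :: "nat \<Rightarrow> 'a set" and s :: "nat \<Rightarrow> real" where Q: "N \<subseteq> (\<Union>i. Q i)" "\<And>i. 0 \<le> s i"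
    "\<And>i x y. x \<in> Q i \<Longrightarrow> y \<in> Q i \<Longrightarrow> dist x y \<le> d * s i"
    "(\<Sum>i. ennreal (s i ^ d)) \<le> ennreal \<eta>"
    by (rule null_set_small_cubes[OF N \<eta>(1), folded d_def]) (rule that)
  have cs: "c * s i \<le> e" for i
  proof -
    have "ennreal (s i ^ d) \<le> ennreal \<eta>"
      using sum_le_suminf[of "\<lambda>i. ennreal (s i ^ d)" "{i}"] Q(4) by (auto intro: order_trans)
    then have "s i ^ d < (e / c) ^ d" using \<eta> by (simp add: ennreal_le_iff)
    then have "s i < e / c" using \<open>0 < e\<close> c by (intro power_less_imp_less_base[of "s i" d]) auto
    then show ?thesis using c by (simp add: field_simps)
  qed
  define U where "U t i = {x\<in>A. \<Phi> x t \<in> Q i}" for t i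
  have near: "\<bar>t - t'\<bar> \<le> c * s i \<and> dist x y \<le> c * s i"
    if "x \<in> U t i" "y \<in> U t' i" "t \<in> {0<..<T}" "t' \<in> {0<..<T}" for x y t t' i
  proof -
    have "C * dist (\<Phi> x t) (\<Phi> y t') \<le> C * (d * s i)"
      using that Q(3) \<open>0 < C\<close> by (intro mult_left_mono) (auto simp: U_def)
    then show ?thesis using sep[of x y t' t] that by (auto simp: U_def c_def mult.assoc)
  qed
  \<comment> \<open>All visits of the \<open>i\<close>-th cube take place in the interval \<open>J i\<close> around one of them.\<close>
  define t0 where "t0 i = (SOME t. t \<in> {0<..<T} \<and> U t i \<noteq> {})" for i
  define J where "J i = {t0 i - c * s i .. t0 i + c * s i}" for i
  have tJ: "t \<in> J i" if "t \<in> {0<..<T}" "U t i \<noteq> {}" for t i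
  proof -
    have "t0 i \<in> {0<..<T} \<and> U (t0 i) i \<noteq> {}" unfolding t0_def using that by (intro someI) auto
    then have "\<bar>t - t0 i\<bar> \<le> c * s i" using near that by blast
    then show ?thesis by (auto simp: J_def)
  qed
  define f where "f t = (\<Sum>i. ennreal (W * s i ^ m) * indicator (J i) t)" for t
  have wf: "(\<Sum>i. hausdorff_weight m (U t i)) \<le> f t" if t: "t \<in> {0<..<T}" for t
    unfolding f_def
  proof (rule suminf_le)
    fix i
    show "hausdorff_weight m (U t i) \<le> ennreal (W * s i ^ m) * indicator (J i) t"
    proof (cases "U t i = {}")
      case False
      then have "bounded (U t i)" "diameter (U t i) \<le> c * s i"
        using near t by (auto intro!: diameter_le boundedI simp flip: dist_norm simp: bounded_two_points)
          (metis bounded_two_points near t)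
      then have "unit_ball_vol (real m) * (diameter (U t i) / 2) ^ m \<le> unit_ball_vol (real m) * (c * s i / 2) ^ m"
        using ev by (intro mult_left_mono power_mono) (auto simp: diameter_ge_0)
      also have "\<dots> = W * s i ^ m" by (simp add: W_def power_mult_distrib power_divide)
      finally show ?thesis using False tJ[OF t False] by (simp add: hausdorff_weight_def ennreal_leI)
    qed simp
  qed auto
  have [measurable]: "J i \<in> sets borel" for i by (simp add: J_def)
  have "\<exists>t\<in>{0<..<T}. f t \<le> ennreal e"
  proof (rule ccontr)
    assume "\<not> ?thesis"
    then have big: "ennreal e \<le> f t" if "t \<in> {0<..<T}" for t using that by force
    have "ennreal (e * T) = (\<integral>\<^sup>+t. ennreal e * indicator {0<..<T} t \<partial>lborel)"
      using \<open>0 < e\<close> \<open>0 < T\<close> by (simp add: nn_integral_cmult_indicator ennreal_mult)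
    also have "\<dots> \<le> (\<integral>\<^sup>+t. f t \<partial>lborel)"
      using big by (intro nn_integral_mono) (auto simp: indicator_def)
    also have "\<dots> = (\<Sum>i. \<integral>\<^sup>+t. ennreal (W * s i ^ m) * indicator (J i) t \<partial>lborel)"
      unfolding f_def by (rule nn_integral_suminf) measurable
    also have "\<dots> = (\<Sum>i. ennreal (W * (2 * c)) * ennreal (s i ^ d))"
    proof (rule suminf_cong)
      fix i
      have "(\<integral>\<^sup>+t. ennreal (W * s i ^ m) * indicator (J i) t \<partial>lborel) = ennreal (W * s i ^ m) * ennreal (2 * (c * s i))"
        using c Q(2)[of i] by (subst nn_integral_cmult_indicator) (auto simp: J_def)
      also have "\<dots> = ennreal (W * (2 * c)) * ennreal (s i ^ d)"
        using W c Q(2)[of i] by (simp add: dm ac_simps flip: ennreal_mult)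
      finally show "(\<integral>\<^sup>+t. ennreal (W * s i ^ m) * indicator (J i) t \<partial>lborel) = ennreal (W * (2 * c)) * ennreal (s i ^ d)" .
    qed
    also have "\<dots> = ennreal (W * (2 * c)) * (\<Sum>i. ennreal (s i ^ d))" by simp
    also have "\<dots> \<le> ennreal (W * (2 * c)) * ennreal \<eta>" by (intro mult_left_mono Q) auto
    also have "\<dots> = ennreal (\<eta> * (W * (2 * c)))" using W c \<eta> by (simp add: ac_simps flip: ennreal_mult)
    finally show False using \<eta> W c by (simp add: ennreal_le_iff)
  qed
  then obtain t where t: "t \<in> {0<..<T}" "f t \<le> ennreal e" by blast
  have "A \<subseteq> (\<Union>i. U t i)" using inN Q(1) t by (fastforce simp: U_def)
  moreover have "bounded (U t i)" "diameter (U t i) \<le> e" for i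
  proof -
    show "bounded (U t i)" unfolding bounded_two_points using near t by blast
    show "diameter (U t i) \<le> e"
      using near t cs[of i] \<open>0 < e\<close> by (intro diameter_le) (force simp flip: dist_norm)+
  qed
  moreover have "(\<Sum>i. hausdorff_weight (DIM('a) - 1) (U t i)) \<le> ennreal e"
    using wf[OF t(1)] t(2) by (simp add: m_def d_def)
  ultimately show "\<exists>U. A \<subseteq> (\<Union>i. U i) \<and> (\<forall>i. bounded (U i) \<and> diameter (U i) \<le> e) \<and>
      (\<Sum>i::nat. hausdorff_weight (DIM('a) - 1) (U i)) \<le> ennreal e" by blast
qed (use that in blast)

section \<open>Flow lines entering the domain and null sets\<close>

text \<open>A local defining function: \<open>G\<close> is negative exactly inside \<open>\<Omega>\<close>, has Lipschitz gradient near \<open>z0\<close>, and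
  decreases with unit slope in the direction \<open>n\<close>. It is the graph function of the boundary, extended
  constantly along \<open>n\<close>, minus the height.\<close>

lemma boundary_chart:
  fixes \<Omega> :: "'a::euclidean_space set"
  assumes "C2_holder_boundary \<alpha> \<Omega>" "0 < \<alpha>" "z0 \<in> frontier \<Omega>"
  obtains r K :: real and G :: "'a \<Rightarrow> real" and DG :: "'a \<Rightarrow> 'a" and n :: 'a where
    "0 < r" "0 \<le> K" "norm n = 1"
    "\<And>z. (G has_derivative (\<lambda>h. DG z \<bullet> h)) (at z)"
    "\<And>z w. z \<in> ball z0 r \<Longrightarrow> w \<in> ball z0 r \<Longrightarrow> norm (DG z - DG w) \<le> K * dist z w"
    "\<And>z. z \<in> ball z0 r \<Longrightarrow> z \<in> \<Omega> \<longleftrightarrow> G z < 0"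
    "\<And>z t. G (z + t *\<^sub>R n) = G z - t"
proof -
  obtain n r g where n: "norm n = 1" and r: "0 < r" and g: "C2_holder \<alpha> g"
    and epi: "\<forall>x\<in>ball z0 r. x \<in> \<Omega> \<longleftrightarrow> g (x - (x \<bullet> n) *\<^sub>R n) < x \<bullet> n"
    using assms by (auto simp: C2_holder_boundary_def)
  obtain Dg :: "'a \<Rightarrow> 'a" and D2g :: "'a \<Rightarrow> 'a \<Rightarrow>\<^sub>L 'a" and L
    where Dg: "\<And>x. (g has_derivative (\<lambda>h. Dg x \<bullet> h)) (at x)"
      and D2g: "\<And>x. (Dg has_derivative blinfun_apply (D2g x)) (at x)"
      and L: "\<And>x y. norm (D2g x - D2g y) \<le> L * dist x y powr \<alpha>"
    using g unfolding C2_holder_def by metis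
  have nn: "n \<bullet> n = 1" using n by (simp add: dot_square_norm)
  \<comment> \<open>The orthogonal projection to the hyperplane over which the boundary is a graph.\<close>
  define P where "P x = x - (x \<bullet> n) *\<^sub>R n" for x
  have Psq: "norm (P x) ^ 2 = norm x ^ 2 - (x \<bullet> n) ^ 2" for x
    unfolding P_def power2_norm_eq_inner
    by (simp add: inner_diff_left inner_diff_right nn inner_commute power2_eq_square algebra_simps)
  have Pn: "norm (P x) \<le> norm x" for x
    by (rule power2_le_imp_le) (simp_all add: Psq)
  have Pd: "P x - P y = P (x - y)" for x y
    by (simp add: P_def inner_diff_left algebra_simps)
  define G where "G x = g (P x) - x \<bullet> n" for x
  define DG where "DG x = P (Dg (P x)) - n" for x
  define K where "K = norm (D2g (P z0)) + \<bar>L\<bar> * r powr \<alpha>"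
  have K: "norm (D2g x) \<le> K" if "x \<in> ball (P z0) r" for x
  proof -
    have "norm (D2g x) \<le> norm (D2g (P z0)) + norm (D2g x - D2g (P z0))" by (metis add.commute diff_add_cancel norm_triangle_ineq)
    also have "norm (D2g x - D2g (P z0)) \<le> L * dist x (P z0) powr \<alpha>" by (rule L)
    also have "\<dots> \<le> \<bar>L\<bar> * r powr \<alpha>"
      using that assms(2) by (intro mult_mono powr_mono2) (auto simp: dist_commute)
    finally show ?thesis by (simp add: K_def)
  qed
  show ?thesis
  proof (rule that)
    show "0 < r" by fact
    show "0 \<le> K" by (simp add: K_def)
    show "norm n = 1" by fact
    show "(G has_derivative (\<lambda>h. DG z \<bullet> h)) (at z)" for z
    proof -
      have "(G has_derivative (\<lambda>h. Dg (P z) \<bullet> (h - (h \<bullet> n) *\<^sub>R n) - h \<bullet> n)) (at z)"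
        unfolding G_def P_def
        by (rule derivative_eq_intros has_derivative_compose[of "\<lambda>x. x - (x \<bullet> n) *\<^sub>R n" _ z UNIV g] Dg refl | simp)+
      moreover have "(\<lambda>h. Dg (P z) \<bullet> (h - (h \<bullet> n) *\<^sub>R n) - h \<bullet> n) = (\<lambda>h. DG z \<bullet> h)"
        by (auto simp: fun_eq_iff DG_def P_def inner_diff_left inner_diff_right inner_commute)
      ultimately show ?thesis by simp
    qed
    show "norm (DG z - DG w) \<le> K * dist z w" if "z \<in> ball z0 r" "w \<in> ball z0 r" for z w
    proof -
      have in_ball: "P x \<in> ball (P z0) r" if "x \<in> ball z0 r" for x
        using that Pn[of "z0 - x"] by (simp add: dist_norm Pd)
      have "norm (DG z - DG w) = norm (P (Dg (P z) - Dg (P w)))" by (simp add: DG_def Pd)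
      also have "\<dots> \<le> norm (Dg (P z) - Dg (P w))" by (rule Pn)
      also have "\<dots> \<le> K * norm (P z - P w)"
      proof (rule differentiable_bound[of "ball (P z0) r"])
        show "(Dg has_derivative blinfun_apply (D2g x)) (at x within ball (P z0) r)" for x
          using D2g by (rule has_derivative_at_withinI)
        show "onorm (blinfun_apply (D2g x)) \<le> K" if "x \<in> ball (P z0) r" for x
          using K[OF that] by (simp add: norm_blinfun.rep_eq)
      qed (use in_ball that in auto)
      also have "\<dots> \<le> K * dist z w"
        using Pn[of "z - w"] \<open>0 < r\<close> by (intro mult_left_mono) (auto simp: Pd dist_norm K_def)
      finally show ?thesis .
    qed
    show "z \<in> \<Omega> \<longleftrightarrow> G z < 0" if "z \<in> ball z0 r" for z
      using epi that by (simp add: G_def P_def)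
    show "G (z + t *\<^sub>R n) = G z - t" for z t
      by (simp add: G_def P_def inner_add_left nn algebra_simps)
  qed
qed

lemma chart_frontier_zero:
  fixes G :: "'a::euclidean_space \<Rightarrow> real"
  assumes "open \<Omega>" "isCont G x" "x \<in> ball z0 r" "x \<in> frontier \<Omega>"
    and chart: "\<And>z. z \<in> ball z0 r \<Longrightarrow> z \<in> \<Omega> \<longleftrightarrow> G z < 0"
  shows "G x = 0"
proof (rule antisym)
  have "x \<notin> \<Omega>" using assms by (simp add: frontier_def interior_open)
  then show "0 \<le> G x" using chart assms by force
  show "G x \<le> 0"
  proof (rule ccontr)
    assume "\<not> G x \<le> 0"
    then have "eventually (\<lambda>z. 0 < G z) (nhds x)"
      using assms(2) by (intro order_tendstoD(1)[of G "G x"]) (auto simp: isCont_def tendsto_nhds_iff)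
    moreover have "eventually (\<lambda>z. z \<in> ball z0 r) (nhds x)" using assms by (intro eventually_nhds_in_open) auto
    ultimately have "eventually (\<lambda>z. z \<notin> \<Omega>) (nhds x)"
      by eventually_elim (use chart in force)
    then obtain S where "open S" "x \<in> S" "S \<inter> \<Omega> = {}" by (auto simp: eventually_nhds)
    moreover have "x \<in> closure \<Omega>" using assms by (simp add: frontier_def)
    ultimately show False using open_Int_closure_eq_empty[of S \<Omega>] by blast
  qed
qed

text \<open>Directions \<open>v\<close> with \<open>0 < v \<bullet> \<nu>\<close> enter \<open>\<Omega>\<close>, so \<open>DG \<bullet> v \<le> 0\<close>. Strictness for \<open>w\<close> follows by applying
  this to \<open>w - k n\<close> for a small \<open>k > 0\<close>, since \<open>DG \<bullet> n = - 1\<close>.\<close>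

lemma inward_derivative_neg:
  fixes G :: "'a::euclidean_space \<Rightarrow> real"
  assumes "0 < r" and der: "(G has_derivative (\<lambda>h. DG \<bullet> h)) (at z0)" and G0: "G z0 = 0"
    and chart: "\<And>z. z \<in> ball z0 r \<Longrightarrow> z \<in> \<Omega> \<longleftrightarrow> G z < 0"
    and n: "DG \<bullet> n = -1"
    and nu: "inner_unit_normal \<Omega> z0 \<nu>" "0 < w \<bullet> \<nu>"
  shows "DG \<bullet> w < 0"
proof -
  have le: "DG \<bullet> v \<le> 0" if v: "0 < v \<bullet> \<nu>" for v
  proof -
    have ev: "\<forall>\<^sub>F t in at_right 0. z0 + t *\<^sub>R v \<in> \<Omega>" using nu v by (simp add: inner_unit_normal_def)
    have lim: "((\<lambda>t. z0 + t *\<^sub>R v) \<longlongrightarrow> z0 + 0 *\<^sub>R v) (at_right 0)" by (intro tendsto_intros)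
    then have "\<forall>\<^sub>F t in at_right 0. z0 + t *\<^sub>R v \<in> ball z0 r"
      using \<open>0 < r\<close> by (intro topological_tendstoD) auto
    with ev have "\<forall>\<^sub>F t in at_right (0::real). G (z0 + t *\<^sub>R v) < 0"
      by eventually_elim (use chart in auto)
    then have ev2: "\<forall>\<^sub>F t in at_right 0. (G (z0 + t *\<^sub>R v) - G (z0 + 0 *\<^sub>R v)) / (t - 0) \<le> 0"
      using eventually_at_right_less[of "0::real"]
      by eventually_elim (auto simp: G0 divide_nonpos_pos)
    have "((\<lambda>t. G (z0 + t *\<^sub>R v)) has_derivative (\<lambda>t. DG \<bullet> (t *\<^sub>R v))) (at 0)"
      by (rule has_derivative_compose[of "\<lambda>t. z0 + t *\<^sub>R v" "\<lambda>t. t *\<^sub>R v" 0 UNIV G])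
         (use der in \<open>auto intro!: derivative_eq_intros\<close>)
    then have "((\<lambda>t. G (z0 + t *\<^sub>R v)) has_real_derivative DG \<bullet> v) (at 0)"
      by (rule has_derivative_imp_has_field_derivative) simp
    then have "((\<lambda>t. G (z0 + t *\<^sub>R v)) has_real_derivative DG \<bullet> v) (at_right 0)"
      by (rule has_field_derivative_at_within)
    then have "((\<lambda>t. (G (z0 + t *\<^sub>R v) - G (z0 + 0 *\<^sub>R v)) / (t - 0)) \<longlongrightarrow> DG \<bullet> v) (at_right 0)"
      by (simp add: has_field_derivative_iff)
    then show ?thesis using ev2 by (rule tendsto_upperbound) simp
  qed
  define k where "k = w \<bullet> \<nu> / (2 * (\<bar>n \<bullet> \<nu>\<bar> + 1))"
  have k: "0 < k" using nu by (simp add: k_def add_pos_nonneg)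
  have "k * (n \<bullet> \<nu>) < w \<bullet> \<nu>"
  proof -
    have "k * (n \<bullet> \<nu>) \<le> k * (\<bar>n \<bullet> \<nu>\<bar> + 1)" using k by (intro mult_left_mono) auto
    also have "\<dots> = w \<bullet> \<nu> / 2"
    proof -
      have "\<bar>n \<bullet> \<nu>\<bar> + 1 \<noteq> 0" by linarith
      then show ?thesis by (simp add: k_def field_simps)
    qed
    finally show ?thesis using nu by simp
  qed
  then have "DG \<bullet> (w - k *\<^sub>R n) \<le> 0" by (intro le) (simp add: inner_diff_left)
  then show ?thesis using k n by (simp add: inner_diff_right)
qed

definition flow_line :: "'a::euclidean_space set \<Rightarrow> ('a \<Rightarrow> 'a) \<Rightarrow> real \<Rightarrow> (real \<Rightarrow> 'a) \<Rightarrow> bool" where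
  "flow_line \<Omega> Z T \<gamma> \<longleftrightarrow>
     (\<forall>t\<in>{0..<T}. (\<gamma> has_vector_derivative Z (\<gamma> t)) (at t within {0..<T})) \<and> (\<forall>t\<in>{0<..<T}. \<gamma> t \<in> \<Omega>)"

lemma flow_line_restrict:
  assumes "flow_line \<Omega> Z T \<gamma>" "T' \<le> T"
  shows "flow_line \<Omega> Z T' \<gamma>"
  unfolding flow_line_def
proof (intro conjI ballI)
  fix t assume "t \<in> {0..<T'}"
  then have "(\<gamma> has_vector_derivative Z (\<gamma> t)) (at t within {0..<T})"
    using assms by (auto simp: flow_line_def)
  then show "(\<gamma> has_vector_derivative Z (\<gamma> t)) (at t within {0..<T'})"
    by (rule has_vector_derivative_within_subset) (use assms in auto)
qed (use assms in \<open>auto simp: flow_line_def\<close>)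

lemma flow_line_derivative:
  assumes "flow_line \<Omega> Z T \<gamma>" "0 < t" "t < T"
  shows "(\<gamma> has_vector_derivative Z (\<gamma> t)) (at t)"
proof -
  have "(\<gamma> has_vector_derivative Z (\<gamma> t)) (at t within {0<..<T})"
    by (rule has_vector_derivative_within_subset[of _ _ _ "{0..<T}"])
       (use assms in \<open>auto simp: flow_line_def\<close>)
  then show ?thesis using assms by (simp add: at_within_open[of t "{0<..<T}"])
qed

lemma flow_line_continuous: "flow_line \<Omega> Z T \<gamma> \<Longrightarrow> continuous_on {0..<T} \<gamma>"
  unfolding flow_line_def by (meson continuous_on_vector_derivative)

text \<open>A backward Gronwall estimate: the squared distance of two flow lines, multiplied by
  \<open>exp (2 * L * \<sigma>)\<close>, is nondecreasing. Following both lines back for time \<open>s\<close> brings the second one to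
  its starting point.\<close>

lemma flow_line_separation:
  assumes L: "L-lipschitz_on UNIV Z" and x: "flow_line \<Omega> Z T \<gamma>" and y: "flow_line \<Omega> Z T \<eta>"
    and st: "0 \<le> s" "s \<le> t" "t < T"
  shows "dist (\<gamma> (t - s)) (\<eta> 0) \<le> exp (L * T) * dist (\<gamma> t) (\<eta> s)"
proof (cases "s = 0")
  case False
  have L0: "0 \<le> L" using L lipschitz_on_nonneg by blast
  define \<delta> where "\<delta> \<sigma> = \<gamma> (t - s + \<sigma>) - \<eta> \<sigma>" for \<sigma>
  define f where "f \<sigma> = (\<delta> \<sigma> \<bullet> \<delta> \<sigma>) * exp (2 * L * \<sigma>)" for \<sigma>
  have "f 0 \<le> f s"
  proof (rule DERIV_nonneg_imp_increasing_open[of 0 s f])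
    show "0 \<le> s" using st by simp
    have c1: "continuous_on {0..s} (\<lambda>\<sigma>. \<gamma> (t - s + \<sigma>))"
      by (rule continuous_on_compose2[OF flow_line_continuous[OF x]]) (use st in \<open>auto intro!: continuous_intros\<close>)
    have c2: "continuous_on {0..s} \<eta>"
      by (rule continuous_on_subset[OF flow_line_continuous[OF y]]) (use st in auto)
    show "continuous_on {0..s} f" unfolding f_def \<delta>_def
      by (intro continuous_intros c1 c2)
    fix \<sigma> assume \<sigma>: "0 < \<sigma>" "\<sigma> < s"
    have s1: "((\<lambda>\<sigma>. t - s + \<sigma>) has_vector_derivative 1) (at \<sigma>)"
      by (auto intro!: derivative_eq_intros simp flip: has_real_derivative_iff_has_vector_derivative)
    have d1: "((\<lambda>\<sigma>. \<gamma> (t - s + \<sigma>)) has_vector_derivative Z (\<gamma> (t - s + \<sigma>))) (at \<sigma>)"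
      using flow_line_derivative[OF x, of "t - s + \<sigma>"] \<sigma> st
        vector_diff_chain_at[OF s1, of \<gamma> "Z (\<gamma> (t - s + \<sigma>))"]
      by (simp add: o_def)
    have d2: "(\<eta> has_vector_derivative Z (\<eta> \<sigma>)) (at \<sigma>)"
      using flow_line_derivative[OF y] \<sigma> st by auto
    define V where "V = Z (\<gamma> (t - s + \<sigma>)) - Z (\<eta> \<sigma>)"
    have d: "(\<delta> has_vector_derivative V) (at \<sigma>)"
      unfolding \<delta>_def V_def by (intro has_vector_derivative_diff d1 d2)
    have "norm V \<le> L * norm (\<delta> \<sigma>)"
      using lipschitz_onD[OF L, of "\<gamma> (t - s + \<sigma>)" "\<eta> \<sigma>"] by (simp add: V_def \<delta>_def dist_norm)
    then have "norm (\<delta> \<sigma>) * norm V \<le> norm (\<delta> \<sigma>) * (L * norm (\<delta> \<sigma>))" by (intro mult_left_mono) auto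
    moreover have "\<bar>\<delta> \<sigma> \<bullet> V\<bar> \<le> norm (\<delta> \<sigma>) * norm V" by (rule Cauchy_Schwarz_ineq2)
    ultimately have V: "0 \<le> \<delta> \<sigma> \<bullet> V + L * (\<delta> \<sigma> \<bullet> \<delta> \<sigma>)"
      by (simp add: dot_square_norm power2_eq_square mult_ac)
    have dd: "((\<lambda>\<sigma>. \<delta> \<sigma> \<bullet> \<delta> \<sigma>) has_real_derivative 2 * (\<delta> \<sigma> \<bullet> V)) (at \<sigma>)"
      using has_derivative_inner[OF d[unfolded has_vector_derivative_def] d[unfolded has_vector_derivative_def]]
      unfolding has_field_derivative_def
      by (rule has_derivative_eq_rhs) (auto simp: inner_commute fun_eq_iff algebra_simps)
    have "(f has_real_derivative (2 * (\<delta> \<sigma> \<bullet> V) * exp (2 * L * \<sigma>) + (\<delta> \<sigma> \<bullet> \<delta> \<sigma>) * (exp (2 * L * \<sigma>) * (2 * L)))) (at \<sigma>)"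
      unfolding f_def by (rule derivative_eq_intros dd refl | simp)+
    moreover have "2 * (\<delta> \<sigma> \<bullet> V) * exp (2 * L * \<sigma>) + (\<delta> \<sigma> \<bullet> \<delta> \<sigma>) * (exp (2 * L * \<sigma>) * (2 * L))
        = 2 * (\<delta> \<sigma> \<bullet> V + L * (\<delta> \<sigma> \<bullet> \<delta> \<sigma>)) * exp (2 * L * \<sigma>)" by (simp add: algebra_simps)
    ultimately have "(f has_real_derivative 2 * (\<delta> \<sigma> \<bullet> V + L * (\<delta> \<sigma> \<bullet> \<delta> \<sigma>)) * exp (2 * L * \<sigma>)) (at \<sigma>)"
      by (simp only:)
    moreover have "0 \<le> 2 * (\<delta> \<sigma> \<bullet> V + L * (\<delta> \<sigma> \<bullet> \<delta> \<sigma>)) * exp (2 * L * \<sigma>)"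
      using V by simp
    ultimately show "\<exists>D. (f has_real_derivative D) (at \<sigma>) \<and> 0 \<le> D" by blast
  qed
  then have "(dist (\<gamma> (t - s)) (\<eta> 0))\<^sup>2 \<le> (dist (\<gamma> t) (\<eta> s))\<^sup>2 * exp (2 * L * s)"
    by (simp add: f_def \<delta>_def dot_square_norm dist_norm)
  also have "\<dots> = (exp (L * s) * dist (\<gamma> t) (\<eta> s))\<^sup>2"
    by (simp add: power_mult_distrib mult.commute flip: exp_double)
  finally have "dist (\<gamma> (t - s)) (\<eta> 0) \<le> exp (L * s) * dist (\<gamma> t) (\<eta> s)"
    by (rule power2_le_imp_le) simp
  also have "\<dots> \<le> exp (L * T) * dist (\<gamma> t) (\<eta> s)"
    using st L0 by (intro mult_right_mono) (auto intro: mult_left_mono)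
  finally show ?thesis .
next
  case True
  have "1 \<le> exp (L * T)" using L st lipschitz_on_nonneg[OF L] by simp
  then show ?thesis using True mult_right_mono[of 1 "exp (L * T)" "dist (\<gamma> t) (\<eta> 0)"] by simp
qed


text \<open>Choosing for each bad boundary point one flow line \<open>\<Phi> x\<close> inside \<open>N\<close> reduces the claim to
  \<open>hausdorff_null_of_curves_in_null_set\<close>; what has to be shown is the separation estimate. By
  \<open>flow_line_separation\<close> one of the two points may be taken on the boundary, where the defining
  function \<open>G\<close> of \<open>boundary_chart\<close> vanishes. Along a flow line \<open>G\<close> decreases at least at a fixed
  rate, by transversality, and \<open>G\<close> is Lipschitz, so the time elapsed, and with it the distance of the
  starting points, is controlled by the distance to that boundary point.\<close>

lemma flow_lines_in_null_set_local:
  fixes \<Omega> N :: "'a::euclidean_space set"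
  assumes dom: "bounded_C2_holder_domain \<alpha> \<Omega>" "0 < \<alpha>" and Z: "inward_transversal \<Omega> Z"
    and N: "negligible N" and z0: "z0 \<in> frontier \<Omega>"
  obtains \<rho> \<tau> where "0 < \<rho>" "0 < \<tau>"
    "\<And>T. 0 < T \<Longrightarrow> T \<le> \<tau> \<Longrightarrow> \<exists>B\<in>null_sets (hausdorff_measure (DIM('a) - 1)).
       {x\<in>frontier \<Omega> \<inter> ball z0 \<rho>. \<exists>\<gamma>. \<gamma> 0 = x \<and> flow_line \<Omega> Z T \<gamma> \<and> (\<forall>t\<in>{0<..<T}. \<gamma> t \<in> N)} \<subseteq> B"
proof -
  have op: "open \<Omega>" and bd: "bounded \<Omega>" and bdry: "C2_holder_boundary \<alpha> \<Omega>"
    using dom by (auto simp: bounded_C2_holder_domain_def)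
  obtain r K :: real and G :: "'a \<Rightarrow> real" and DG :: "'a \<Rightarrow> 'a" and n :: 'a where
    ch: "0 < r" "0 \<le> K" "norm n = 1"
    "\<And>z. (G has_derivative (\<lambda>h. DG z \<bullet> h)) (at z)"
    "\<And>z w. z \<in> ball z0 r \<Longrightarrow> w \<in> ball z0 r \<Longrightarrow> norm (DG z - DG w) \<le> K * dist z w"
    "\<And>z. z \<in> ball z0 r \<Longrightarrow> z \<in> \<Omega> \<longleftrightarrow> G z < 0"
    "\<And>z t. G (z + t *\<^sub>R n) = G z - t"
    by (rule boundary_chart[OF bdry \<open>0 < \<alpha>\<close> z0]) (rule that)
  obtain L where L: "L-lipschitz_on UNIV Z" using Z by (auto simp: inward_transversal_def)
  have contZ: "continuous_on UNIV Z" using L by (rule lipschitz_on_continuous_on)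
  have contG: "isCont G z" for z using ch(4) has_derivative_continuous by blast
  have zero: "G x = 0" if "x \<in> frontier \<Omega>" "x \<in> ball z0 r" for x
    using chart_frontier_zero[OF op contG that(2,1) ch(6)] by blast
  have DGn: "DG z0 \<bullet> n = -1"
  proof -
    have "((\<lambda>t. G (z0 + t *\<^sub>R n)) has_derivative (\<lambda>t. DG z0 \<bullet> (t *\<^sub>R n))) (at 0)"
      by (rule has_derivative_compose[of "\<lambda>t. z0 + t *\<^sub>R n" "\<lambda>t. t *\<^sub>R n" 0 UNIV G])
         (use ch(4)[of z0] in \<open>auto intro!: derivative_eq_intros\<close>)
    then have "((\<lambda>t. G z0 - t) has_real_derivative DG z0 \<bullet> n) (at 0)"
      unfolding ch(7) by (rule has_derivative_imp_has_field_derivative) simp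
    moreover have "((\<lambda>t. G z0 - t) has_real_derivative -1) (at 0)"
      by (auto intro!: derivative_eq_intros)
    ultimately show ?thesis by (rule DERIV_unique)
  qed
  obtain \<nu> where \<nu>: "inner_unit_normal \<Omega> z0 \<nu>" "0 < Z z0 \<bullet> \<nu>"
    using Z z0 by (auto simp: inward_transversal_def)
  have neg: "DG z0 \<bullet> Z z0 < 0"
    by (rule inward_derivative_neg[OF ch(1,4) zero ch(6) DGn \<nu>]) (use z0 ch(1) in auto)
  define \<kappa> where "\<kappa> = - (DG z0 \<bullet> Z z0) / 2"
  have \<kappa>: "0 < \<kappa>" using neg by (simp add: \<kappa>_def)
  have "continuous_on (ball z0 r) DG"
    by (rule lipschitz_on_continuous_on[of K]) (use ch(2,5) in \<open>auto intro!: lipschitz_onI simp: dist_norm\<close>)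
  then have "isCont DG z0" using ch(1) by (simp add: continuous_on_eq_continuous_at)
  moreover have "isCont Z z0" using contZ by (simp add: continuous_on_eq_continuous_at)
  ultimately have "isCont (\<lambda>z. DG z \<bullet> Z z) z0" by (intro continuous_intros)
  then have "\<forall>\<^sub>F z in nhds z0. DG z \<bullet> Z z < - \<kappa>"
    using \<kappa> by (intro order_tendstoD(2)[of _ "DG z0 \<bullet> Z z0"]) (auto simp: isCont_def tendsto_nhds_iff \<kappa>_def)
  then obtain r0 where r0: "0 < r0" "\<And>z. dist z z0 < r0 \<Longrightarrow> DG z \<bullet> Z z < - \<kappa>"
    by (auto simp: eventually_nhds_metric)
  define r1 where "r1 = min r r0"
  have r1: "0 < r1" "r1 \<le> r" using r0 ch(1) by (auto simp: r1_def)
  have DGZ: "DG z \<bullet> Z z \<le> - \<kappa>" if "z \<in> ball z0 r1" for z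
    using r0(2)[of z] that by (auto simp: r1_def dist_commute less_imp_le)
  define M where "M = norm (DG z0) + K * r"
  have M0: "0 \<le> M" using ch by (simp add: M_def)
  have M: "norm (DG z) \<le> M" if "z \<in> ball z0 r1" for z
  proof -
    have "norm (DG z) \<le> norm (DG z0) + norm (DG z - DG z0)" by (metis add.commute diff_add_cancel norm_triangle_ineq)
    also have "norm (DG z - DG z0) \<le> K * dist z z0" using that r1 ch(1) by (intro ch(5)) auto
    also have "\<dots> \<le> K * r" using that r1 ch(2) by (intro mult_left_mono) (auto simp: dist_commute)
    finally show ?thesis by (simp add: M_def)
  qed
  have GM: "\<bar>G z - G w\<bar> \<le> M * dist z w" if "z \<in> ball z0 r1" "w \<in> ball z0 r1" for z w
  proof -
    have "norm (G z - G w) \<le> M * norm (z - w)"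
    proof (rule differentiable_bound[of "ball z0 r1"])
      show "(G has_derivative (\<lambda>h. DG x \<bullet> h)) (at x within ball z0 r1)" for x
        using ch(4) by (rule has_derivative_at_withinI)
      show "onorm (\<lambda>h. DG x \<bullet> h) \<le> M" if "x \<in> ball z0 r1" for x
      proof (rule onorm_le)
        fix h
        have "norm (DG x \<bullet> h) \<le> norm (DG x) * norm h" using Cauchy_Schwarz_ineq2 by simp
        also have "\<dots> \<le> M * norm h" using M[OF that] by (rule mult_right_mono) simp
        finally show "norm (DG x \<bullet> h) \<le> M * norm h" .
      qed
    qed (use that in auto)
    then show ?thesis by (simp add: dist_norm)
  qed
  have "compact (Z ` closure \<Omega>)"
    using bd contZ by (intro compact_continuous_image) (auto intro: continuous_on_subset)
  then obtain C0 where C0: "\<And>x. x \<in> closure \<Omega> \<Longrightarrow> norm (Z x) \<le> C0"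
    using compact_imp_bounded by (fastforce simp: bounded_iff)
  define C where "C = max C0 1"
  have C1: "1 \<le> C" by (simp add: C_def)
  have CZ: "norm (Z x) \<le> C" if "x \<in> closure \<Omega>" for x using C0[OF that] by (simp add: C_def)
  define \<tau> where "\<tau> = r1 / (2 * C)"
  have \<tau>: "0 < \<tau>" "C * \<tau> \<le> r1 / 2" using r1 C1 by (auto simp: \<tau>_def)
  show ?thesis
  proof (rule that)
    show "0 < r1 / 2" "0 < \<tau>" using r1 \<tau> by auto
    fix T assume T: "0 < T" "T \<le> \<tau>"
    define A where "A = {x\<in>frontier \<Omega> \<inter> ball z0 (r1 / 2). \<exists>\<gamma>. \<gamma> 0 = x \<and> flow_line \<Omega> Z T \<gamma> \<and> (\<forall>t\<in>{0<..<T}. \<gamma> t \<in> N)}"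
    define \<Phi> where "\<Phi> x = (SOME \<gamma>. \<gamma> 0 = x \<and> flow_line \<Omega> Z T \<gamma> \<and> (\<forall>t\<in>{0<..<T}. \<gamma> t \<in> N))" for x
    have \<Phi>: "\<Phi> x 0 = x \<and> flow_line \<Omega> Z T (\<Phi> x) \<and> (\<forall>t\<in>{0<..<T}. \<Phi> x t \<in> N)" if "x \<in> A" for x
    proof -
      from that have "\<exists>\<gamma>. \<gamma> 0 = x \<and> flow_line \<Omega> Z T \<gamma> \<and> (\<forall>t\<in>{0<..<T}. \<gamma> t \<in> N)"
        unfolding A_def by blast
      from someI_ex[OF this] show ?thesis unfolding \<Phi>_def .
    qed
    have Acl: "x \<in> closure \<Omega>" if "x \<in> A" for x using that by (auto simp: A_def frontier_def)
    have \<Phi>cl: "\<Phi> x t \<in> closure \<Omega>" if "x \<in> A" "t \<in> {0..<T}" for x t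
      using \<Phi>[OF that(1)] that Acl[OF that(1)] closure_subset[of \<Omega>]
      by (cases "t = 0") (auto simp: flow_line_def subset_iff)
    have speed: "dist (\<Phi> x t) x \<le> C * t" if x: "x \<in> A" and t: "t \<in> {0..<T}" for x t
    proof -
      have "norm (\<Phi> x t - \<Phi> x 0) \<le> C * norm (t - 0)"
      proof (rule differentiable_bound[of "{0..<T}"])
        fix \<sigma> assume \<sigma>: "\<sigma> \<in> {0..<T}"
        show "(\<Phi> x has_derivative (\<lambda>h. h *\<^sub>R Z (\<Phi> x \<sigma>))) (at \<sigma> within {0..<T})"
          using \<Phi>[OF x] \<sigma> by (auto simp: flow_line_def has_vector_derivative_def)
        show "onorm (\<lambda>h. h *\<^sub>R Z (\<Phi> x \<sigma>)) \<le> C"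
          using CZ[OF \<Phi>cl[OF x \<sigma>]] by (intro onorm_le) (auto simp: mult.commute[of C] intro: mult_left_mono)
      qed (use t T in auto)
      then show ?thesis using \<Phi>[OF x] t by (simp add: dist_norm)
    qed
    have inball: "\<Phi> x t \<in> ball z0 r1" if x: "x \<in> A" and t: "t \<in> {0..<T}" for x t
    proof -
      have "C * t \<le> C * \<tau>" using t T C1 by (intro mult_left_mono) auto
      then have "dist (\<Phi> x t) x \<le> r1 / 2" using speed[OF x t] \<tau> by linarith
      moreover have "dist z0 x < r1 / 2" using x by (auto simp: A_def)
      ultimately show ?thesis using dist_triangle[of z0 "\<Phi> x t" x] by (auto simp: dist_commute)
    qed
    have G0: "G x = 0" if "x \<in> A" for x using that zero[of x] r1 by (auto simp: A_def)
    have descend: "G (\<Phi> x t) \<le> - \<kappa> * t" if x: "x \<in> A" and t: "t \<in> {0..<T}" for x t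
    proof -
      have "G (\<Phi> x t) + \<kappa> * t \<le> G (\<Phi> x 0) + \<kappa> * 0"
      proof (rule DERIV_nonpos_imp_decreasing_open[of 0 t "\<lambda>t. G (\<Phi> x t) + \<kappa> * t"])
        show "0 \<le> t" using t by simp
        have c\<Phi>: "continuous_on {0..t} (\<Phi> x)"
          by (rule continuous_on_subset[OF flow_line_continuous[of \<Omega> Z T]]) (use \<Phi>[OF x] t in auto)
        have cUG: "continuous_on UNIV G" using contG by (simp add: continuous_on_eq_continuous_at)
        have cG: "continuous_on {0..t} (\<lambda>t. G (\<Phi> x t))"
          by (rule continuous_on_compose2[OF cUG c\<Phi>]) simp
        show "continuous_on {0..t} (\<lambda>t. G (\<Phi> x t) + \<kappa> * t)"
          by (intro continuous_intros cG)
        fix \<sigma> assume \<sigma>: "0 < \<sigma>" "\<sigma> < t"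
        then have \<sigma>T: "\<sigma> < T" "\<sigma> \<in> {0..<T}" using t by auto
        have "(\<Phi> x has_derivative (\<lambda>h. h *\<^sub>R Z (\<Phi> x \<sigma>))) (at \<sigma>)"
          using flow_line_derivative[of \<Omega> Z T "\<Phi> x" \<sigma>] \<Phi>[OF x] \<sigma> \<sigma>T by (simp add: has_vector_derivative_def)
        from has_derivative_compose[OF this ch(4)]
        have "((\<lambda>t. G (\<Phi> x t)) has_derivative (\<lambda>h. DG (\<Phi> x \<sigma>) \<bullet> (h *\<^sub>R Z (\<Phi> x \<sigma>)))) (at \<sigma>)" .
        then have "((\<lambda>t. G (\<Phi> x t)) has_real_derivative DG (\<Phi> x \<sigma>) \<bullet> Z (\<Phi> x \<sigma>)) (at \<sigma>)"
          by (rule has_derivative_imp_has_field_derivative) simp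
        then have "((\<lambda>t. G (\<Phi> x t) + \<kappa> * t) has_real_derivative DG (\<Phi> x \<sigma>) \<bullet> Z (\<Phi> x \<sigma>) + \<kappa>) (at \<sigma>)"
          by (auto intro!: derivative_eq_intros)
        then show "\<exists>y. ((\<lambda>t. G (\<Phi> x t) + \<kappa> * t) has_real_derivative y) (at \<sigma>) \<and> y \<le> 0"
          using DGZ[OF inball[OF x \<sigma>T(2)]] by (intro exI conjI) auto
      qed
      then show ?thesis using G0[OF x] \<Phi>[OF x] by simp
    qed
    \<comment> \<open>A common upper bound of the constants \<open>M / \<kappa>\<close> and \<open>1 + C * (M / \<kappa>)\<close> below.\<close>
    define B where "B = (1 + C) * (M / \<kappa>) + 1"
    have B0: "M / \<kappa> \<le> B" "1 + C * (M / \<kappa>) \<le> B" "0 < B"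
    proof -
      have "0 \<le> M / \<kappa>" "0 \<le> C * (M / \<kappa>)" using M0 \<kappa> C1 by auto
      then show "M / \<kappa> \<le> B" "1 + C * (M / \<kappa>) \<le> B" "0 < B" unfolding B_def distrib_right by linarith+
    qed
    have start: "t \<le> B * dist (\<Phi> x t) y \<and> dist x y \<le> B * dist (\<Phi> x t) y"
      if x: "x \<in> A" and y: "y \<in> A" and t: "t \<in> {0..<T}" for x y t
    proof -
      define m where "m = dist (\<Phi> x t) y"
      have m0: "0 \<le> m" by (simp add: m_def)
      have "y \<in> ball z0 r1" using y r1 by (auto simp: A_def)
      then have "\<bar>G (\<Phi> x t) - G y\<bar> \<le> M * m" unfolding m_def by (intro GM inball x t)
      then have "\<kappa> * t \<le> M * m" using descend[OF x t] G0[OF y] by linarith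
      then have tm: "t \<le> M / \<kappa> * m" using \<kappa> by (simp add: field_simps)
      have "dist x y \<le> dist x (\<Phi> x t) + m" unfolding m_def by (rule dist_triangle)
      also have "\<dots> \<le> C * t + m" using speed[OF x t] by (simp add: dist_commute)
      also have "\<dots> \<le> C * (M / \<kappa> * m) + m" using tm C1 by (intro add_right_mono mult_left_mono) auto
      also have "\<dots> = (1 + C * (M / \<kappa>)) * m" by (simp add: algebra_simps)
      also have "\<dots> \<le> B * m" using B0 m0 by (intro mult_right_mono)
      finally have "dist x y \<le> B * m" .
      moreover have "t \<le> B * m" using tm mult_right_mono[OF B0(1) m0] by linarith
      ultimately show ?thesis by (simp add: m_def)
    qed
    define D where "D = B * exp (L * T)"
    have sep: "\<bar>t - s\<bar> \<le> D * dist (\<Phi> x t) (\<Phi> y s) \<and> dist x y \<le> D * dist (\<Phi> x t) (\<Phi> y s)"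
      if x: "x \<in> A" and y: "y \<in> A" and st: "0 < s" "s \<le> t" "t < T" for x y s t
    proof -
      have "dist (\<Phi> x (t - s)) (\<Phi> y 0) \<le> exp (L * T) * dist (\<Phi> x t) (\<Phi> y s)"
        using \<Phi>[OF x] \<Phi>[OF y] st by (intro flow_line_separation[OF L, of \<Omega>]) auto
      then have "B * dist (\<Phi> x (t - s)) y \<le> B * (exp (L * T) * dist (\<Phi> x t) (\<Phi> y s))"
        using B0 \<Phi>[OF y] by (intro mult_left_mono) auto
      then have "B * dist (\<Phi> x (t - s)) y \<le> D * dist (\<Phi> x t) (\<Phi> y s)" by (simp add: D_def mult.assoc)
      then show ?thesis using start[OF x y, of "t - s"] st by auto
    qed
    have neg: "negligible (N \<inter> \<Omega>)" using N by (rule negligible_subset) auto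
    have bN: "bounded (N \<inter> \<Omega>)" using bd by (rule bounded_subset) auto
    obtain Q where "Q \<in> null_sets (hausdorff_measure (DIM('a) - 1))" "A \<subseteq> Q"
    proof (rule hausdorff_null_of_curves_in_null_set[OF neg bN T(1), of D A \<Phi>])
      show "0 < D" using B0 by (simp add: D_def)
      show "\<Phi> x t \<in> N \<inter> \<Omega>" if "x \<in> A" "0 < t" "t < T" for x t
        using \<Phi>[OF that(1)] that by (auto simp: flow_line_def)
      show "\<bar>t - s\<bar> \<le> D * dist (\<Phi> x t) (\<Phi> y s) \<and> dist x y \<le> D * dist (\<Phi> x t) (\<Phi> y s)"
        if "x \<in> A" "y \<in> A" "0 < s" "s < T" "0 < t" "t < T" for x y s t
        using sep[of x y s t] sep[of y x t s] that by (cases "s \<le> t") (auto simp: dist_commute abs_minus_commute)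
    qed
    then show "\<exists>B\<in>null_sets (hausdorff_measure (DIM('a) - 1)).
       {x\<in>frontier \<Omega> \<inter> ball z0 (r1 / 2). \<exists>\<gamma>. \<gamma> 0 = x \<and> flow_line \<Omega> Z T \<gamma> \<and> (\<forall>t\<in>{0<..<T}. \<gamma> t \<in> N)} \<subseteq> B"
      unfolding A_def by blast
  qed
qed

text \<open>Staying in \<open>N\<close> up to time \<open>T\<close> implies the same for shorter times, so countably many times
  \<open>T = 1 / (k + 1)\<close> suffice, and for each of them finitely many boundary points \<open>z\<close>.\<close>

lemma flow_lines_leave_null_set:
  fixes \<Omega> N :: "'a::euclidean_space set"
  assumes dom: "bounded_C2_holder_domain \<alpha> \<Omega>" "0 < \<alpha>" and Z: "inward_transversal \<Omega> Z"
    and N: "negligible N"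
  shows "AE x in boundary_measure \<Omega>. \<forall>T>0. \<forall>\<gamma>. \<gamma> 0 = x \<and> flow_line \<Omega> Z T \<gamma> \<longrightarrow> (\<exists>t\<in>{0<..<T}. \<gamma> t \<notin> N)"
proof -
  define H where "H = (hausdorff_measure (DIM('a) - 1) :: 'a measure)"
  define bad where "bad T = {x. \<exists>\<gamma>. \<gamma> 0 = x \<and> flow_line \<Omega> Z T \<gamma> \<and> (\<forall>t\<in>{0<..<T}. \<gamma> t \<in> N)}" for T
  have bad_mono: "bad T \<subseteq> bad T'" if "T' \<le> T" for T T'
    using that flow_line_restrict[of \<Omega> Z T _ T'] unfolding bad_def by fastforce
  have "\<exists>\<rho>>0. \<exists>\<tau>>0. \<forall>T. 0 < T \<and> T \<le> \<tau> \<longrightarrow> (\<exists>B\<in>null_sets H. frontier \<Omega> \<inter> ball z0 \<rho> \<inter> bad T \<subseteq> B)"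
    if z0: "z0 \<in> frontier \<Omega>" for z0
  proof -
    obtain \<rho> \<tau> where *: "0 < \<rho>" "0 < \<tau>"
      "\<And>T. 0 < T \<Longrightarrow> T \<le> \<tau> \<Longrightarrow> \<exists>B\<in>null_sets (hausdorff_measure (DIM('a) - 1)).
       {x\<in>frontier \<Omega> \<inter> ball z0 \<rho>. \<exists>\<gamma>. \<gamma> 0 = x \<and> flow_line \<Omega> Z T \<gamma> \<and> (\<forall>t\<in>{0<..<T}. \<gamma> t \<in> N)} \<subseteq> B"
      by (rule flow_lines_in_null_set_local[OF dom Z N z0]) (rule that)
    moreover have "frontier \<Omega> \<inter> ball z0 \<rho> \<inter> bad T = {x\<in>frontier \<Omega> \<inter> ball z0 \<rho>. \<exists>\<gamma>. \<gamma> 0 = x \<and> flow_line \<Omega> Z T \<gamma> \<and> (\<forall>t\<in>{0<..<T}. \<gamma> t \<in> N)}" for T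
      by (auto simp: bad_def)
    ultimately show ?thesis unfolding H_def by (intro exI[of _ \<rho>] exI[of _ \<tau>] conjI allI impI) auto
  qed
  then obtain \<rho> \<tau> where loc: "\<And>z. z \<in> frontier \<Omega> \<Longrightarrow> 0 < \<rho> z" "\<And>z. z \<in> frontier \<Omega> \<Longrightarrow> 0 < \<tau> z"
    "\<And>z T. z \<in> frontier \<Omega> \<Longrightarrow> 0 < T \<Longrightarrow> T \<le> \<tau> z \<Longrightarrow> \<exists>B\<in>null_sets H. frontier \<Omega> \<inter> ball z (\<rho> z) \<inter> bad T \<subseteq> B"
    by metis
  have cpt: "compact (frontier \<Omega>)"
    using dom by (intro compact_frontier_bounded) (simp add: bounded_C2_holder_domain_def)
  obtain F where F: "F \<subseteq> frontier \<Omega>" "finite F" "frontier \<Omega> \<subseteq> (\<Union>z\<in>F. ball z (\<rho> z))"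
    by (rule compactE_image[OF cpt, of "frontier \<Omega>" "\<lambda>z. ball z (\<rho> z)"]) (use loc(1) in auto)
  have "\<exists>B\<in>null_sets H. frontier \<Omega> \<inter> bad T \<subseteq> B" if "0 < T" for T
  proof -
    have "\<exists>B\<in>null_sets H. frontier \<Omega> \<inter> ball z (\<rho> z) \<inter> bad T \<subseteq> B" if "z \<in> F" for z
    proof -
      have z: "z \<in> frontier \<Omega>" using that F by auto
      have "bad T \<subseteq> bad (min T (\<tau> z))" by (rule bad_mono) simp
      moreover have "\<exists>B\<in>null_sets H. frontier \<Omega> \<inter> ball z (\<rho> z) \<inter> bad (min T (\<tau> z)) \<subseteq> B"
        by (rule loc(3)[OF z]) (use loc(2)[OF z] \<open>0 < T\<close> in auto)
      ultimately show ?thesis by blast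
    qed
    then obtain B where B: "\<And>z. z \<in> F \<Longrightarrow> B z \<in> null_sets H" "\<And>z. z \<in> F \<Longrightarrow> frontier \<Omega> \<inter> ball z (\<rho> z) \<inter> bad T \<subseteq> B z"
      by metis
    have "(\<Union>z\<in>F. B z) \<in> null_sets H" using F B by (intro null_sets_UN') (auto intro: countable_finite)
    moreover have "frontier \<Omega> \<inter> bad T \<subseteq> (\<Union>z\<in>F. B z)" using F(3) B(2) by blast
    ultimately show ?thesis by blast
  qed
  then have "\<forall>k. \<exists>B\<in>null_sets H. frontier \<Omega> \<inter> bad (inverse (real (Suc k))) \<subseteq> B" by simp
  then obtain B where B: "\<And>k. B k \<in> null_sets H" "\<And>k. frontier \<Omega> \<inter> bad (inverse (real (Suc k))) \<subseteq> B k"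
    by metis
  have null: "(\<Union>k. B k) \<in> null_sets H" using B(1) by (intro null_sets_UN) auto
  then have "AE x in H. x \<notin> (\<Union>k. B k)" by (rule AE_not_in)
  moreover have fr: "frontier \<Omega> \<inter> space H \<in> sets H"
    by (simp add: H_def sets_hausdorff_measure space_hausdorff_measure)
  ultimately have "AE x in boundary_measure \<Omega>. x \<notin> (\<Union>k. B k)"
    unfolding boundary_measure_def H_def[symmetric] by (subst AE_restrict_space_iff) auto
  moreover have "AE x in boundary_measure \<Omega>. x \<in> frontier \<Omega>"
    by (intro AE_I2) (simp add: boundary_measure_def space_restrict_space)
  ultimately show ?thesis
  proof eventually_elim
    case (elim x)
    show ?case
    proof (intro allI impI, rule ccontr)
      fix T :: real and \<gamma> assume T: "0 < T" and \<gamma>: "\<gamma> 0 = x \<and> flow_line \<Omega> Z T \<gamma>"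
        and "\<not> (\<exists>t\<in>{0<..<T}. \<gamma> t \<notin> N)"
      then have "x \<in> bad T" by (auto simp: bad_def)
      moreover obtain k where "inverse (real (Suc k)) < T" using reals_Archimedean[OF T] by blast
      ultimately have "x \<in> bad (inverse (real (Suc k)))" using bad_mono less_imp_le by blast
      then show False using B(2) elim by blast
    qed
  qed
qed

section \<open>Convergence of the approximate Dirichlet energies\<close>

lemma quadratic_remainder:
  fixes G :: "'a::euclidean_space \<Rightarrow> real"
  assumes der: "\<And>z. (G has_derivative (\<lambda>h. DG z \<bullet> h)) (at z)"
    and lip: "\<And>z w. z \<in> S \<Longrightarrow> w \<in> S \<Longrightarrow> norm (DG z - DG w) \<le> K * dist z w"
    and S: "convex S" "x \<in> S" "m \<in> S" and "0 \<le> K"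
  shows "G m + DG m \<bullet> (x - m) - K * (dist x m)\<^sup>2 \<le> G x"
proof -
  define F where "F w = G w - DG m \<bullet> w" for w
  have "norm (F x - F m) \<le> (K * dist x m) * norm (x - m)"
  proof (rule differentiable_bound[of "closed_segment m x" F "\<lambda>w h. DG w \<bullet> h - DG m \<bullet> h"])
    show "(F has_derivative (\<lambda>h. DG w \<bullet> h - DG m \<bullet> h)) (at w within closed_segment m x)" for w
      unfolding F_def by (intro derivative_intros has_derivative_at_withinI[OF der])
    show "onorm (\<lambda>h. DG w \<bullet> h - DG m \<bullet> h) \<le> K * dist x m" if w: "w \<in> closed_segment m x" for w
    proof (rule onorm_le)
      fix h
      have wS: "w \<in> S" using w S closed_segment_subset by blast
      have "norm (DG w \<bullet> h - DG m \<bullet> h) = \<bar>(DG w - DG m) \<bullet> h\<bar>" by (simp add: inner_diff_left)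
      also have "\<dots> \<le> norm (DG w - DG m) * norm h" by (rule Cauchy_Schwarz_ineq2)
      also have "\<dots> \<le> (K * dist w m) * norm h" using lip[OF wS S(3)] by (rule mult_right_mono) simp
      also have "\<dots> \<le> (K * dist x m) * norm h"
        using segment_bound(1)[OF w] \<open>0 \<le> K\<close> by (intro mult_right_mono mult_left_mono) (auto simp: dist_norm)
      finally show "norm (DG w \<bullet> h - DG m \<bullet> h) \<le> K * dist x m * norm h" .
    qed
  qed auto
  also have "(K * dist x m) * norm (x - m) = K * (dist x m)\<^sup>2" by (simp add: dist_norm power2_eq_square)
  finally show ?thesis unfolding F_def by (simp add: inner_diff_right abs_le_iff)
qed

text \<open>At a boundary point the defining function satisfies a quadratic bound, so on the segment from \<open>x\<close> to
  \<open>y\<close> it exceeds the linear interpolation of its negative end values by at most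
  \<open>K \<theta> (1 - \<theta>) \<epsilon>\<^sup>2\<close>. Shifting the segment by this amount in the direction \<open>n\<close> keeps it inside. The
  shift is by a constant vector depending only on \<open>\<theta>\<close> and \<open>\<epsilon>\<close>, which makes the resulting changes of
  variables mere translations and dilations.\<close>

lemma bent_segment_in_domain:
  fixes \<Omega> :: "'a::euclidean_space set"
  assumes dom: "open \<Omega>" "C2_holder_boundary \<alpha> \<Omega>" "0 < \<alpha>" and z0: "z0 \<in> closure \<Omega>"
  obtains \<rho> b \<epsilon>0 where "0 < \<rho>" "0 < \<epsilon>0"
    "\<And>x y \<epsilon> \<theta>. x \<in> \<Omega> \<Longrightarrow> x \<in> ball z0 \<rho> \<Longrightarrow> y \<in> \<Omega> \<Longrightarrow> dist x y \<le> \<epsilon> \<Longrightarrow> \<epsilon> \<le> \<epsilon>0 \<Longrightarrow> 0 \<le> \<theta> \<Longrightarrow> \<theta> \<le> 1 \<Longrightarrow>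
       x + \<theta> *\<^sub>R (y - x) + (\<epsilon>\<^sup>2 * (\<theta> * (1 - \<theta>))) *\<^sub>R b \<in> \<Omega>"
proof (cases "z0 \<in> \<Omega>")
  case True
  then obtain r where r: "0 < r" "ball z0 r \<subseteq> \<Omega>" using dom openE by blast
  show ?thesis
  proof (rule that[of "r / 2" "r / 2" 0])
    fix x y :: 'a and \<epsilon> \<theta> :: real
    assume *: "x \<in> ball z0 (r / 2)" "dist x y \<le> \<epsilon>" "\<epsilon> \<le> r / 2" "0 \<le> \<theta>" "\<theta> \<le> 1"
    then have "x \<in> ball z0 r" "y \<in> ball z0 r" using r dist_triangle[of z0 y x] by auto
    then have "(1 - \<theta>) *\<^sub>R x + \<theta> *\<^sub>R y \<in> ball z0 r" using * by (intro convexD) auto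
    then show "x + \<theta> *\<^sub>R (y - x) + (\<epsilon>\<^sup>2 * (\<theta> * (1 - \<theta>))) *\<^sub>R 0 \<in> \<Omega>" using r by (auto simp: algebra_simps)
  qed (use r in auto)
next
  case False
  then have fr: "z0 \<in> frontier \<Omega>" using dom z0 by (simp add: frontier_def interior_open)
  obtain r K :: real and G :: "'a \<Rightarrow> real" and DG :: "'a \<Rightarrow> 'a" and n :: 'a where
    ch: "0 < r" "0 \<le> K" "norm n = 1"
    "\<And>z. (G has_derivative (\<lambda>h. DG z \<bullet> h)) (at z)"
    "\<And>z w. z \<in> ball z0 r \<Longrightarrow> w \<in> ball z0 r \<Longrightarrow> norm (DG z - DG w) \<le> K * dist z w"
    "\<And>z. z \<in> ball z0 r \<Longrightarrow> z \<in> \<Omega> \<longleftrightarrow> G z < 0"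
    "\<And>z t. G (z + t *\<^sub>R n) = G z - t"
    by (rule boundary_chart[OF dom(2,3) fr]) (rule that)
  define \<epsilon>0 where "\<epsilon>0 = min 1 (r / (2 * (1 + K)))"
  have \<epsilon>0: "0 < \<epsilon>0" "\<epsilon>0 \<le> 1" "\<epsilon>0 * (1 + K) \<le> r / 2"
  proof -
    show "0 < \<epsilon>0" "\<epsilon>0 \<le> 1" using ch by (auto simp: \<epsilon>0_def)
    have "\<epsilon>0 * (1 + K) \<le> r / (2 * (1 + K)) * (1 + K)" using ch by (intro mult_right_mono) (auto simp: \<epsilon>0_def)
    also have "\<dots> = r / 2" using ch by (simp add: field_simps)
    finally show "\<epsilon>0 * (1 + K) \<le> r / 2" .
  qed
  show ?thesis
  proof (rule that[of "r / 2" \<epsilon>0 "K *\<^sub>R n"])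
    fix x y :: 'a and \<epsilon> \<theta> :: real
    assume x: "x \<in> \<Omega>" "x \<in> ball z0 (r / 2)" and y: "y \<in> \<Omega>" and xy: "dist x y \<le> \<epsilon>" and \<epsilon>: "\<epsilon> \<le> \<epsilon>0"
      and \<theta>: "0 \<le> \<theta>" "\<theta> \<le> 1"
    have \<epsilon>pos: "0 \<le> \<epsilon>" using xy zero_le_dist order_trans by blast
    define m where "m = x + \<theta> *\<^sub>R (y - x)"
    define k where "k = \<epsilon>\<^sup>2 * (\<theta> * (1 - \<theta>)) * K"
    have "\<epsilon> \<le> r / 2" using \<epsilon> \<epsilon>0 ch mult_left_mono[of 1 "1 + K" \<epsilon>0] by linarith
    then have xb: "x \<in> ball z0 r" "y \<in> ball z0 r" using x xy ch(1) dist_triangle[of z0 y x] by auto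
    have meq: "m = (1 - \<theta>) *\<^sub>R x + \<theta> *\<^sub>R y" by (simp add: m_def algebra_simps)
    have mb: "m \<in> ball z0 r" unfolding meq using xb \<theta> by (intro convexD) auto
    have \<theta>1: "0 \<le> \<theta> * (1 - \<theta>)" "\<theta> * (1 - \<theta>) \<le> 1" using \<theta> by (auto intro: mult_le_one)
    have k: "0 \<le> k" "k \<le> \<epsilon>0 * K"
    proof -
      show "0 \<le> k" using \<theta>1 ch by (simp add: k_def)
      have "\<epsilon>\<^sup>2 * (\<theta> * (1 - \<theta>)) \<le> \<epsilon>0 * 1"
        using \<epsilon>pos \<epsilon> \<epsilon>0 \<theta>1 unfolding power2_eq_square
        by (intro mult_mono order_trans[OF mult_mono[of \<epsilon> \<epsilon>0 \<epsilon> 1]]) auto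
      then show "k \<le> \<epsilon>0 * K" using ch unfolding k_def by (intro mult_right_mono) auto
    qed
    have xm: "x - m = - \<theta> *\<^sub>R (y - x)" and ym: "y - m = (1 - \<theta>) *\<^sub>R (y - x)"
      by (auto simp: m_def algebra_simps)
    have dxm: "dist x m = \<theta> * dist x y" "dist y m = (1 - \<theta>) * dist x y"
      using \<theta> by (simp_all add: dist_norm xm ym norm_minus_commute)
    have pb: "m + k *\<^sub>R n \<in> ball z0 r"
    proof -
      have "dist z0 (m + k *\<^sub>R n) \<le> dist z0 x + dist x m + k"
        using dist_triangle[of z0 "m + k *\<^sub>R n" x] dist_triangle[of x "m + k *\<^sub>R n" m] k ch by (simp add: dist_norm)
      also have "dist x m \<le> \<epsilon>0"
        using dxm \<theta> xy \<epsilon> mult_right_mono[of \<theta> 1 "dist x y"] by simp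
      finally have "dist z0 (m + k *\<^sub>R n) \<le> dist z0 x + \<epsilon>0 * (1 + K)" using k by (simp add: algebra_simps)
      then show ?thesis using x \<epsilon>0 by simp
    qed
    have T1: "G m + DG m \<bullet> (x - m) - K * (dist x m)\<^sup>2 \<le> G x"
      by (rule quadratic_remainder[OF ch(4) ch(5) convex_ball[of z0 r]]) (use xb mb ch in auto)
    have T2: "G m + DG m \<bullet> (y - m) - K * (dist y m)\<^sup>2 \<le> G y"
      by (rule quadratic_remainder[OF ch(4) ch(5) convex_ball[of z0 r]]) (use xb mb ch in auto)
    have "(1 - \<theta>) * (G m + DG m \<bullet> (x - m) - K * (dist x m)\<^sup>2) + \<theta> * (G m + DG m \<bullet> (y - m) - K * (dist y m)\<^sup>2)
        \<le> (1 - \<theta>) * G x + \<theta> * G y"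
      using T1 T2 \<theta> by (intro add_mono mult_left_mono) auto
    moreover have "(1 - \<theta>) * (G m + DG m \<bullet> (x - m) - K * (dist x m)\<^sup>2) + \<theta> * (G m + DG m \<bullet> (y - m) - K * (dist y m)\<^sup>2)
        = G m - K * (\<theta> * (1 - \<theta>)) * (dist x y)\<^sup>2"
      unfolding xm ym dxm by (simp add: power2_eq_square algebra_simps)
    moreover have "(1 - \<theta>) * G x + \<theta> * G y < 0"
    proof -
      have "G x < 0" "G y < 0" using ch(6) xb x y by auto
      then show ?thesis using \<theta> by (cases "\<theta> = 0") (auto intro!: add_nonpos_neg simp: mult_nonneg_nonpos mult_pos_neg)
    qed
    moreover have "K * (\<theta> * (1 - \<theta>)) * (dist x y)\<^sup>2 \<le> k"
    proof -
      have "K * (\<theta> * (1 - \<theta>)) * (dist x y)\<^sup>2 \<le> K * (\<theta> * (1 - \<theta>)) * \<epsilon>\<^sup>2"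
        using xy ch \<theta>1 by (intro mult_left_mono power_mono) auto
      then show ?thesis by (simp add: k_def mult_ac)
    qed
    ultimately have "G m - k < 0" by linarith
    then have "G (m + k *\<^sub>R n) < 0" by (simp add: ch(7))
    then have "m + k *\<^sub>R n \<in> \<Omega>" using ch(6) pb by blast
    then show "x + \<theta> *\<^sub>R (y - x) + (\<epsilon>\<^sup>2 * (\<theta> * (1 - \<theta>))) *\<^sub>R K *\<^sub>R n \<in> \<Omega>" by (simp add: m_def k_def)
  qed (use \<epsilon>0 ch in auto)
qed

text \<open>The tent functions \<open>\<psi> j\<close> divided by their sum \<open>W\<close>, which is bounded below on the compact set.\<close>

lemma lipschitz_partition:
  fixes \<rho> :: "'a::euclidean_space \<Rightarrow> real"
  assumes J: "finite J" "S \<subseteq> (\<Union>z\<in>J. ball z (\<rho> z))" and S: "compact S"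
  obtains \<phi> :: "'a \<Rightarrow> 'a \<Rightarrow> real" and L where "0 \<le> L"
    "\<And>j x. 0 \<le> \<phi> j x" "\<And>j. \<phi> j \<in> borel_measurable borel" "\<And>x. x \<in> S \<Longrightarrow> (\<Sum>j\<in>J. \<phi> j x) = 1"
    "\<And>j x. 0 < \<phi> j x \<Longrightarrow> x \<in> ball j (\<rho> j)"
    "\<And>j x y. j \<in> J \<Longrightarrow> x \<in> S \<Longrightarrow> y \<in> S \<Longrightarrow> \<phi> j x \<le> \<phi> j y + L * dist x y"
proof (cases "S = {}")
  case True
  then show ?thesis using that[of 0 "\<lambda>_ _. 0"] by auto
next
  case False
  define \<psi> where "\<psi> j x = max 0 (\<rho> j - dist x j)" for j x
  define W where "W x = (\<Sum>j\<in>J. \<psi> j x)" for x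
  have \<psi>0: "0 \<le> \<psi> j x" for j x by (simp add: \<psi>_def)
  have \<psi>c: "continuous_on UNIV (\<psi> j)" for j unfolding \<psi>_def by (intro continuous_intros)
  have \<psi>L: "\<bar>\<psi> j x - \<psi> j y\<bar> \<le> dist x y" for j x y
    unfolding \<psi>_def max_def using dist_triangle[of x j y] dist_triangle[of y j x] by (auto simp: dist_commute)
  have Wc: "continuous_on UNIV W" unfolding W_def by (intro continuous_intros \<psi>c)
  have WL: "\<bar>W x - W y\<bar> \<le> card J * dist x y" for x y
  proof -
    have "\<bar>W x - W y\<bar> \<le> (\<Sum>j\<in>J. \<bar>\<psi> j x - \<psi> j y\<bar>)" unfolding W_def sum_subtractf[symmetric] by (rule sum_abs)
    also have "\<dots> \<le> (\<Sum>j\<in>J. dist x y)" by (intro sum_mono \<psi>L)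
    finally show ?thesis by simp
  qed
  have Wpos: "0 < W x" if "x \<in> S" for x
  proof -
    obtain j where j: "j \<in> J" "x \<in> ball j (\<rho> j)" using J(2) \<open>x \<in> S\<close> by blast
    have "0 < \<psi> j x" using j by (simp add: \<psi>_def dist_commute)
    also have "\<psi> j x \<le> W x" unfolding W_def using J(1) j \<psi>0 by (intro member_le_sum) auto
    finally show ?thesis .
  qed
  obtain x0 where x0: "x0 \<in> S" "\<And>y. y \<in> S \<Longrightarrow> W x0 \<le> W y"
    using continuous_attains_inf[OF S False continuous_on_subset[OF Wc]] by auto
  define c where "c = W x0"
  have c: "0 < c" using Wpos x0 by (simp add: c_def)
  define L where "L = (1 + card J) / c"
  define \<phi> where "\<phi> j x = \<psi> j x / W x" for j x
  have W0: "0 \<le> W x" for x unfolding W_def by (intro sum_nonneg \<psi>0)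
  show ?thesis
  proof (rule that)
    show "0 \<le> L" using c by (simp add: L_def)
    show "0 \<le> \<phi> j x" for j x using \<psi>0 W0 by (simp add: \<phi>_def)
    show "\<phi> j \<in> borel_measurable borel" for j unfolding \<phi>_def
      by (intro borel_measurable_divide borel_measurable_continuous_onI \<psi>c Wc)
    show "(\<Sum>j\<in>J. \<phi> j x) = 1" if "x \<in> S" for x
      using Wpos[OF that] unfolding \<phi>_def by (simp add: W_def flip: sum_divide_distrib)
    show "x \<in> ball j (\<rho> j)" if "0 < \<phi> j x" for j x
      using that W0[of x] by (auto simp: \<phi>_def \<psi>_def dist_commute max_def zero_less_divide_iff split: if_splits)
    fix j x y assume j: "j \<in> J" and x: "x \<in> S" and y: "y \<in> S"
    have Wx: "c \<le> W x" "c \<le> W y" using x0 x y by (auto simp: c_def)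
    have "\<phi> j x - \<phi> j y = (\<psi> j x - \<psi> j y) / W x + \<psi> j y / W y * ((W y - W x) / W x)"
      using Wx c unfolding \<phi>_def by (simp add: field_simps)
    also have "\<dots> \<le> dist x y / c + 1 * (card J * dist x y / c)"
    proof (intro add_mono)
      have "(\<psi> j x - \<psi> j y) / W x \<le> dist x y / W x"
        using \<psi>L[of j x y] Wx c by (intro divide_right_mono) auto
      also have "\<dots> \<le> dist x y / c" using Wx c by (intro divide_left_mono) auto
      finally show "(\<psi> j x - \<psi> j y) / W x \<le> dist x y / c" .
      have "\<psi> j y \<le> W y" unfolding W_def using J(1) j \<psi>0 by (intro member_le_sum) auto
      then have "\<psi> j y / W y \<le> 1" using Wx c by simp
      moreover have "(W y - W x) / W x \<le> card J * dist x y / c"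
      proof -
        have "(W y - W x) / W x \<le> (card J * dist x y) / W x"
          using WL[of x y] Wx c by (intro divide_right_mono) auto
        also have "\<dots> \<le> card J * dist x y / c" using Wx c by (intro divide_left_mono) auto
        finally show ?thesis .
      qed
      moreover have "\<psi> j y / W y * ((W y - W x) / W x) \<le> \<psi> j y / W y * (card J * dist x y / c)"
        using calculation(2) \<psi>0 W0 by (intro mult_left_mono) auto
      moreover have "\<psi> j y / W y * (card J * dist x y / c) \<le> 1 * (card J * dist x y / c)"
        using calculation(1) c by (intro mult_right_mono) auto
      ultimately show "\<psi> j y / W y * ((W y - W x) / W x) \<le> 1 * (card J * dist x y / c)" by linarith
    qed
    also have "\<dots> = L * dist x y" by (simp add: L_def add_divide_distrib algebra_simps)
    finally show "\<phi> j x \<le> \<phi> j y + L * dist x y" by simp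
  qed
qed

text \<open>The functions \<open>dist (u x) (u y)\<close> for maps \<open>u\<close> with separable range are of this kind, and the energy
  of \<open>u\<close> depends on \<open>u\<close> only through them.\<close>

definition measurable_pseudometric :: "('a::euclidean_space \<Rightarrow> 'a \<Rightarrow> real) \<Rightarrow> bool" where
  "measurable_pseudometric q \<longleftrightarrow> case_prod q \<in> borel_measurable (borel \<Otimes>\<^sub>M borel) \<and>
     (\<forall>x y. 0 \<le> q x y) \<and> (\<forall>x y z. q x z \<le> q x y + q y z)"

definition pair_energy :: "'a::euclidean_space set \<Rightarrow> real \<Rightarrow> ('a \<Rightarrow> 'a \<Rightarrow> real) \<Rightarrow> ennreal" where
  "pair_energy \<Omega> \<epsilon> q =
     (\<integral>\<^sup>+x\<in>\<Omega>. (\<integral>\<^sup>+y\<in>\<Omega>. ennreal ((q x y)\<^sup>2) * indicator {y. norm (x - y) \<le> \<epsilon>} y \<partial>lborel) \<partial>lborel)"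

definition pair_density :: "'a::euclidean_space set \<Rightarrow> real \<Rightarrow> ('a \<Rightarrow> 'a \<Rightarrow> real) \<Rightarrow> 'a \<Rightarrow> 'a \<Rightarrow> ennreal" where
  "pair_density \<Omega> \<epsilon> q x y = (if x \<in> \<Omega> \<and> y \<in> \<Omega> \<and> norm (x - y) \<le> \<epsilon> then ennreal ((q x y)\<^sup>2) else 0)"

lemma nn_integral_translate:
  fixes f :: "'a::euclidean_space \<Rightarrow> ennreal"
  assumes [measurable]: "f \<in> borel_measurable borel"
  shows "(\<integral>\<^sup>+x. f (x + c) \<partial>lborel) = (\<integral>\<^sup>+x. f x \<partial>lborel)"
proof -
  have "(\<integral>\<^sup>+x. f x \<partial>lborel) = (\<integral>\<^sup>+x. f x \<partial>distr lborel borel ((+) c))"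
    by (simp only: lborel_distr_plus)
  also have "\<dots> = (\<integral>\<^sup>+x. f (c + x) \<partial>lborel)" by (intro nn_integral_distr) auto
  finally show ?thesis by (simp add: add.commute)
qed

lemma nn_integral_rescale:
  fixes f :: "'a::euclidean_space \<Rightarrow> ennreal"
  assumes [measurable]: "f \<in> borel_measurable borel" and "0 < n"
  shows "(\<integral>\<^sup>+x. f ((1 / n) *\<^sub>R x) \<partial>lborel) = ennreal (n ^ DIM('a)) * (\<integral>\<^sup>+x. f x \<partial>lborel)"
proof -
  have eq: "lborel = density (distr lborel borel (\<lambda>x::'a. 0 + n *\<^sub>R x)) (\<lambda>_. \<bar>n\<bar> ^ DIM('a))"
    using \<open>0 < n\<close> by (intro lborel_affine) simp
  have "(\<integral>\<^sup>+x. f ((1 / n) *\<^sub>R x) \<partial>lborel)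
      = (\<integral>\<^sup>+x. f ((1 / n) *\<^sub>R x) \<partial>density (distr lborel borel (\<lambda>x. 0 + n *\<^sub>R x)) (\<lambda>_. \<bar>n\<bar> ^ DIM('a)))"
    by (subst (1) eq) (rule refl)
  also have "\<dots> = (\<integral>\<^sup>+x. ennreal (n ^ DIM('a)) * f ((1 / n) *\<^sub>R (0 + n *\<^sub>R x)) \<partial>lborel)"
    using \<open>0 < n\<close> by (subst nn_integral_density, measurable, subst nn_integral_distr) auto
  also have "\<dots> = ennreal (n ^ DIM('a)) * (\<integral>\<^sup>+x. f x \<partial>lborel)"
    using \<open>0 < n\<close> by (simp add: nn_integral_cmult)
  finally show ?thesis .
qed

lemma pair_energy_eq:
  "pair_energy \<Omega> \<epsilon> q = (\<integral>\<^sup>+x. \<integral>\<^sup>+y. pair_density \<Omega> \<epsilon> q x y \<partial>lborel \<partial>lborel)"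
  unfolding pair_energy_def
proof (rule nn_integral_cong)
  fix x
  show "(\<integral>\<^sup>+y\<in>\<Omega>. ennreal ((q x y)\<^sup>2) * indicator {y. norm (x - y) \<le> \<epsilon>} y \<partial>lborel) * indicator \<Omega> x
      = (\<integral>\<^sup>+y. pair_density \<Omega> \<epsilon> q x y \<partial>lborel)"
    by (cases "x \<in> \<Omega>") (auto intro!: nn_integral_cong simp: pair_density_def indicator_def)
qed

lemma pair_density_measurable:
  fixes \<Omega> :: "'a::euclidean_space set"
  assumes "open \<Omega>" "measurable_pseudometric q"
  shows "case_prod (pair_density \<Omega> \<epsilon> q) \<in> borel_measurable (borel \<Otimes>\<^sub>M borel)"
proof -
  have [measurable]: "\<Omega> \<in> sets borel" using assms by simp
  have [measurable]: "case_prod q \<in> borel_measurable (borel \<Otimes>\<^sub>M borel)"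
    using assms by (simp add: measurable_pseudometric_def)
  have "case_prod (pair_density \<Omega> \<epsilon> q) = (\<lambda>z. if fst z \<in> \<Omega> \<and> snd z \<in> \<Omega> \<and> norm (fst z - snd z) \<le> \<epsilon>
      then ennreal ((case_prod q z)\<^sup>2) else 0)"
    by (auto simp: pair_density_def fun_eq_iff)
  also have "\<dots> \<in> borel_measurable (borel \<Otimes>\<^sub>M borel)" by measurable
  finally show ?thesis .
qed

lemma pseudometric_chain:
  assumes q: "measurable_pseudometric q" and "0 < n"
  shows "(q (p 0) (p n))\<^sup>2 \<le> real n * (\<Sum>i<n. (q (p i) (p (Suc i)))\<^sup>2)"
proof -
  have tri: "q (p 0) (p (Suc m)) \<le> (\<Sum>i<Suc m. q (p i) (p (Suc i)))" for m
  proof (induction m)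
    case (Suc m)
    have "q (p 0) (p (Suc (Suc m))) \<le> q (p 0) (p (Suc m)) + q (p (Suc m)) (p (Suc (Suc m)))"
      using q by (simp add: measurable_pseudometric_def)
    then show ?case using Suc by simp
  qed simp
  have "q (p 0) (p n) \<le> (\<Sum>i<n. q (p i) (p (Suc i)))" using tri[of "n - 1"] \<open>0 < n\<close> by simp
  then have "(q (p 0) (p n))\<^sup>2 \<le> (\<Sum>i<n. q (p i) (p (Suc i)))\<^sup>2"
    using q by (intro power_mono) (auto simp: measurable_pseudometric_def)
  also have "\<dots> \<le> real n * (\<Sum>i<n. (q (p i) (p (Suc i)))\<^sup>2)"
    using sum_squared_le_sum_of_squares[of "\<lambda>i. q (p i) (p (Suc i))" "{..<n}"] by (simp add: mult.commute)
  finally show ?thesis .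
qed

text \<open>For fixed \<open>h\<close> the substitution in \<open>x\<close> is a translation; afterwards the one in \<open>h\<close> is a dilation by
  \<open>n\<close> and a translation.\<close>

lemma sheared_integral:
  fixes F :: "'a::euclidean_space \<Rightarrow> 'a \<Rightarrow> ennreal"
  assumes F: "case_prod F \<in> borel_measurable (borel \<Otimes>\<^sub>M borel)" and "0 < n"
  shows "(\<integral>\<^sup>+x. \<integral>\<^sup>+h. F (x + (\<theta> *\<^sub>R h + c)) (x + (\<theta> *\<^sub>R h + c) + ((1 / n) *\<^sub>R h + v)) \<partial>lborel \<partial>lborel)
    = ennreal (n ^ DIM('a)) * (\<integral>\<^sup>+x. \<integral>\<^sup>+y. F x y \<partial>lborel \<partial>lborel)"
proof -
  have [measurable]: "(\<lambda>z. F (f z) (g z)) \<in> borel_measurable M"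
    if "f \<in> borel_measurable M" "g \<in> borel_measurable M" for f g and M :: "'c measure"
    using measurable_compose[OF measurable_Pair[OF that] F] by simp
  have "(\<integral>\<^sup>+x. \<integral>\<^sup>+h. F (x + (\<theta> *\<^sub>R h + c)) (x + (\<theta> *\<^sub>R h + c) + ((1 / n) *\<^sub>R h + v)) \<partial>lborel \<partial>lborel)
      = (\<integral>\<^sup>+h. \<integral>\<^sup>+x. F (x + (\<theta> *\<^sub>R h + c)) (x + (\<theta> *\<^sub>R h + c) + ((1 / n) *\<^sub>R h + v)) \<partial>lborel \<partial>lborel)"
    by (intro lborel_pair.Fubini') measurable
  also have "\<dots> = (\<integral>\<^sup>+h. \<integral>\<^sup>+x. F x (x + ((1 / n) *\<^sub>R h + v)) \<partial>lborel \<partial>lborel)"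
    by (intro nn_integral_cong nn_integral_translate) measurable
  also have "\<dots> = (\<integral>\<^sup>+x. \<integral>\<^sup>+h. F x (x + ((1 / n) *\<^sub>R h + v)) \<partial>lborel \<partial>lborel)"
    by (intro lborel_pair.Fubini'[symmetric]) measurable
  also have "\<dots> = (\<integral>\<^sup>+x. ennreal (n ^ DIM('a)) * (\<integral>\<^sup>+y. F x y \<partial>lborel) \<partial>lborel)"
  proof (rule nn_integral_cong)
    fix x
    have "(\<integral>\<^sup>+h. F x (x + ((1 / n) *\<^sub>R h + v)) \<partial>lborel) = ennreal (n ^ DIM('a)) * (\<integral>\<^sup>+h. F x (x + (h + v)) \<partial>lborel)"
      by (rule nn_integral_rescale) (use \<open>0 < n\<close> in measurable)
    also have "(\<integral>\<^sup>+h. F x (x + (h + v)) \<partial>lborel) = (\<integral>\<^sup>+h. F x (h + (x + v)) \<partial>lborel)"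
      by (simp add: ac_simps)
    also have "\<dots> = (\<integral>\<^sup>+y. F x y \<partial>lborel)" by (rule nn_integral_translate) measurable
    finally show "(\<integral>\<^sup>+h. F x (x + ((1 / n) *\<^sub>R h + v)) \<partial>lborel) = ennreal (n ^ DIM('a)) * (\<integral>\<^sup>+y. F x y \<partial>lborel)" .
  qed
  also have "\<dots> = ennreal (n ^ DIM('a)) * (\<integral>\<^sup>+x. \<integral>\<^sup>+y. F x y \<partial>lborel \<partial>lborel)"
    by (intro nn_integral_cmult) measurable
  finally show ?thesis .
qed

text \<open>The points \<open>P x h i\<close> form a chain of \<open>n\<close> steps from \<open>x\<close> to \<open>x + h\<close> along the bent segment, with steps
  of length at most \<open>\<delta>\<close> because \<open>\<theta> (1 - \<theta>)\<close> is \<open>1\<close>-Lipschitz. The chain inequality costs a factor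
  \<open>n\<close>, the \<open>n\<close> steps another one, and rescaling the steps \<open>n ^ d\<close>. Replacing the weight at \<open>x\<close> by the
  weight at \<open>P x h i\<close> costs \<open>\<eta>\<close>.\<close>

lemma localized_refinement:
  fixes \<Omega> :: "'a::euclidean_space set" and \<phi> :: "'a \<Rightarrow> real" and b :: 'a
  assumes \<Omega>: "open \<Omega>" and q: "measurable_pseudometric q" and n: "0 < n" and "0 \<le> \<eta>" "0 \<le> \<epsilon>"
    and \<phi>: "\<phi> \<in> borel_measurable borel" "\<And>x. 0 \<le> \<phi> x"
    and bent: "\<And>x y \<theta>. x \<in> \<Omega> \<Longrightarrow> 0 < \<phi> x \<Longrightarrow> y \<in> \<Omega> \<Longrightarrow> dist x y \<le> \<epsilon> \<Longrightarrow> 0 \<le> \<theta> \<Longrightarrow> \<theta> \<le> 1 \<Longrightarrow>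
       x + \<theta> *\<^sub>R (y - x) + (\<epsilon>\<^sup>2 * (\<theta> * (1 - \<theta>))) *\<^sub>R b \<in> \<Omega>"
    and osc: "\<And>x y. x \<in> \<Omega> \<Longrightarrow> y \<in> \<Omega> \<Longrightarrow> dist x y \<le> \<epsilon> * (1 + norm b * \<epsilon>) \<Longrightarrow> \<phi> x \<le> \<phi> y + \<eta>"
    and \<delta>: "\<epsilon> * (1 + norm b * \<epsilon>) \<le> real n * \<delta>"
  shows "(\<integral>\<^sup>+x. \<integral>\<^sup>+y. ennreal (\<phi> x) * pair_density \<Omega> \<epsilon> q x y \<partial>lborel \<partial>lborel)
    \<le> ennreal (real n ^ (DIM('a) + 2)) * (\<integral>\<^sup>+x. \<integral>\<^sup>+y. ennreal (\<phi> x + \<eta>) * pair_density \<Omega> \<delta> q x y \<partial>lborel \<partial>lborel)"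
proof -
  note [measurable] = \<phi>(1)
  have dm: "case_prod (pair_density \<Omega> r q) \<in> borel_measurable (borel \<Otimes>\<^sub>M borel)" for r
    by (rule pair_density_measurable[OF \<Omega> q])
  have [measurable]: "(\<lambda>z. pair_density \<Omega> r q (f z) (g z)) \<in> borel_measurable M"
    if "f \<in> borel_measurable M" "g \<in> borel_measurable M" for f g r and M :: "'c measure"
    using measurable_compose[OF measurable_Pair[OF that] dm] by simp
  define F where "F x y = ennreal (\<phi> x + \<eta>) * pair_density \<Omega> \<delta> q x y" for x y
  have F: "case_prod F \<in> borel_measurable (borel \<Otimes>\<^sub>M borel)"
    unfolding F_def by measurable
  have [measurable]: "(\<lambda>z. F (f z) (g z)) \<in> borel_measurable M"
    if "f \<in> borel_measurable M" "g \<in> borel_measurable M" for f g and M :: "'c measure"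
    using measurable_compose[OF measurable_Pair[OF that] F] by simp
  define \<theta> where "\<theta> i = real i / real n" for i
  define c where "c i = \<epsilon>\<^sup>2 * (\<theta> i * (1 - \<theta> i))" for i
  define v where "v i = (c (Suc i) - c i) *\<^sub>R b" for i
  have \<theta>S: "\<theta> (Suc i) = \<theta> i + 1 / real n" for i by (simp add: \<theta>_def add_divide_distrib)
  have \<theta>01: "0 \<le> \<theta> i \<and> \<theta> i \<le> 1" if "i \<le> n" for i using that n by (simp add: \<theta>_def)
  have cS: "\<bar>c (Suc i) - c i\<bar> \<le> \<epsilon>\<^sup>2 / real n" if "i < n" for i
  proof -
    have "c (Suc i) - c i = \<epsilon>\<^sup>2 * ((1 / real n) * (1 - \<theta> i - \<theta> (Suc i)))"
      by (simp add: c_def \<theta>S algebra_simps)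
    also have "\<bar>\<dots>\<bar> = \<epsilon>\<^sup>2 * ((1 / real n) * \<bar>1 - \<theta> i - \<theta> (Suc i)\<bar>)" by (simp add: abs_mult)
    also have "\<dots> \<le> \<epsilon>\<^sup>2 * ((1 / real n) * 1)"
      using \<theta>01[of i] \<theta>01[of "Suc i"] that by (intro mult_left_mono) auto
    finally show ?thesis by simp
  qed
  define P where "P x h i = x + (\<theta> i *\<^sub>R h + c i *\<^sub>R b)" for x h i
  have P0: "P x h 0 = x" and Pn: "P x h n = x + h" for x h
    using n by (simp_all add: P_def \<theta>_def c_def)
  have PS: "P x h (Suc i) = P x h i + ((1 / real n) *\<^sub>R h + v i)" for x h i
    by (simp add: P_def v_def \<theta>S algebra_simps)
  have pointwise: "ennreal (\<phi> x) * pair_density \<Omega> \<epsilon> q x (x + h)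
      \<le> (\<Sum>i<n. ennreal (real n) * F (P x h i) (P x h i + ((1 / real n) *\<^sub>R h + v i)))" for x h
  proof (cases "0 < \<phi> x \<and> x \<in> \<Omega> \<and> x + h \<in> \<Omega> \<and> norm h \<le> \<epsilon>")
    case True
    have P\<Omega>: "P x h i \<in> \<Omega>" if "i \<le> n" for i
      using bent[of x "x + h" "\<theta> i"] True \<theta>01[OF that] by (simp add: P_def c_def dist_norm algebra_simps)
    have Pdist: "norm (P x h i - P x h (Suc i)) \<le> \<delta>" if "i < n" for i
    proof -
      have "norm (P x h i - P x h (Suc i)) = norm ((1 / real n) *\<^sub>R h + v i)"
        unfolding PS by (metis add_diff_cancel_left' norm_minus_commute)
      also have "\<dots> \<le> norm ((1 / real n) *\<^sub>R h) + norm (v i)" by (rule norm_triangle_ineq)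
      also have "\<dots> \<le> \<epsilon> / real n + \<epsilon>\<^sup>2 / real n * norm b"
      proof (rule add_mono)
        show "norm ((1 / real n) *\<^sub>R h) \<le> \<epsilon> / real n" using True by (simp add: divide_right_mono)
        show "norm (v i) \<le> \<epsilon>\<^sup>2 / real n * norm b"
          unfolding v_def norm_scaleR using cS[OF that] by (rule mult_right_mono) simp
      qed
      also have "\<dots> = \<epsilon> * (1 + norm b * \<epsilon>) / real n"
        by (simp add: power2_eq_square add_divide_distrib algebra_simps)
      also have "\<dots> \<le> \<delta>" using \<delta> n by (simp add: divide_le_eq mult.commute)
      finally show ?thesis .
    qed
    have Posc: "\<phi> x \<le> \<phi> (P x h i) + \<eta>" if "i < n" for i
    proof (rule osc)
      show "x \<in> \<Omega>" "P x h i \<in> \<Omega>" using True P\<Omega> that by auto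
      have th: "\<theta> i * (1 - \<theta> i) \<le> 1" "0 \<le> \<theta> i * (1 - \<theta> i)"
        using \<theta>01[of i] that by (auto intro: mult_le_one)
      have "dist x (P x h i) = norm (\<theta> i *\<^sub>R h + c i *\<^sub>R b)"
        unfolding P_def dist_norm by (metis add_diff_cancel_left' norm_minus_commute)
      also have "\<dots> \<le> norm (\<theta> i *\<^sub>R h) + norm (c i *\<^sub>R b)" by (rule norm_triangle_ineq)
      also have "\<dots> \<le> 1 * \<epsilon> + (\<epsilon>\<^sup>2 * 1) * norm b"
      proof (rule add_mono)
        show "norm (\<theta> i *\<^sub>R h) \<le> 1 * \<epsilon>"
          unfolding norm_scaleR using True \<theta>01[of i] that \<open>0 \<le> \<epsilon>\<close> by (intro mult_mono) auto
        have "\<bar>c i\<bar> \<le> \<epsilon>\<^sup>2 * 1"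
          unfolding c_def abs_mult using th by (intro mult_mono) auto
        then show "norm (c i *\<^sub>R b) \<le> (\<epsilon>\<^sup>2 * 1) * norm b"
          unfolding norm_scaleR by (rule mult_right_mono) simp
      qed
      also have "\<dots> = \<epsilon> * (1 + norm b * \<epsilon>)" by (simp add: power2_eq_square algebra_simps)
      finally show "dist x (P x h i) \<le> \<epsilon> * (1 + norm b * \<epsilon>)" .
    qed
    have "\<phi> x * (q x (x + h))\<^sup>2 \<le> \<phi> x * (real n * (\<Sum>i<n. (q (P x h i) (P x h (Suc i)))\<^sup>2))"
      using pseudometric_chain[OF q n, of "P x h"] \<phi>(2) by (intro mult_left_mono) (auto simp: P0 Pn)
    also have "\<dots> = (\<Sum>i<n. real n * (\<phi> x * (q (P x h i) (P x h (Suc i)))\<^sup>2))"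
      by (simp add: sum_distrib_left mult_ac)
    also have "\<dots> \<le> (\<Sum>i<n. real n * ((\<phi> (P x h i) + \<eta>) * (q (P x h i) (P x h (Suc i)))\<^sup>2))"
      using Posc by (intro sum_mono mult_left_mono mult_right_mono) auto
    finally have "ennreal (\<phi> x * (q x (x + h))\<^sup>2) \<le> ennreal (\<Sum>i<n. real n * ((\<phi> (P x h i) + \<eta>) * (q (P x h i) (P x h (Suc i)))\<^sup>2))"
      by (rule ennreal_leI)
    also have "\<dots> = (\<Sum>i<n. ennreal (real n * ((\<phi> (P x h i) + \<eta>) * (q (P x h i) (P x h (Suc i)))\<^sup>2)))"
      using \<phi>(2) \<open>0 \<le> \<eta>\<close> by (intro sum_ennreal[symmetric]) auto
    also have "\<dots> = (\<Sum>i<n. ennreal (real n) * F (P x h i) (P x h (Suc i)))"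
    proof (rule sum.cong)
      fix i assume "i \<in> {..<n}"
      then have "pair_density \<Omega> \<delta> q (P x h i) (P x h (Suc i)) = ennreal ((q (P x h i) (P x h (Suc i)))\<^sup>2)"
        using P\<Omega>[of i] P\<Omega>[of "Suc i"] Pdist[of i] by (simp add: pair_density_def)
      then show "ennreal (real n * ((\<phi> (P x h i) + \<eta>) * (q (P x h i) (P x h (Suc i)))\<^sup>2))
          = ennreal (real n) * F (P x h i) (P x h (Suc i))"
        using \<phi>(2) \<open>0 \<le> \<eta>\<close> by (simp add: F_def ennreal_mult)
    qed simp
    finally show ?thesis using True \<phi>(2) by (simp add: pair_density_def PS ennreal_mult)
  next
    case False
    then have zero: "ennreal (\<phi> x) * pair_density \<Omega> \<epsilon> q x (x + h) = 0"
      using \<phi>(2)[of x] by (auto simp: pair_density_def norm_minus_commute less_le)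
    show ?thesis unfolding zero by (rule zero_le)
  qed
  have "(\<integral>\<^sup>+x. \<integral>\<^sup>+y. ennreal (\<phi> x) * pair_density \<Omega> \<epsilon> q x y \<partial>lborel \<partial>lborel)
      = (\<integral>\<^sup>+x. \<integral>\<^sup>+h. ennreal (\<phi> x) * pair_density \<Omega> \<epsilon> q x (x + h) \<partial>lborel \<partial>lborel)"
  proof (rule nn_integral_cong)
    fix x
    have "(\<integral>\<^sup>+h. ennreal (\<phi> x) * pair_density \<Omega> \<epsilon> q x (h + x) \<partial>lborel) = (\<integral>\<^sup>+y. ennreal (\<phi> x) * pair_density \<Omega> \<epsilon> q x y \<partial>lborel)"
      by (rule nn_integral_translate) measurable
    then show "(\<integral>\<^sup>+y. ennreal (\<phi> x) * pair_density \<Omega> \<epsilon> q x y \<partial>lborel) = (\<integral>\<^sup>+h. ennreal (\<phi> x) * pair_density \<Omega> \<epsilon> q x (x + h) \<partial>lborel)"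
      by (simp add: add.commute)
  qed
  also have "\<dots> \<le> (\<integral>\<^sup>+x. \<integral>\<^sup>+h. (\<Sum>i<n. ennreal (real n) * F (P x h i) (P x h i + ((1 / real n) *\<^sub>R h + v i))) \<partial>lborel \<partial>lborel)"
    by (intro nn_integral_mono pointwise)
  also have "\<dots> = (\<Sum>i<n. ennreal (real n) * (\<integral>\<^sup>+x. \<integral>\<^sup>+h. F (P x h i) (P x h i + ((1 / real n) *\<^sub>R h + v i)) \<partial>lborel \<partial>lborel))"
    unfolding P_def by (simp add: nn_integral_sum nn_integral_cmult)
  also have "\<dots> = (\<Sum>i<n. ennreal (real n) * (ennreal (real n ^ DIM('a)) * (\<integral>\<^sup>+x. \<integral>\<^sup>+y. F x y \<partial>lborel \<partial>lborel)))"
    unfolding P_def using n by (simp add: sheared_integral[OF F])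
  also have "\<dots> = ennreal (real n ^ (DIM('a) + 2)) * (\<integral>\<^sup>+x. \<integral>\<^sup>+y. F x y \<partial>lborel \<partial>lborel)"
  proof -
    define X where "X = (\<integral>\<^sup>+x. \<integral>\<^sup>+y. F x y \<partial>lborel \<partial>lborel)"
    have "(\<Sum>i<n. ennreal (real n) * (ennreal (real n ^ DIM('a)) * X))
        = ennreal (real n) * (ennreal (real n) * (ennreal (real n ^ DIM('a)) * X))"
      by (simp add: ennreal_of_nat_eq_real_of_nat)
    also have "\<dots> = ennreal (real n * (real n * real n ^ DIM('a))) * X"
      by (simp add: ennreal_mult mult.assoc)
    also have "real n * (real n * real n ^ DIM('a)) = real n ^ (DIM('a) + 2)" by simp
    finally show ?thesis unfolding X_def .
  qed
  finally show ?thesis by (simp add: F_def)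
qed


text \<open>Sum \<open>localized_refinement\<close> over a partition of unity subordinate to neighbourhoods with a common
  bending vector. The oscillation of the weights is of order \<open>\<epsilon>\<close>.\<close>

lemma pair_energy_refine:
  fixes \<Omega> :: "'a::euclidean_space set"
  assumes dom: "bounded_C2_holder_domain \<alpha> \<Omega>" "0 < \<alpha>"
  obtains B C \<epsilon>0 :: real where "0 \<le> B" "0 \<le> C" "0 < \<epsilon>0"
    "\<And>q \<epsilon> \<delta> n. measurable_pseudometric q \<Longrightarrow> 0 < \<epsilon> \<Longrightarrow> \<epsilon> \<le> \<epsilon>0 \<Longrightarrow> 0 < n \<Longrightarrow> \<epsilon> * (1 + B * \<epsilon>) \<le> real n * \<delta> \<Longrightarrow>
       pair_energy \<Omega> \<epsilon> q \<le> ennreal (real n ^ (DIM('a) + 2) * (1 + C * \<epsilon>)) * pair_energy \<Omega> \<delta> q"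
proof -
  have op: "open \<Omega>" and bd: "bounded \<Omega>" and bdry: "C2_holder_boundary \<alpha> \<Omega>"
    using dom by (auto simp: bounded_C2_holder_domain_def)
  define good where "good z \<rho> e b \<longleftrightarrow> 0 < \<rho> \<and> 0 < e \<and>
      (\<forall>x y \<epsilon> \<theta>. x \<in> \<Omega> \<longrightarrow> x \<in> ball z \<rho> \<longrightarrow> y \<in> \<Omega> \<longrightarrow> dist x y \<le> \<epsilon> \<longrightarrow> \<epsilon> \<le> e \<longrightarrow> 0 \<le> \<theta> \<longrightarrow> \<theta> \<le> 1 \<longrightarrow>
       x + \<theta> *\<^sub>R (y - x) + (\<epsilon>\<^sup>2 * (\<theta> * (1 - \<theta>))) *\<^sub>R b \<in> \<Omega>)" for z \<rho> e and b :: 'a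
  have "\<exists>\<rho> e b. good z \<rho> e b" if z: "z \<in> closure \<Omega>" for z
  proof (rule bent_segment_in_domain[OF op bdry dom(2) z])
    fix \<rho> b e
    assume "0 < \<rho>" "0 < e" "\<And>x y \<epsilon> \<theta>. x \<in> \<Omega> \<Longrightarrow> x \<in> ball z \<rho> \<Longrightarrow> y \<in> \<Omega> \<Longrightarrow> dist x y \<le> \<epsilon> \<Longrightarrow> \<epsilon> \<le> e \<Longrightarrow> 0 \<le> \<theta> \<Longrightarrow> \<theta> \<le> 1 \<Longrightarrow>
       x + \<theta> *\<^sub>R (y - x) + (\<epsilon>\<^sup>2 * (\<theta> * (1 - \<theta>))) *\<^sub>R b \<in> \<Omega>"
    then have "good z \<rho> e b" unfolding good_def by blast
    then show ?thesis by blast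
  qed
  then obtain \<rho> e b where g: "\<And>z. z \<in> closure \<Omega> \<Longrightarrow> good z (\<rho> z) (e z) (b z)" by metis
  have cpt: "compact (closure \<Omega>)" using bd by simp
  obtain J where J: "J \<subseteq> closure \<Omega>" "finite J" "closure \<Omega> \<subseteq> (\<Union>z\<in>J. ball z (\<rho> z))"
    by (rule compactE_image[OF cpt, of "closure \<Omega>" "\<lambda>z. ball z (\<rho> z)"]) (use g in \<open>auto simp: good_def\<close>)
  obtain \<phi> :: "'a \<Rightarrow> 'a \<Rightarrow> real" and L where \<phi>: "0 \<le> L"
    "\<And>j x. 0 \<le> \<phi> j x" "\<And>j. \<phi> j \<in> borel_measurable borel" "\<And>x. x \<in> closure \<Omega> \<Longrightarrow> (\<Sum>j\<in>J. \<phi> j x) = 1"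
    "\<And>j x. 0 < \<phi> j x \<Longrightarrow> x \<in> ball j (\<rho> j)"
    "\<And>j x y. j \<in> J \<Longrightarrow> x \<in> closure \<Omega> \<Longrightarrow> y \<in> closure \<Omega> \<Longrightarrow> \<phi> j x \<le> \<phi> j y + L * dist x y"
    by (rule lipschitz_partition[OF J(2,3) cpt]) (rule that)
  define B where "B = (\<Sum>j\<in>J. norm (b j))"
  have B0: "0 \<le> B" unfolding B_def by (intro sum_nonneg) auto
  have B: "norm (b j) \<le> B" if "j \<in> J" for j
    unfolding B_def using J(2) that by (intro member_le_sum) auto
  define \<epsilon>0 where "\<epsilon>0 = Min (insert 1 (e ` J))"
  have \<epsilon>0: "0 < \<epsilon>0" "\<epsilon>0 \<le> 1" "\<And>j. j \<in> J \<Longrightarrow> \<epsilon>0 \<le> e j"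
  proof -
    have "\<epsilon>0 \<in> insert 1 (e ` J)" unfolding \<epsilon>0_def using J(2) by (intro Min_in) auto
    then show "0 < \<epsilon>0" using g J(1) by (auto simp: good_def)
    show "\<epsilon>0 \<le> 1" "\<And>j. j \<in> J \<Longrightarrow> \<epsilon>0 \<le> e j" unfolding \<epsilon>0_def using J(2) by (auto intro: Min_le)
  qed
  define C where "C = card J * (L * (1 + B))"
  show ?thesis
  proof (rule that[of B C \<epsilon>0])
    show "0 \<le> B" "0 \<le> C" "0 < \<epsilon>0" using B0 \<phi>(1) \<epsilon>0 by (auto simp: C_def)
    fix q :: "'a \<Rightarrow> 'a \<Rightarrow> real" and \<epsilon> \<delta> :: real and n :: nat
    assume q: "measurable_pseudometric q" and \<epsilon>: "0 < \<epsilon>" "\<epsilon> \<le> \<epsilon>0" and n: "0 < n" and \<delta>: "\<epsilon> * (1 + B * \<epsilon>) \<le> real n * \<delta>"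
    have dm: "case_prod (pair_density \<Omega> r q) \<in> borel_measurable (borel \<Otimes>\<^sub>M borel)" for r
      by (rule pair_density_measurable[OF op q])
    have [measurable]: "(\<lambda>z. pair_density \<Omega> r q (f z) (g z)) \<in> borel_measurable M"
      if "f \<in> borel_measurable M" "g \<in> borel_measurable M" for f g r and M :: "'c measure"
      using measurable_compose[OF measurable_Pair[OF that] dm] by simp
    note [measurable] = \<phi>(3)
    define \<eta> where "\<eta> = L * (\<epsilon> * (1 + B))"
    have \<eta>0: "0 \<le> \<eta>" using \<phi>(1) \<epsilon> B0 by (simp add: \<eta>_def)
    have loc: "(\<integral>\<^sup>+x. \<integral>\<^sup>+y. ennreal (\<phi> j x) * pair_density \<Omega> \<epsilon> q x y \<partial>lborel \<partial>lborel)
      \<le> ennreal (real n ^ (DIM('a) + 2)) * (\<integral>\<^sup>+x. \<integral>\<^sup>+y. ennreal (\<phi> j x + \<eta>) * pair_density \<Omega> \<delta> q x y \<partial>lborel \<partial>lborel)"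
      if j: "j \<in> J" for j
    proof (rule localized_refinement[OF op q n \<eta>0 _ \<phi>(3) \<phi>(2), where b = "b j"])
      show "0 \<le> \<epsilon>" using \<epsilon> by simp
      show "x + \<theta> *\<^sub>R (y - x) + (\<epsilon>\<^sup>2 * (\<theta> * (1 - \<theta>))) *\<^sub>R b j \<in> \<Omega>"
        if "x \<in> \<Omega>" "0 < \<phi> j x" "y \<in> \<Omega>" "dist x y \<le> \<epsilon>" "0 \<le> \<theta>" "\<theta> \<le> 1" for x y \<theta>
      proof -
        have "good j (\<rho> j) (e j) (b j)" using g J(1) j by blast
        moreover have "x \<in> ball j (\<rho> j)" using \<phi>(5) that by blast
        moreover have "\<epsilon> \<le> e j" using \<epsilon> \<epsilon>0(3)[OF j] by linarith
        ultimately show ?thesis using that unfolding good_def by blast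
      qed
      have nb: "\<epsilon> * (1 + norm (b j) * \<epsilon>) \<le> \<epsilon> * (1 + B * \<epsilon>)"
        using \<epsilon> B[OF j] by (intro mult_left_mono add_left_mono mult_right_mono) auto
      then show "\<epsilon> * (1 + norm (b j) * \<epsilon>) \<le> real n * \<delta>" using \<delta> by linarith
      have "\<epsilon> * (1 + B * \<epsilon>) \<le> \<epsilon> * (1 + B * 1)"
        using \<epsilon> \<epsilon>0 B0 by (intro mult_left_mono add_left_mono) auto
      with nb have nb2: "\<epsilon> * (1 + norm (b j) * \<epsilon>) \<le> \<epsilon> * (1 + B)"
        unfolding mult_1_right by (rule order_trans)
      show "\<phi> j x \<le> \<phi> j y + \<eta>" if "x \<in> \<Omega>" "y \<in> \<Omega>" "dist x y \<le> \<epsilon> * (1 + norm (b j) * \<epsilon>)" for x y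
      proof -
        have "\<phi> j x \<le> \<phi> j y + L * dist x y" using that closure_subset by (intro \<phi>(6)[OF j]) auto
        also have "L * dist x y \<le> \<eta>" unfolding \<eta>_def using that nb2 \<phi>(1) by (intro mult_left_mono) auto
        finally show ?thesis by simp
      qed
    qed
    have one: "(\<Sum>j\<in>J. ennreal (\<phi> j x)) = 1" if "x \<in> \<Omega>" for x
      using \<phi>(2) \<phi>(4)[OF subsetD[OF closure_subset that]] by (subst sum_ennreal) auto
    have "pair_energy \<Omega> \<epsilon> q = (\<integral>\<^sup>+x. \<integral>\<^sup>+y. (\<Sum>j\<in>J. ennreal (\<phi> j x) * pair_density \<Omega> \<epsilon> q x y) \<partial>lborel \<partial>lborel)"
      unfolding pair_energy_eq
      by (intro nn_integral_cong) (auto simp: pair_density_def one simp flip: sum_distrib_right)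
    also have "\<dots> = (\<Sum>j\<in>J. \<integral>\<^sup>+x. \<integral>\<^sup>+y. ennreal (\<phi> j x) * pair_density \<Omega> \<epsilon> q x y \<partial>lborel \<partial>lborel)"
      by (simp add: nn_integral_sum)
    also have "\<dots> \<le> (\<Sum>j\<in>J. ennreal (real n ^ (DIM('a) + 2)) * (\<integral>\<^sup>+x. \<integral>\<^sup>+y. ennreal (\<phi> j x + \<eta>) * pair_density \<Omega> \<delta> q x y \<partial>lborel \<partial>lborel))"
      by (intro sum_mono loc)
    also have "\<dots> = ennreal (real n ^ (DIM('a) + 2)) * (\<integral>\<^sup>+x. \<integral>\<^sup>+y. (\<Sum>j\<in>J. ennreal (\<phi> j x + \<eta>) * pair_density \<Omega> \<delta> q x y) \<partial>lborel \<partial>lborel)"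
      by (simp add: nn_integral_sum flip: sum_distrib_left)
    also have "(\<integral>\<^sup>+x. \<integral>\<^sup>+y. (\<Sum>j\<in>J. ennreal (\<phi> j x + \<eta>) * pair_density \<Omega> \<delta> q x y) \<partial>lborel \<partial>lborel)
        = (\<integral>\<^sup>+x. \<integral>\<^sup>+y. ennreal (1 + C * \<epsilon>) * pair_density \<Omega> \<delta> q x y \<partial>lborel \<partial>lborel)"
    proof (intro nn_integral_cong)
      fix x y
      show "(\<Sum>j\<in>J. ennreal (\<phi> j x + \<eta>) * pair_density \<Omega> \<delta> q x y) = ennreal (1 + C * \<epsilon>) * pair_density \<Omega> \<delta> q x y"
      proof (cases "x \<in> \<Omega>")
        case True
        have "(\<Sum>j\<in>J. ennreal (\<phi> j x + \<eta>)) = ennreal (\<Sum>j\<in>J. \<phi> j x + \<eta>)"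
          using \<phi>(2) \<eta>0 by (intro sum_ennreal) (auto intro: add_nonneg_nonneg)
        also have "(\<Sum>j\<in>J. \<phi> j x + \<eta>) = 1 + C * \<epsilon>"
          using \<phi>(4)[OF subsetD[OF closure_subset True]] by (simp add: sum.distrib C_def \<eta>_def mult_ac)
        finally show ?thesis by (simp flip: sum_distrib_right)
      qed (simp add: pair_density_def)
    qed
    also have "\<dots> = ennreal (1 + C * \<epsilon>) * pair_energy \<Omega> \<delta> q"
      unfolding pair_energy_eq by (simp add: nn_integral_cmult)
    also have "ennreal (real n ^ (DIM('a) + 2)) * (ennreal (1 + C * \<epsilon>) * pair_energy \<Omega> \<delta> q)
        = ennreal (real n ^ (DIM('a) + 2) * (1 + C * \<epsilon>)) * pair_energy \<Omega> \<delta> q"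
      using \<open>0 \<le> C\<close> \<epsilon> by (simp add: ennreal_mult mult.assoc)
    finally show "pair_energy \<Omega> \<epsilon> q \<le> ennreal (real n ^ (DIM('a) + 2) * (1 + C * \<epsilon>)) * pair_energy \<Omega> \<delta> q" .
  qed
qed

text \<open>Take \<open>n\<close> to be \<open>\<epsilon> (1 + B \<epsilon>) / \<delta>\<close> rounded up. The rounding is harmless when \<open>\<delta> \<le> \<epsilon>\<^sup>2\<close>: it
  changes \<open>n \<delta> / \<epsilon>\<close> by at most \<open>\<epsilon>\<close>.\<close>

lemma pair_energy_almost_decreasing:
  fixes \<Omega> :: "'a::euclidean_space set"
  assumes dom: "bounded_C2_holder_domain \<alpha> \<Omega>" "0 < \<alpha>"
  obtains w :: "real \<Rightarrow> real" and \<epsilon>0 where "0 < \<epsilon>0" "\<And>\<epsilon>. 0 < \<epsilon> \<Longrightarrow> 0 < w \<epsilon>" "(w \<longlongrightarrow> 1) (at_right 0)"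
    "\<And>q \<epsilon> \<delta> k. measurable_pseudometric q \<Longrightarrow> 0 < \<epsilon> \<Longrightarrow> \<epsilon> \<le> \<epsilon>0 \<Longrightarrow> 0 < \<delta> \<Longrightarrow> \<delta> \<le> \<epsilon>\<^sup>2 \<Longrightarrow> 0 < k \<Longrightarrow>
       pair_energy \<Omega> \<epsilon> q / ennreal (k * \<epsilon> ^ (DIM('a) + 2)) \<le> ennreal (w \<epsilon>) * (pair_energy \<Omega> \<delta> q / ennreal (k * \<delta> ^ (DIM('a) + 2)))"
proof -
  obtain B C \<epsilon>0 :: real where BC: "0 \<le> B" "0 \<le> C" and \<epsilon>0: "0 < \<epsilon>0"
    and refine: "\<And>q \<epsilon> \<delta> n. measurable_pseudometric q \<Longrightarrow> 0 < \<epsilon> \<Longrightarrow> \<epsilon> \<le> \<epsilon>0 \<Longrightarrow> 0 < n \<Longrightarrow> \<epsilon> * (1 + B * \<epsilon>) \<le> real n * \<delta> \<Longrightarrow>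
       pair_energy \<Omega> \<epsilon> q \<le> ennreal (real n ^ (DIM('a) + 2) * (1 + C * \<epsilon>)) * pair_energy \<Omega> \<delta> q"
    by (rule pair_energy_refine[OF dom]) (rule that)
  define D where "D = DIM('a) + 2"
  define w where "w \<epsilon> = (1 + (B + 1) * \<epsilon>) ^ D * (1 + C * \<epsilon>)" for \<epsilon>
  show ?thesis
  proof (rule that[of \<epsilon>0 w])
    show "0 < \<epsilon>0" by fact
    show "0 < w \<epsilon>" if "0 < \<epsilon>" for \<epsilon> using that BC by (auto simp: w_def intro!: mult_pos_pos zero_less_power add_pos_nonneg)
    have "(w \<longlongrightarrow> (1 + (B + 1) * 0) ^ D * (1 + C * 0)) (at_right 0)" unfolding w_def by (intro tendsto_intros)
    then show "(w \<longlongrightarrow> 1) (at_right 0)" by simp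
    fix q :: "'a \<Rightarrow> 'a \<Rightarrow> real" and \<epsilon> \<delta> k :: real
    assume q: "measurable_pseudometric q" and \<epsilon>: "0 < \<epsilon>" "\<epsilon> \<le> \<epsilon>0" and \<delta>: "0 < \<delta>" "\<delta> \<le> \<epsilon>\<^sup>2" and k: "0 < k"
    define n where "n = nat \<lceil>\<epsilon> * (1 + B * \<epsilon>) / \<delta>\<rceil>"
    have pos: "0 < \<epsilon> * (1 + B * \<epsilon>) / \<delta>" using \<epsilon> \<delta> BC by (auto intro!: divide_pos_pos mult_pos_pos add_pos_nonneg)
    then have n0: "0 < n" by (simp add: n_def)
    have nlo: "\<epsilon> * (1 + B * \<epsilon>) / \<delta> \<le> real n" unfolding n_def by (rule real_nat_ceiling_ge)
    have nhi: "real n \<le> \<epsilon> * (1 + B * \<epsilon>) / \<delta> + 1" unfolding n_def using pos ceiling_correct[of "\<epsilon> * (1 + B * \<epsilon>) / \<delta>"] by simp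
    have "real n * \<delta> \<le> \<epsilon> * (1 + B * \<epsilon>) + \<delta>" using nhi \<delta> by (simp add: field_simps)
    also have "\<dots> \<le> \<epsilon> * (1 + (B + 1) * \<epsilon>)" using \<delta> by (simp add: power2_eq_square algebra_simps)
    finally have "real n \<le> \<epsilon> / \<delta> * (1 + (B + 1) * \<epsilon>)" using \<delta> by (simp add: field_simps)
    then have nD: "real n ^ D \<le> (\<epsilon> / \<delta>) ^ D * (1 + (B + 1) * \<epsilon>) ^ D"
      unfolding power_mult_distrib[symmetric] by (intro power_mono) auto
    have "pair_energy \<Omega> \<epsilon> q \<le> ennreal (real n ^ D * (1 + C * \<epsilon>)) * pair_energy \<Omega> \<delta> q"
      unfolding D_def using nlo \<delta> by (intro refine q \<epsilon> n0) (simp add: pos_divide_le_eq)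
    also have "\<dots> \<le> ennreal ((\<epsilon> / \<delta>) ^ D * w \<epsilon>) * pair_energy \<Omega> \<delta> q"
    proof (intro mult_right_mono ennreal_leI)
      have "real n ^ D * (1 + C * \<epsilon>) \<le> ((\<epsilon> / \<delta>) ^ D * (1 + (B + 1) * \<epsilon>) ^ D) * (1 + C * \<epsilon>)"
        using nD BC \<epsilon> by (intro mult_right_mono) auto
      then show "real n ^ D * (1 + C * \<epsilon>) \<le> (\<epsilon> / \<delta>) ^ D * w \<epsilon>" by (simp add: w_def mult.assoc)
    qed simp
    finally have main: "pair_energy \<Omega> \<epsilon> q \<le> ennreal ((\<epsilon> / \<delta>) ^ D * w \<epsilon>) * pair_energy \<Omega> \<delta> q" .
    have w0: "0 \<le> w \<epsilon>" using BC \<epsilon> by (auto simp: w_def)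
    have div: "a / ennreal (k * r ^ D) = ennreal (1 / (k * r ^ D)) * a" if "0 < r" for a r
      using that k by (simp add: divide_ennreal_def inverse_ennreal mult.commute inverse_eq_divide)
    have "pair_energy \<Omega> \<epsilon> q / ennreal (k * \<epsilon> ^ D) \<le> ennreal (1 / (k * \<epsilon> ^ D)) * (ennreal ((\<epsilon> / \<delta>) ^ D * w \<epsilon>) * pair_energy \<Omega> \<delta> q)"
      unfolding div[OF \<epsilon>(1)] using main by (intro mult_left_mono) auto
    also have "\<dots> = ennreal (1 / (k * \<epsilon> ^ D) * ((\<epsilon> / \<delta>) ^ D * w \<epsilon>)) * pair_energy \<Omega> \<delta> q"
      using w0 k \<epsilon> \<delta> by (subst ennreal_mult) (auto simp: mult.assoc)
    also have "1 / (k * \<epsilon> ^ D) * ((\<epsilon> / \<delta>) ^ D * w \<epsilon>) = w \<epsilon> * (1 / (k * \<delta> ^ D))"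
      using k \<epsilon> \<delta> by (simp add: power_divide field_simps)
    also have "ennreal (w \<epsilon> * (1 / (k * \<delta> ^ D))) * pair_energy \<Omega> \<delta> q = ennreal (w \<epsilon>) * (pair_energy \<Omega> \<delta> q / ennreal (k * \<delta> ^ D))"
      unfolding div[OF \<delta>(1)] using w0 k \<delta> by (subst ennreal_mult) (auto simp: mult.assoc)
    finally show "pair_energy \<Omega> \<epsilon> q / ennreal (k * \<epsilon> ^ (DIM('a) + 2)) \<le> ennreal (w \<epsilon>) * (pair_energy \<Omega> \<delta> q / ennreal (k * \<delta> ^ (DIM('a) + 2)))"
      by (simp add: D_def)
  qed
qed

text \<open>Letting first \<open>\<delta>\<close> tend to zero bounds \<open>f \<epsilon>\<close> by \<open>w \<epsilon>\<close> times the lower limit; letting then \<open>\<epsilon>\<close> tend to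
  zero bounds the upper limit by the lower one. In particular \<open>f\<close> vanishes near zero if its limit
  does.\<close>

lemma tendsto_of_almost_decreasing:
  fixes f :: "real \<Rightarrow> ennreal" and w :: "real \<Rightarrow> real"
  assumes "0 < \<epsilon>0" and wpos: "\<And>\<epsilon>. 0 < \<epsilon> \<Longrightarrow> 0 < w \<epsilon>" and w: "(w \<longlongrightarrow> 1) (at_right 0)"
    and dec: "\<And>\<epsilon> \<delta>. 0 < \<epsilon> \<Longrightarrow> \<epsilon> \<le> \<epsilon>0 \<Longrightarrow> 0 < \<delta> \<Longrightarrow> \<delta> \<le> \<epsilon>\<^sup>2 \<Longrightarrow> f \<epsilon> \<le> ennreal (w \<epsilon>) * f \<delta>"
  defines "l \<equiv> Liminf (at_right 0) f"
  shows "(f \<longlongrightarrow> l) (at_right 0)" and "\<And>\<epsilon>. 0 < \<epsilon> \<Longrightarrow> \<epsilon> \<le> \<epsilon>0 \<Longrightarrow> f \<epsilon> \<le> ennreal (w \<epsilon>) * l"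
proof -
  have bound: "f \<epsilon> \<le> ennreal (w \<epsilon>) * l" if \<epsilon>: "0 < \<epsilon>" "\<epsilon> \<le> \<epsilon>0" for \<epsilon>
  proof -
    have inv: "ennreal (1 / w \<epsilon>) * (ennreal (w \<epsilon>) * a) = a" for a
      using wpos[OF \<epsilon>(1)] by (simp flip: mult.assoc ennreal_mult)
    have inv2: "ennreal (w \<epsilon>) * (ennreal (1 / w \<epsilon>) * a) = a" for a
      using wpos[OF \<epsilon>(1)] by (simp flip: mult.assoc ennreal_mult)
    have "\<forall>\<^sub>F \<delta> in at_right 0. \<delta> \<in> {0<..<\<epsilon>\<^sup>2}" using \<epsilon> by (intro eventually_at_right_real) simp
    then have "\<forall>\<^sub>F \<delta> in at_right 0. ennreal (1 / w \<epsilon>) * f \<epsilon> \<le> f \<delta>"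
    proof eventually_elim
      case (elim \<delta>)
      have "ennreal (1 / w \<epsilon>) * f \<epsilon> \<le> ennreal (1 / w \<epsilon>) * (ennreal (w \<epsilon>) * f \<delta>)"
        using dec[OF \<epsilon>, of \<delta>] elim by (intro mult_left_mono) auto
      then show ?case by (simp only: inv)
    qed
    then have "ennreal (1 / w \<epsilon>) * f \<epsilon> \<le> l" unfolding l_def by (rule Liminf_bounded)
    then have "ennreal (w \<epsilon>) * (ennreal (1 / w \<epsilon>) * f \<epsilon>) \<le> ennreal (w \<epsilon>) * l" by (rule mult_left_mono) simp
    then show ?thesis by (simp only: inv2)
  qed
  then show "\<And>\<epsilon>. 0 < \<epsilon> \<Longrightarrow> \<epsilon> \<le> \<epsilon>0 \<Longrightarrow> f \<epsilon> \<le> ennreal (w \<epsilon>) * l" .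
  have "((\<lambda>\<epsilon>. ennreal (w \<epsilon>)) \<longlongrightarrow> ennreal 1) (at_right 0)" using w by (rule tendsto_ennrealI)
  then have "((\<lambda>\<epsilon>. ennreal (w \<epsilon>) * l) \<longlongrightarrow> 1 * l) (at_right 0)"
    by (intro tendsto_mult_ennreal) auto
  then have "Limsup (at_right 0) (\<lambda>\<epsilon>. ennreal (w \<epsilon>) * l) = l"
    using lim_imp_Limsup[of "at_right (0::real)"] by simp
  moreover have "Limsup (at_right 0) f \<le> Limsup (at_right 0) (\<lambda>\<epsilon>. ennreal (w \<epsilon>) * l)"
  proof (rule Limsup_mono)
    have "\<forall>\<^sub>F \<epsilon> in at_right 0. \<epsilon> \<in> {0<..<\<epsilon>0}" using \<open>0 < \<epsilon>0\<close> by (intro eventually_at_right_real)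
    then show "\<forall>\<^sub>F \<epsilon> in at_right 0. f \<epsilon> \<le> ennreal (w \<epsilon>) * l" by eventually_elim (use bound in auto)
  qed
  ultimately have "Limsup (at_right 0) f \<le> l" by simp
  moreover have "l \<le> Limsup (at_right 0) f" unfolding l_def by (intro Liminf_le_Limsup) simp
  ultimately show "(f \<longlongrightarrow> l) (at_right 0)"
    by (subst tendsto_iff_Liminf_eq_Limsup) (auto simp: l_def)
qed

section \<open>Dirichlet energy of maps into metric spaces\<close>

text \<open>In a nonseparable target the distance of two Borel maps need not be jointly measurable. With a
  countable set \<open>C\<close> dense in the range, \<open>dist a b\<close> is the infimum of \<open>dist a c + dist c b\<close> over \<open>C\<close>.\<close>

lemma pseudometric_of_separable_range:
  fixes v :: "'a::euclidean_space \<Rightarrow> 'x::metric_space"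
  assumes v: "v \<in> borel_measurable borel" and C: "countable C" "range v \<subseteq> closure C"
  shows "measurable_pseudometric (\<lambda>x y. dist (v x) (v y))"
proof -
  have [measurable]: "(\<lambda>z. dist (v (f z)) c) \<in> borel_measurable M" if "f \<in> borel_measurable M"
    for c f and M :: "'c measure"
  proof -
    have "(\<lambda>p. dist p c) \<in> borel_measurable borel" by (intro borel_measurable_continuous_onI continuous_intros)
    from measurable_compose[OF measurable_compose[OF that v] this] show ?thesis .
  qed
  have eq: "{z. dist (v (fst z)) (v (snd z)) < r} = (\<Union>c\<in>C. {z. dist (v (fst z)) c + dist (v (snd z)) c < r})" for r
  proof (intro set_eqI iffI)
    fix z assume "z \<in> {z. dist (v (fst z)) (v (snd z)) < r}"
    then have r: "0 < (r - dist (v (fst z)) (v (snd z))) / 2" by simp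
    have "v (fst z) \<in> closure C" using C(2) by auto
    then obtain c where c: "c \<in> C" "dist c (v (fst z)) < (r - dist (v (fst z)) (v (snd z))) / 2"
      using closure_approachable[THEN iffD1, rule_format, OF _ r] by blast
    have "dist (v (snd z)) c \<le> dist (v (snd z)) (v (fst z)) + dist (v (fst z)) c" by (rule dist_triangle)
    then have "dist (v (fst z)) c + dist (v (snd z)) c < r" using c by (simp add: dist_commute field_simps)
    then show "z \<in> (\<Union>c\<in>C. {z. dist (v (fst z)) c + dist (v (snd z)) c < r})" using c by blast
  next
    fix z assume "z \<in> (\<Union>c\<in>C. {z. dist (v (fst z)) c + dist (v (snd z)) c < r})"
    then obtain c where "dist (v (fst z)) c + dist (v (snd z)) c < r" by auto
    then show "z \<in> {z. dist (v (fst z)) (v (snd z)) < r}"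
      using dist_triangle[of "v (fst z)" "v (snd z)" c] by (simp add: dist_commute)
  qed
  have "(\<lambda>z. dist (v (fst z)) (v (snd z))) \<in> borel_measurable (borel \<Otimes>\<^sub>M borel)"
  proof (rule borel_measurableI_less)
    fix r
    have "{z. dist (v (fst z)) c + dist (v (snd z)) c < r} \<in> sets (borel \<Otimes>\<^sub>M borel)" for c
    proof -
      have "{z \<in> space (borel \<Otimes>\<^sub>M borel). dist (v (fst z)) c + dist (v (snd z)) c < r} \<in> sets (borel \<Otimes>\<^sub>M borel)"
        by measurable
      then show ?thesis by (simp add: space_pair_measure)
    qed
    then have "(\<Union>c\<in>C. {z. dist (v (fst z)) c + dist (v (snd z)) c < r}) \<in> sets (borel \<Otimes>\<^sub>M borel)"
      using C(1) by (intro sets.countable_UN') auto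
    then show "{z \<in> space (borel \<Otimes>\<^sub>M borel). dist (v (fst z)) (v (snd z)) < r} \<in> sets (borel \<Otimes>\<^sub>M borel)"
      by (simp add: space_pair_measure eq)
  qed
  then show ?thesis
    unfolding measurable_pseudometric_def by (auto simp: case_prod_beta' dist_triangle)
qed

text \<open>Outside of \<open>\<Omega>\<close>, and on the exceptional null set, the representative takes the arbitrary value
  \<open>undefined\<close>, which is added to the dense set.\<close>

lemma separable_representative:
  fixes \<Omega> :: "'a::euclidean_space set" and u :: "'a \<Rightarrow> 'x::metric_space"
  assumes \<Omega>: "open \<Omega>" and u: "L2_map (domain_measure \<Omega>) u"
  obtains v C where "v \<in> borel_measurable borel" "countable C" "range v \<subseteq> closure C"
    "AE x in lborel. x \<in> \<Omega> \<longrightarrow> v x = u x"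
proof -
  have sp: "space (domain_measure \<Omega>) = \<Omega>" by (simp add: domain_measure_def space_restrict_space)
  have [measurable]: "\<Omega> \<in> sets borel" using \<Omega> by simp
  have um: "u \<in> borel_measurable (restrict_space lborel \<Omega>)"
    using u by (simp add: L2_map_def domain_measure_def)
  obtain N where N: "N \<in> null_sets (domain_measure \<Omega>)" "separable_space (top_of_set (u ` (\<Omega> - N)))"
    using u sp by (auto simp: L2_map_def)
  have N0: "N \<in> null_sets lborel" "N \<subseteq> \<Omega>"
    using N(1) null_sets_restrict_space[of \<Omega> lborel N] by (auto simp: domain_measure_def)
  have [measurable]: "N \<in> sets borel" using N0 by auto
  obtain C where C: "countable C" "u ` (\<Omega> - N) \<subseteq> closure C"
    using N(2) by (auto simp: separable_space_def closure_of_subtopology)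
  define v where "v x = (if x \<in> \<Omega> - N then u x else undefined)" for x
  show ?thesis
  proof (rule that[of v "insert undefined C"])
    have "(\<lambda>x. if x \<in> \<Omega> then v x else undefined) \<in> borel_measurable lborel"
    proof (subst measurable_restrict_space_iff[symmetric])
      have "(\<lambda>x. if x \<in> \<Omega> - N then u x else undefined) \<in> borel_measurable (restrict_space lborel \<Omega>)"
      proof (rule measurable_If_set[OF um])
        show "(\<Omega> - N) \<inter> space (restrict_space lborel \<Omega>) \<in> sets (restrict_space lborel \<Omega>)"
          by (auto simp: sets_restrict_space space_restrict_space intro!: image_eqI[of _ _ "\<Omega> - N"])
      qed auto
      then show "v \<in> borel_measurable (restrict_space lborel \<Omega>)" unfolding v_def .
    qed auto
    moreover have "(\<lambda>x. if x \<in> \<Omega> then v x else undefined) = v" by (auto simp: v_def)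
    ultimately show "v \<in> borel_measurable borel" by simp
    show "countable (insert undefined C)" using C by simp
    show "range v \<subseteq> closure (insert undefined C)"
    proof -
      have "closure C \<subseteq> closure (insert undefined C)" by (intro closure_mono) auto
      moreover have "undefined \<in> closure (insert undefined C)" using closure_subset by blast
      ultimately show ?thesis using C(2) by (auto simp: v_def)
    qed
    have "AE x in lborel. x \<notin> N" using N0 by (intro AE_not_in)
    then show "AE x in lborel. x \<in> \<Omega> \<longrightarrow> v x = u x" by eventually_elim (simp add: v_def)
  qed
qed

lemma pseudometric_compose:
  fixes v :: "'a::euclidean_space \<Rightarrow> 'x::metric_space" and f :: "'x \<Rightarrow> 'y::metric_space"
  assumes "v \<in> borel_measurable borel" "countable C" "range v \<subseteq> closure C" and f: "continuous_on UNIV f"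
  shows "measurable_pseudometric (\<lambda>x y. dist (f (v x)) (f (v y)))"
proof (rule pseudometric_of_separable_range)
  show "(\<lambda>x. f (v x)) \<in> borel_measurable borel"
    using measurable_compose[OF assms(1) borel_measurable_continuous_onI[OF f]] .
  show "countable (f ` C)" using assms by simp
  have "f ` closure C \<subseteq> closure (f ` C)"
    using continuous_on_subset[OF f] by (intro image_closure_subset[of C f]) (auto intro: closure_subset[THEN subsetD])
  then show "range (\<lambda>x. f (v x)) \<subseteq> closure (f ` C)" using assms(3) by auto
qed

lemma Dir_const_pos: "0 < Dir_const TYPE('a::euclidean_space)"
proof -
  let ?f = "\<lambda>z::'a. indicator (ball 0 1) z *\<^sub>R (norm z)\<^sup>2"
  have int: "integrable lborel ?f"
  proof (rule Bochner_Integration.integrable_bound[of lborel "indicat_real (ball (0::'a) 1)"])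
    show "integrable lborel (indicat_real (ball (0::'a) 1))"
      using emeasure_bounded_finite[OF bounded_ball, of "0::'a" 1] by (intro integrable_real_indicator) auto
    show "AE x in lborel. norm (?f x) \<le> norm (indicat_real (ball (0::'a) 1) x)"
      by (intro AE_I2) (auto simp: indicator_def power_le_one abs_square_le_1)
    have "(\<lambda>z::'a. (norm z)\<^sup>2) \<in> borel_measurable borel"
      by (intro borel_measurable_continuous_onI continuous_intros)
    then show "?f \<in> borel_measurable lborel"
      by (intro borel_measurable_scaleR borel_measurable_indicator) auto
  qed
  have "(LINT z|lborel. ?f z) \<noteq> 0"
  proof
    assume "(LINT z|lborel. ?f z) = 0"
    then have "AE z in lborel. ?f z = 0" using int by (subst (asm) integral_nonneg_eq_0_iff_AE) auto
    moreover have "AE z in lborel. z \<noteq> (0::'a)" by (rule AE_lborel_singleton)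
    ultimately have "AE z in lborel. z \<notin> ball (0::'a) 1" by eventually_elim (auto simp: indicator_def)
    then have "emeasure lborel (ball (0::'a) 1) = 0" by (subst (asm) AE_iff_measurable[of "ball 0 1"]) auto
    moreover have "0 < emeasure lborel (ball (0::'a) 1)" by (simp add: emeasure_ball)
    ultimately show False by simp
  qed
  moreover have "0 \<le> (LINT z|lborel. ?f z)" by (intro integral_nonneg_AE) auto
  ultimately have "0 < (LINT z|lborel. ?f z)" by linarith
  then show ?thesis unfolding Dir_const_def set_lebesgue_integral_def by simp
qed

lemma Dir_eps_eq:
  fixes \<Omega> :: "'a::euclidean_space set" and u v :: "'a \<Rightarrow> 'x::metric_space"
  assumes "AE x in lborel. x \<in> \<Omega> \<longrightarrow> v x = u x"
  shows "Dir_eps \<Omega> \<epsilon> u = pair_energy \<Omega> \<epsilon> (\<lambda>x y. dist (v x) (v y)) / ennreal (2 * Dir_const TYPE('a) * \<epsilon> ^ (DIM('a) + 2))"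
proof -
  have "(\<integral>\<^sup>+x\<in>\<Omega>. (\<integral>\<^sup>+y\<in>\<Omega>. ennreal ((dist (u x) (u y))\<^sup>2) * indicator {y. norm (x - y) \<le> \<epsilon>} y \<partial>lborel) \<partial>lborel)
      = pair_energy \<Omega> \<epsilon> (\<lambda>x y. dist (v x) (v y))"
    unfolding pair_energy_def
  proof (rule nn_integral_cong_AE, use assms in eventually_elim)
    fix x assume x: "x \<in> \<Omega> \<longrightarrow> v x = u x"
    show "(\<integral>\<^sup>+y\<in>\<Omega>. ennreal ((dist (u x) (u y))\<^sup>2) * indicator {y. norm (x - y) \<le> \<epsilon>} y \<partial>lborel) * indicator \<Omega> x
      = (\<integral>\<^sup>+y\<in>\<Omega>. ennreal ((dist (v x) (v y))\<^sup>2) * indicator {y. norm (x - y) \<le> \<epsilon>} y \<partial>lborel) * indicator \<Omega> x"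
    proof (cases "x \<in> \<Omega>")
      case True
      have "(\<integral>\<^sup>+y\<in>\<Omega>. ennreal ((dist (u x) (u y))\<^sup>2) * indicator {y. norm (x - y) \<le> \<epsilon>} y \<partial>lborel)
        = (\<integral>\<^sup>+y\<in>\<Omega>. ennreal ((dist (v x) (v y))\<^sup>2) * indicator {y. norm (x - y) \<le> \<epsilon>} y \<partial>lborel)"
        by (rule nn_integral_cong_AE, use assms in eventually_elim) (use x True in \<open>auto simp: indicator_def\<close>)
      then show ?thesis by simp
    qed simp
  qed
  then show ?thesis by (simp add: Dir_eps_def)
qed

text \<open>The second conclusion improves \<open>Dir \<Omega> u = 0\<close>, a statement about a limit, to the vanishing of the
  energy at a fixed scale, from which local constancy can be read off.\<close>

lemma Dir_eps_convergence:
  fixes \<Omega> :: "'a::euclidean_space set"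
  assumes dom: "bounded_C2_holder_domain \<alpha> \<Omega>" "0 < \<alpha>"
  obtains \<epsilon>0 where "0 < \<epsilon>0"
    "\<And>u v :: 'a \<Rightarrow> 'x::metric_space. measurable_pseudometric (\<lambda>x y. dist (v x) (v y)) \<Longrightarrow> AE x in lborel. x \<in> \<Omega> \<longrightarrow> v x = u x \<Longrightarrow>
        ((\<lambda>\<epsilon>. Dir_eps \<Omega> \<epsilon> u) \<longlongrightarrow> Dir \<Omega> u) (at_right 0)"
    "\<And>u v :: 'a \<Rightarrow> 'x::metric_space. measurable_pseudometric (\<lambda>x y. dist (v x) (v y)) \<Longrightarrow> AE x in lborel. x \<in> \<Omega> \<longrightarrow> v x = u x \<Longrightarrow>
        Dir \<Omega> u = 0 \<Longrightarrow> pair_energy \<Omega> \<epsilon>0 (\<lambda>x y. dist (v x) (v y)) = 0"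
proof -
  obtain w :: "real \<Rightarrow> real" and \<epsilon>0 where w: "0 < \<epsilon>0" "\<And>\<epsilon>. 0 < \<epsilon> \<Longrightarrow> 0 < w \<epsilon>" "(w \<longlongrightarrow> 1) (at_right 0)"
    "\<And>q \<epsilon> \<delta> k. measurable_pseudometric q \<Longrightarrow> 0 < \<epsilon> \<Longrightarrow> \<epsilon> \<le> \<epsilon>0 \<Longrightarrow> 0 < \<delta> \<Longrightarrow> \<delta> \<le> \<epsilon>\<^sup>2 \<Longrightarrow> 0 < k \<Longrightarrow>
       pair_energy \<Omega> \<epsilon> q / ennreal (k * \<epsilon> ^ (DIM('a) + 2)) \<le> ennreal (w \<epsilon>) * (pair_energy \<Omega> \<delta> q / ennreal (k * \<delta> ^ (DIM('a) + 2)))"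
    by (rule pair_energy_almost_decreasing[OF dom]) (rule that)
  have k: "0 < 2 * Dir_const TYPE('a)" using Dir_const_pos by simp
  have main: "((\<lambda>\<epsilon>. Dir_eps \<Omega> \<epsilon> u) \<longlongrightarrow> Dir \<Omega> u) (at_right 0) \<and> Dir_eps \<Omega> \<epsilon>0 u \<le> ennreal (w \<epsilon>0) * Dir \<Omega> u"
    if v: "measurable_pseudometric (\<lambda>x y. dist (v x) (v y))" "AE x in lborel. x \<in> \<Omega> \<longrightarrow> v x = u x"
    for u v :: "'a \<Rightarrow> 'x"
  proof -
    have dec: "Dir_eps \<Omega> \<epsilon> u \<le> ennreal (w \<epsilon>) * Dir_eps \<Omega> \<delta> u" if "0 < \<epsilon>" "\<epsilon> \<le> \<epsilon>0" "0 < \<delta>" "\<delta> \<le> \<epsilon>\<^sup>2" for \<epsilon> \<delta>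
      unfolding Dir_eps_eq[OF v(2)] by (rule w(4)[OF v(1) that k])
    have lim: "((\<lambda>\<epsilon>. Dir_eps \<Omega> \<epsilon> u) \<longlongrightarrow> Liminf (at_right 0) (\<lambda>\<epsilon>. Dir_eps \<Omega> \<epsilon> u)) (at_right 0)"
      by (rule tendsto_of_almost_decreasing(1)[OF w(1-3) dec])
    then have D: "Dir \<Omega> u = Liminf (at_right 0) (\<lambda>\<epsilon>. Dir_eps \<Omega> \<epsilon> u)"
      unfolding Dir_def by (intro tendsto_Lim) auto
    show ?thesis
      unfolding D using lim tendsto_of_almost_decreasing(2)[OF w(1-3) dec w(1)] by simp
  qed
  show ?thesis
  proof (rule that[OF w(1)])
    fix u v :: "'a \<Rightarrow> 'x"
    assume v: "measurable_pseudometric (\<lambda>x y. dist (v x) (v y))" "AE x in lborel. x \<in> \<Omega> \<longrightarrow> v x = u x"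
    show "((\<lambda>\<epsilon>. Dir_eps \<Omega> \<epsilon> u) \<longlongrightarrow> Dir \<Omega> u) (at_right 0)" using main[OF v] by blast
    assume "Dir \<Omega> u = 0"
    then have "Dir_eps \<Omega> \<epsilon>0 u = 0" using main[OF v] by simp
    then show "pair_energy \<Omega> \<epsilon>0 (\<lambda>x y. dist (v x) (v y)) = 0"
      unfolding Dir_eps_eq[OF v(2)] by (simp add: ennreal_divide_eq_0_iff)
  qed
qed

lemma AE_lborel_open_witness:
  fixes S :: "'a::euclidean_space set"
  assumes "open S" "S \<noteq> {}" "AE x in lborel. P x"
  obtains x where "x \<in> S" "P x"
proof (rule ccontr)
  assume "\<not> thesis"
  then have "AE x in lborel. x \<notin> S" using assms(3) that by (auto elim: eventually_mono)
  then have "S \<in> null_sets lborel" using assms(1) by (subst (asm) AE_iff_null_sets[symmetric]) auto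
  then have "negligible S" by (simp add: negligible_iff_null_sets null_sets_completionI)
  then show False using open_not_negligible assms by blast
qed

text \<open>Almost every point \<open>x\<close> sees the value \<open>g x\<close> at almost every point within distance \<open>\<epsilon>\<close>. Hence \<open>g\<close> is
  almost everywhere constant on balls of radius \<open>\<epsilon> / 2\<close> around points of \<open>\<Omega>\<close>, and the constants
  of balls around nearby points agree.\<close>

lemma constant_of_zero_pair_energy:
  fixes g :: "'a::euclidean_space \<Rightarrow> 'x::metric_space"
  assumes \<Omega>: "open \<Omega>" "connected \<Omega>" "bounded \<Omega>" "\<Omega> \<noteq> {}" and "0 < \<epsilon>"
    and q: "measurable_pseudometric (\<lambda>x y. dist (g x) (g y))"
    and zero: "pair_energy \<Omega> \<epsilon> (\<lambda>x y. dist (g x) (g y)) = 0"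
  obtains c where "AE x in lborel. x \<in> \<Omega> \<longrightarrow> g x = c"
proof -
  define Q where "Q = pair_density \<Omega> \<epsilon> (\<lambda>x y. dist (g x) (g y))"
  have Q: "case_prod Q \<in> borel_measurable (borel \<Otimes>\<^sub>M borel)"
    unfolding Q_def by (rule pair_density_measurable[OF \<Omega>(1) q])
  have [measurable]: "(\<lambda>z. Q (f z) (h z)) \<in> borel_measurable M"
    if "f \<in> borel_measurable M" "h \<in> borel_measurable M" for f h and M :: "'c measure"
    using measurable_compose[OF measurable_Pair[OF that] Q] by simp
  have "AE x in lborel. (\<integral>\<^sup>+y. Q x y \<partial>lborel) = 0"
    using zero unfolding pair_energy_eq Q_def[symmetric] by (subst (asm) nn_integral_0_iff_AE) auto
  then have P: "AE x in lborel. x \<in> \<Omega> \<longrightarrow> (AE y in lborel. y \<in> \<Omega> \<and> dist x y \<le> \<epsilon> \<longrightarrow> g y = g x)"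
  proof eventually_elim
    case (elim x)
    then have "AE y in lborel. Q x y = 0" by (subst (asm) nn_integral_0_iff_AE) auto
    then show ?case by (auto elim!: eventually_mono simp: Q_def pair_density_def dist_norm split: if_splits)
  qed
  define K where "K z c \<longleftrightarrow> (AE y in lborel. y \<in> \<Omega> \<inter> ball z (\<epsilon> / 2) \<longrightarrow> g y = c)" for z c
  have ex: "\<exists>c. K z c" if z: "z \<in> \<Omega>" for z
  proof -
    have "z \<in> \<Omega> \<inter> ball z (\<epsilon> / 2)" using z \<open>0 < \<epsilon>\<close> by simp
    then have ne: "\<Omega> \<inter> ball z (\<epsilon> / 2) \<noteq> {}" by blast
    obtain x where x: "x \<in> \<Omega> \<inter> ball z (\<epsilon> / 2)" "x \<in> \<Omega> \<longrightarrow> (AE y in lborel. y \<in> \<Omega> \<and> dist x y \<le> \<epsilon> \<longrightarrow> g y = g x)"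
      by (rule AE_lborel_open_witness[OF _ ne P]) (use \<Omega> in auto)
    then have "AE y in lborel. y \<in> \<Omega> \<and> dist x y \<le> \<epsilon> \<longrightarrow> g y = g x" by auto
    then have "K z (g x)" unfolding K_def
    proof eventually_elim
      case (elim y)
      then show ?case using x dist_triangle[of x y z] by (auto simp: dist_commute)
    qed
    then show ?thesis by blast
  qed
  have uniq: "c = c'" if K: "K z c" "K z' c'" and z: "z \<in> \<Omega>" "z' \<in> \<Omega>" "z' \<in> ball z (\<epsilon> / 2)" for z z' c c'
  proof -
    have "z' \<in> \<Omega> \<inter> ball z (\<epsilon> / 2) \<inter> ball z' (\<epsilon> / 2)" using z \<open>0 < \<epsilon>\<close> by simp
    then have ne: "\<Omega> \<inter> ball z (\<epsilon> / 2) \<inter> ball z' (\<epsilon> / 2) \<noteq> {}" by blast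
    have "AE y in lborel. (y \<in> \<Omega> \<inter> ball z (\<epsilon> / 2) \<longrightarrow> g y = c) \<and> (y \<in> \<Omega> \<inter> ball z' (\<epsilon> / 2) \<longrightarrow> g y = c')"
      using K unfolding K_def by eventually_elim auto
    then obtain y where "y \<in> \<Omega> \<inter> ball z (\<epsilon> / 2) \<inter> ball z' (\<epsilon> / 2)"
      "(y \<in> \<Omega> \<inter> ball z (\<epsilon> / 2) \<longrightarrow> g y = c) \<and> (y \<in> \<Omega> \<inter> ball z' (\<epsilon> / 2) \<longrightarrow> g y = c')"
      by (rule AE_lborel_open_witness[OF _ ne, rotated]) (use \<Omega> in auto)
    then show ?thesis by auto
  qed
  define k where "k z = (SOME c. K z c)" for z
  have k: "K z (k z)" if "z \<in> \<Omega>" for z unfolding k_def using ex[OF that] by (rule someI_ex)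
  obtain z0 where z0: "z0 \<in> \<Omega>" using \<Omega> by auto
  have kconst: "k z = k z0" if "z \<in> \<Omega>" for z
  proof (rule connected_local_const[OF \<Omega>(2) that z0])
    show "\<forall>a\<in>\<Omega>. \<forall>\<^sub>F b in at a within \<Omega>. k a = k b"
    proof
      fix a assume a: "a \<in> \<Omega>"
      have "\<forall>\<^sub>F b in at a within \<Omega>. b \<in> \<Omega> \<and> b \<in> ball a (\<epsilon> / 2)"
        using \<open>0 < \<epsilon>\<close> by (auto simp: eventually_at dist_commute intro!: exI[of _ "\<epsilon> / 2"])
      then show "\<forall>\<^sub>F b in at a within \<Omega>. k a = k b"
        by eventually_elim (use uniq k a in blast)
    qed
  qed
  have cover: "closure \<Omega> \<subseteq> (\<Union>z\<in>\<Omega>. ball z (\<epsilon> / 2))"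
  proof
    fix x assume "x \<in> closure \<Omega>"
    moreover have "0 < \<epsilon> / 2" using \<open>0 < \<epsilon>\<close> by simp
    ultimately obtain z where "z \<in> \<Omega>" "dist z x < \<epsilon> / 2" unfolding closure_approachable by blast
    then show "x \<in> (\<Union>z\<in>\<Omega>. ball z (\<epsilon> / 2))" by auto
  qed
  have cpt: "compact (closure \<Omega>)" using \<Omega> by simp
  obtain F where F: "F \<subseteq> \<Omega>" "finite F" "closure \<Omega> \<subseteq> (\<Union>z\<in>F. ball z (\<epsilon> / 2))"
    by (rule compactE_image[OF cpt _ cover]) auto
  have "AE y in lborel. \<forall>z\<in>F. y \<in> \<Omega> \<inter> ball z (\<epsilon> / 2) \<longrightarrow> g y = k z0"
  proof (rule AE_finite_allI[OF F(2)])
    fix z assume "z \<in> F"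
    then have "z \<in> \<Omega>" using F by blast
    then show "AE y in lborel. y \<in> \<Omega> \<inter> ball z (\<epsilon> / 2) \<longrightarrow> g y = k z0"
      using k[of z] kconst[of z] by (simp add: K_def)
  qed
  then have "AE y in lborel. y \<in> \<Omega> \<longrightarrow> g y = k z0"
    by eventually_elim (use F(3) closure_subset[of \<Omega>] in blast)
  then show ?thesis by (rule that)
qed

section \<open>Traces and the maximum principle\<close>

lemma space_boundary_measure: "space (boundary_measure \<Omega>) = frontier \<Omega>"
  by (simp add: boundary_measure_def space_restrict_space space_hausdorff_measure)

lemma AE_domain_measure:
  assumes "open \<Omega>"
  shows "(AE x in domain_measure \<Omega>. P x) \<longleftrightarrow> (AE x in lborel. x \<in> \<Omega> \<longrightarrow> P x)"
  unfolding domain_measure_def using assms by (subst AE_restrict_space_iff) auto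

lemma boundary_measure_nonzero:
  fixes \<Omega> :: "'a::euclidean_space set"
  assumes "open \<Omega>" "bounded \<Omega>" "\<Omega> \<noteq> {}"
  shows "emeasure (boundary_measure \<Omega>) (space (boundary_measure \<Omega>)) \<noteq> 0"
proof -
  have "emeasure (boundary_measure \<Omega>) (frontier \<Omega>) = hausdorff_outer (DIM('a) - 1) (frontier \<Omega>)"
    unfolding boundary_measure_def
    by (subst emeasure_restrict_space) (auto simp: sets_hausdorff_measure space_hausdorff_measure emeasure_hausdorff_measure)
  then show ?thesis using hausdorff_outer_frontier_nonzero[OF assms] by (simp add: space_boundary_measure)
qed

lemma AE_False_iff: "(AE x in M. False) \<longleftrightarrow> emeasure M (space M) = 0"
  by (simp add: ae_filter_eq_bot_iff[symmetric] trivial_limit_def)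

lemma AE_witness:
  assumes "emeasure M (space M) \<noteq> 0" "AE x in M. P x"
  obtains x where "x \<in> space M" "P x"
proof (rule ccontr)
  assume "\<not> thesis"
  have "AE x in M. False" using assms(2) AE_space[of M]
    by eventually_elim (use \<open>\<not> thesis\<close> that in blast)
  then show False using assms(1) by (simp add: AE_False_iff)
qed

text \<open>The trace at \<open>x0\<close> is the limit of \<open>u'\<close> along a flow line. The set where \<open>u'\<close> violates the closed
  condition is a null set, so from almost every \<open>x0\<close> the flow line leaves it at arbitrarily small
  times.\<close>

lemma trace_in_closed:
  fixes u b :: "'a::euclidean_space \<Rightarrow> 'x::metric_space"
  assumes dom: "bounded_C2_holder_domain \<alpha> \<Omega>" "0 < \<alpha>" and tr: "is_trace \<Omega> u b"
    and F: "closed F" and u: "AE x in domain_measure \<Omega>. u x \<in> F"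
  shows "AE x in boundary_measure \<Omega>. b x \<in> F"
proof -
  have op: "open \<Omega>" using dom by (simp add: bounded_C2_holder_domain_def)
  obtain Z where Z: "inward_transversal \<Omega> Z" "trace_along \<Omega> Z u b" using tr by (auto simp: is_trace_def)
  obtain u' where u': "AE x in domain_measure \<Omega>. u' x = u x"
    "AE x0 in boundary_measure \<Omega>. \<exists>T>0. \<exists>\<gamma>.
           \<gamma> 0 = x0 \<and>
           (\<forall>t\<in>{0..<T}. (\<gamma> has_vector_derivative Z (\<gamma> t)) (at t within {0..<T})) \<and>
           (\<forall>t\<in>{0<..<T}. \<gamma> t \<in> \<Omega>) \<and>
           holder_on {0<..<T} (\<lambda>t. u' (\<gamma> t)) \<and>
           ((\<lambda>t. u' (\<gamma> t)) \<longlongrightarrow> b x0) (at_right 0)"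
    using Z(2) by (auto simp: trace_along_def)
  have "AE x in lborel. x \<in> \<Omega> \<longrightarrow> u' x \<in> F"
  proof -
    have "AE x in lborel. x \<in> \<Omega> \<longrightarrow> u' x = u x" "AE x in lborel. x \<in> \<Omega> \<longrightarrow> u x \<in> F"
      using u' u by (simp_all add: AE_domain_measure[OF op])
    then show ?thesis by eventually_elim auto
  qed
  then obtain N where N: "N \<in> null_sets lborel" "{x. \<not> (x \<in> \<Omega> \<longrightarrow> u' x \<in> F)} \<subseteq> N"
    by (auto simp: eventually_ae_filter)
  have neg: "negligible N" using N(1) by (simp add: negligible_iff_null_sets null_sets_completionI)
  from u'(2) flow_lines_leave_null_set[OF dom Z(1) neg] show ?thesis
  proof eventually_elim
    case (elim x0)
    then obtain T \<gamma> where T: "0 < T" and \<gamma>: "\<gamma> 0 = x0" "flow_line \<Omega> Z T \<gamma>"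
      and lim: "((\<lambda>t. u' (\<gamma> t)) \<longlongrightarrow> b x0) (at_right 0)"
      unfolding flow_line_def by blast
    have freq: "\<exists>\<^sub>F t in at_right 0. u' (\<gamma> t) \<in> F"
      unfolding frequently_def
    proof
      assume "\<forall>\<^sub>F t in at_right 0. u' (\<gamma> t) \<notin> F"
      then obtain s where s: "0 < s" "\<And>t. 0 < t \<Longrightarrow> t < s \<Longrightarrow> u' (\<gamma> t) \<notin> F"
        by (auto simp: eventually_at_right_field)
      define T' where "T' = min s T"
      have "0 < T'" "flow_line \<Omega> Z T' \<gamma>" using s T flow_line_restrict[OF \<gamma>(2), of T'] by (auto simp: T'_def)
      then obtain t where t: "t \<in> {0<..<T'}" "\<gamma> t \<notin> N" using elim(2) \<gamma>(1) by blast
      then have "\<gamma> t \<in> \<Omega>" using \<open>flow_line \<Omega> Z T' \<gamma>\<close> by (auto simp: flow_line_def)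
      then have "u' (\<gamma> t) \<in> F" using N t by blast
      then show False using s t by (auto simp: T'_def)
    qed
    show ?case
    proof (rule ccontr)
      assume "b x0 \<notin> F"
      then have "\<forall>\<^sub>F t in at_right 0. u' (\<gamma> t) \<in> - F"
        using lim F by (intro topological_tendstoD) auto
      then show False using freq by (simp add: frequently_def)
    qed
  qed
qed

lemma nonexpansive_continuous:
  fixes f :: "'x::metric_space \<Rightarrow> 'y::metric_space"
  assumes "\<And>y z. dist (f y) (f z) \<le> dist y z"
  shows "continuous_on UNIV f"
  using assms by (intro lipschitz_on_continuous_on[of 1]) (auto intro!: lipschitz_onI)

lemma is_trace_compose:
  fixes f :: "'x::metric_space \<Rightarrow> 'x"
  assumes tr: "is_trace \<Omega> u b" and f: "\<And>y z. dist (f y) (f z) \<le> dist y z"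
    and fix_b: "AE x in boundary_measure \<Omega>. f (b x) = b x"
  shows "is_trace \<Omega> (\<lambda>x. f (u x)) b"
proof -
  obtain Z u' where Z: "inward_transversal \<Omega> Z" "AE x in domain_measure \<Omega>. u' x = u x"
    "AE x0 in boundary_measure \<Omega>. \<exists>T>0. \<exists>\<gamma>.
           \<gamma> 0 = x0 \<and>
           (\<forall>t\<in>{0..<T}. (\<gamma> has_vector_derivative Z (\<gamma> t)) (at t within {0..<T})) \<and>
           (\<forall>t\<in>{0<..<T}. \<gamma> t \<in> \<Omega>) \<and>
           holder_on {0<..<T} (\<lambda>t. u' (\<gamma> t)) \<and>
           ((\<lambda>t. u' (\<gamma> t)) \<longlongrightarrow> b x0) (at_right 0)"
    using tr by (auto simp: is_trace_def trace_along_def)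
  have hol: "holder_on I (\<lambda>t. f (h t))" if "holder_on I h" for I and h :: "real \<Rightarrow> 'x"
    using that f unfolding holder_on_def by (meson order_trans)
  have cont: "((\<lambda>t. f (h t)) \<longlongrightarrow> f l) G" if "(h \<longlongrightarrow> l) G" for h l and G :: "real filter"
    using that nonexpansive_continuous[OF f] by (intro continuous_on_tendsto_compose[of UNIV f]) auto
  have "trace_along \<Omega> Z (\<lambda>x. f (u x)) b"
    unfolding trace_along_def
  proof (intro exI conjI)
    show "AE x in domain_measure \<Omega>. f (u' x) = f (u x)" using Z(2) by eventually_elim simp
    show "AE x0 in boundary_measure \<Omega>. \<exists>T>0. \<exists>\<gamma>.
           \<gamma> 0 = x0 \<and>
           (\<forall>t\<in>{0..<T}. (\<gamma> has_vector_derivative Z (\<gamma> t)) (at t within {0..<T})) \<and>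
           (\<forall>t\<in>{0<..<T}. \<gamma> t \<in> \<Omega>) \<and>
           holder_on {0<..<T} (\<lambda>t. f (u' (\<gamma> t))) \<and>
           ((\<lambda>t. f (u' (\<gamma> t))) \<longlongrightarrow> b x0) (at_right 0)"
      using Z(3) fix_b
    proof eventually_elim
      case (elim x0)
      then obtain T \<gamma> where "0 < T" "\<gamma> 0 = x0"
        "\<forall>t\<in>{0..<T}. (\<gamma> has_vector_derivative Z (\<gamma> t)) (at t within {0..<T})" "\<forall>t\<in>{0<..<T}. \<gamma> t \<in> \<Omega>"
        and h: "holder_on {0<..<T} (\<lambda>t. u' (\<gamma> t))" "((\<lambda>t. u' (\<gamma> t)) \<longlongrightarrow> b x0) (at_right 0)"
        by blast
      moreover have "((\<lambda>t. f (u' (\<gamma> t))) \<longlongrightarrow> b x0) (at_right 0)" using cont[OF h(2)] elim(2) by simp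
      ultimately show ?case using hol[OF h(1)] by blast
    qed
  qed
  then show ?thesis using tr Z(1) unfolding is_trace_def by blast
qed

lemma L2_map_compose:
  fixes f :: "'x::metric_space \<Rightarrow> 'x"
  assumes u: "L2_map M u" and f: "\<And>y z. dist (f y) (f z) \<le> dist y z"
  shows "L2_map M (\<lambda>x. f (u x))"
proof -
  have cf: "continuous_on UNIV f" using f by (rule nonexpansive_continuous)
  have um: "u \<in> borel_measurable M" using u by (simp add: L2_map_def)
  have fm: "(\<lambda>x. f (u x)) \<in> borel_measurable M"
    using measurable_compose[OF um borel_measurable_continuous_onI[OF cf]] .
  obtain N where N: "N \<in> null_sets M" "separable_space (top_of_set (u ` (space M - N)))"
    using u by (auto simp: L2_map_def)
  obtain v where v: "integrable M (\<lambda>x. (dist (u x) v)\<^sup>2)" using u by (auto simp: L2_map_def)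
  have "separable_space (top_of_set (f ` (u ` (space M - N))))"
  proof (rule separable_space_continuous_map_image)
    show "continuous_map (top_of_set (u ` (space M - N))) (top_of_set (f ` (u ` (space M - N)))) f"
      using continuous_on_subset[OF cf] by (auto simp: continuous_map_in_subtopology)
  qed (use N in auto)
  then have sep: "separable_space (top_of_set ((\<lambda>x. f (u x)) ` (space M - N)))" by (simp only: image_image)
  have "integrable M (\<lambda>x. (dist (f (u x)) (f v))\<^sup>2)"
  proof (rule Bochner_Integration.integrable_bound[OF v])
    have "(\<lambda>p. dist p (f v)) \<in> borel_measurable borel" by (intro borel_measurable_continuous_onI continuous_intros)
    from measurable_compose[OF fm this] show "(\<lambda>x. (dist (f (u x)) (f v))\<^sup>2) \<in> borel_measurable M" by measurable
    show "AE x in M. norm ((dist (f (u x)) (f v))\<^sup>2) \<le> norm ((dist (u x) v)\<^sup>2)"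
      using f by (intro AE_I2) (auto intro: power_mono)
  qed
  then show ?thesis unfolding L2_map_def using fm N(1) sep by (intro conjI bexI[of _ N] exI[of _ "f v"])
qed

text \<open>Integrates the pointwise estimate \<open>fg\<close>. Additivity of the integral requires the measurable
  representative \<open>v\<close>.\<close>

lemma Dir_eps_add_le:
  fixes f :: "'x::metric_space \<Rightarrow> 'x" and g :: "'x \<Rightarrow> real"
  assumes \<Omega>: "open \<Omega>" and v: "AE x in lborel. x \<in> \<Omega> \<longrightarrow> v x = u x"
    and qf: "measurable_pseudometric (\<lambda>x y. dist (f (v x)) (f (v y)))"
    and qg: "measurable_pseudometric (\<lambda>x y. dist (g (v x)) (g (v y)))"
    and fg: "\<And>y z. (dist (f y) (f z))\<^sup>2 + (g y - g z)\<^sup>2 \<le> (dist y z)\<^sup>2"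
  shows "Dir_eps \<Omega> \<epsilon> (\<lambda>x. f (u x)) + Dir_eps \<Omega> \<epsilon> (\<lambda>x. g (u x)) \<le> Dir_eps \<Omega> \<epsilon> u"
proof -
  have vf: "AE x in lborel. x \<in> \<Omega> \<longrightarrow> f (v x) = f (u x)" using v by eventually_elim simp
  have vg: "AE x in lborel. x \<in> \<Omega> \<longrightarrow> g (v x) = g (u x)" using v by eventually_elim simp
  define Qf where "Qf = pair_density \<Omega> \<epsilon> (\<lambda>x y. dist (f (v x)) (f (v y)))"
  define Qg where "Qg = pair_density \<Omega> \<epsilon> (\<lambda>x y. dist (g (v x)) (g (v y)))"
  have mf: "case_prod Qf \<in> borel_measurable (borel \<Otimes>\<^sub>M borel)"
    unfolding Qf_def by (rule pair_density_measurable[OF \<Omega> qf])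
  have mg: "case_prod Qg \<in> borel_measurable (borel \<Otimes>\<^sub>M borel)"
    unfolding Qg_def by (rule pair_density_measurable[OF \<Omega> qg])
  have [measurable]: "(\<lambda>z. Qf (h z) (k z)) \<in> borel_measurable M"
    if "h \<in> borel_measurable M" "k \<in> borel_measurable M" for h k and M :: "'c measure"
    using measurable_compose[OF measurable_Pair[OF that] mf] by simp
  have [measurable]: "(\<lambda>z. Qg (h z) (k z)) \<in> borel_measurable M"
    if "h \<in> borel_measurable M" "k \<in> borel_measurable M" for h k and M :: "'c measure"
    using measurable_compose[OF measurable_Pair[OF that] mg] by simp
  have "pair_energy \<Omega> \<epsilon> (\<lambda>x y. dist (f (v x)) (f (v y))) + pair_energy \<Omega> \<epsilon> (\<lambda>x y. dist (g (v x)) (g (v y)))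
      = (\<integral>\<^sup>+x. \<integral>\<^sup>+y. Qf x y + Qg x y \<partial>lborel \<partial>lborel)"
    unfolding pair_energy_eq Qf_def[symmetric] Qg_def[symmetric]
    by (subst nn_integral_add[symmetric]; measurable?) (simp add: nn_integral_add)
  also have "\<dots> \<le> pair_energy \<Omega> \<epsilon> (\<lambda>x y. dist (v x) (v y))"
    unfolding pair_energy_eq
  proof (intro nn_integral_mono)
    fix x y
    have "ennreal ((dist (f (v x)) (f (v y)))\<^sup>2) + ennreal ((dist (g (v x)) (g (v y)))\<^sup>2) \<le> ennreal ((dist (v x) (v y))\<^sup>2)"
      using fg[of "v x" "v y"] by (simp add: dist_real_def ennreal_leI flip: ennreal_plus)
    then show "Qf x y + Qg x y \<le> pair_density \<Omega> \<epsilon> (\<lambda>x y. dist (v x) (v y)) x y"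
      by (simp add: Qf_def Qg_def pair_density_def)
  qed
  finally have "pair_energy \<Omega> \<epsilon> (\<lambda>x y. dist (f (v x)) (f (v y))) + pair_energy \<Omega> \<epsilon> (\<lambda>x y. dist (g (v x)) (g (v y)))
      \<le> pair_energy \<Omega> \<epsilon> (\<lambda>x y. dist (v x) (v y))" .
  then show ?thesis
    unfolding Dir_eps_eq[OF v] Dir_eps_eq[OF vf] Dir_eps_eq[OF vg]
    unfolding divide_ennreal_def distrib_right[symmetric] by (rule mult_right_mono) simp
qed

text \<open>The competitor is \<open>w = f \<circ> u\<close>. Minimality of \<open>u\<close> and the improved contraction leave no energy for
  \<open>g \<circ> u\<close>, so it is a constant \<open>c\<close>; passing to the trace identifies \<open>c = 0\<close>.\<close>

lemma (in EVI_flow) harmonic_map_sublevel: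
  fixes \<Omega> :: "'a::euclidean_space set" and u ub :: "'a \<Rightarrow> 'x"
  assumes dom: "bounded_C2_holder_domain \<alpha> \<Omega>" "0 < \<alpha>" and harm: "harmonic_map \<Omega> u"
    and tr: "is_trace \<Omega> u ub" and M: "AE x in boundary_measure \<Omega>. E (ub x) \<le> ereal M"
  shows "AE x in domain_measure \<Omega>. E (u x) \<le> ereal M"
proof -
  have \<Omega>: "open \<Omega>" "connected \<Omega>" "bounded \<Omega>" "\<Omega> \<noteq> {}"
    using dom by (auto simp: bounded_C2_holder_domain_def)
  define f where "f = retract M"
  define g where "g = retraction_time M"
  have fg: "(dist (f y) (f z))\<^sup>2 + (g y - g z)\<^sup>2 \<le> (dist y z)\<^sup>2" for y z
    unfolding f_def g_def by (rule retract_improved_contraction)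
  have f1: "dist (f y) (f z) \<le> dist y z" for y z
  proof (rule power2_le_imp_le)
    have "0 \<le> (g y - g z)\<^sup>2" by simp
    then show "(dist (f y) (f z))\<^sup>2 \<le> (dist y z)\<^sup>2" using fg[of y z] by linarith
  qed simp
  have g1: "dist (g y) (g z) \<le> dist y z" for y z
  proof (rule power2_le_imp_le)
    have "0 \<le> (dist (f y) (f z))\<^sup>2" by simp
    then show "(dist (g y) (g z))\<^sup>2 \<le> (dist y z)\<^sup>2" using fg[of y z] unfolding dist_real_def power2_abs by linarith
  qed simp
  have cf: "continuous_on UNIV f" and cg: "continuous_on UNIV g"
    using f1 g1 by (auto intro: nonexpansive_continuous)
  have u: "L2_map (domain_measure \<Omega>) u" "Dir \<Omega> u < \<infinity>" using harm by (auto simp: harmonic_map_def H1_map_def)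
  obtain v C where v: "v \<in> borel_measurable borel" "countable C" "range v \<subseteq> closure C"
    "AE x in lborel. x \<in> \<Omega> \<longrightarrow> v x = u x"
    by (rule separable_representative[OF \<Omega>(1) u(1)])
  have vf: "AE x in lborel. x \<in> \<Omega> \<longrightarrow> f (v x) = f (u x)" using v(4) by eventually_elim simp
  have vg: "AE x in lborel. x \<in> \<Omega> \<longrightarrow> g (v x) = g (u x)" using v(4) by eventually_elim simp
  note qu = pseudometric_of_separable_range[OF v(1-3)]
  note qf = pseudometric_compose[OF v(1-3) cf]
  note qg = pseudometric_compose[OF v(1-3) cg]
  obtain \<epsilon>1 where conv: "\<And>u v :: 'a \<Rightarrow> 'x. measurable_pseudometric (\<lambda>x y. dist (v x) (v y)) \<Longrightarrow> AE x in lborel. x \<in> \<Omega> \<longrightarrow> v x = u x \<Longrightarrow>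
        ((\<lambda>\<epsilon>. Dir_eps \<Omega> \<epsilon> u) \<longlongrightarrow> Dir \<Omega> u) (at_right 0)"
    by (rule Dir_eps_convergence[OF dom, where 'x = 'x]) (rule that)
  obtain \<epsilon>0 where "0 < \<epsilon>0" and convr: "\<And>u v :: 'a \<Rightarrow> real. measurable_pseudometric (\<lambda>x y. dist (v x) (v y)) \<Longrightarrow> AE x in lborel. x \<in> \<Omega> \<longrightarrow> v x = u x \<Longrightarrow>
        ((\<lambda>\<epsilon>. Dir_eps \<Omega> \<epsilon> u) \<longlongrightarrow> Dir \<Omega> u) (at_right 0)"
    and zero: "\<And>u v :: 'a \<Rightarrow> real. measurable_pseudometric (\<lambda>x y. dist (v x) (v y)) \<Longrightarrow> AE x in lborel. x \<in> \<Omega> \<longrightarrow> v x = u x \<Longrightarrow>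
        Dir \<Omega> u = 0 \<Longrightarrow> pair_energy \<Omega> \<epsilon>0 (\<lambda>x y. dist (v x) (v y)) = 0"
    by (rule Dir_eps_convergence[OF dom, where 'x = real]) (rule that)
  define w where "w x = f (u x)" for x
  have le: "Dir \<Omega> w + Dir \<Omega> (\<lambda>x. g (u x)) \<le> Dir \<Omega> u"
  proof (rule tendsto_le[OF _ conv[OF qu v(4)]])
    show "((\<lambda>\<epsilon>. Dir_eps \<Omega> \<epsilon> w + Dir_eps \<Omega> \<epsilon> (\<lambda>x. g (u x))) \<longlongrightarrow> Dir \<Omega> w + Dir \<Omega> (\<lambda>x. g (u x))) (at_right 0)"
      unfolding w_def by (intro tendsto_add conv[OF qf vf] convr[OF qg vg])
    show "\<forall>\<^sub>F \<epsilon> in at_right 0. Dir_eps \<Omega> \<epsilon> w + Dir_eps \<Omega> \<epsilon> (\<lambda>x. g (u x)) \<le> Dir_eps \<Omega> \<epsilon> u"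
      unfolding w_def by (intro always_eventually allI Dir_eps_add_le[OF \<Omega>(1) v(4) qf qg fg])
  qed simp
  have fb: "AE x in boundary_measure \<Omega>. f (ub x) = ub x"
    using M by eventually_elim (simp add: f_def retract_eq)
  have "is_trace \<Omega> w ub" unfolding w_def by (rule is_trace_compose[OF tr f1 fb])
  moreover have Dw: "Dir \<Omega> w < \<infinity>"
  proof -
    have "Dir \<Omega> w \<le> Dir \<Omega> w + Dir \<Omega> (\<lambda>x. g (u x))" by simp
    then show ?thesis using le u(2) by (meson le_less_trans)
  qed
  moreover have "L2_map (domain_measure \<Omega>) w" unfolding w_def by (rule L2_map_compose[OF u(1) f1])
  ultimately have "Dir \<Omega> u \<le> Dir \<Omega> w" using harm tr unfolding harmonic_map_def H1_map_def by blast
  from order_trans[OF le this] have "Dir \<Omega> w + Dir \<Omega> (\<lambda>x. g (u x)) \<le> Dir \<Omega> w + 0"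
    by (simp only: add_0_right)
  then have "Dir \<Omega> (\<lambda>x. g (u x)) = 0" using Dw unfolding ennreal_add_left_cancel_le by auto
  from constant_of_zero_pair_energy[OF \<Omega> \<open>0 < \<epsilon>0\<close> qg zero[OF qg vg this]]
  obtain c where "AE x in lborel. x \<in> \<Omega> \<longrightarrow> g (v x) = c" .
  with vg have "AE x in lborel. x \<in> \<Omega> \<longrightarrow> g (u x) = c" by eventually_elim auto
  then have c: "AE x in domain_measure \<Omega>. u x \<in> {y. g y = c}" by (simp add: AE_domain_measure[OF \<Omega>(1)])
  have "closed {y. g y = c}" using continuous_closed_preimage_constant[OF cg closed_UNIV, of c] by simp
  from trace_in_closed[OF dom tr this c] M
  have "AE x in boundary_measure \<Omega>. c = 0"
    by eventually_elim (simp add: g_def retraction_time_eq_0_iff[symmetric])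
  then have "c = 0" using AE_witness[OF boundary_measure_nonzero[OF \<Omega>(1,3,4)]] by blast
  then show ?thesis using c by (simp add: g_def retraction_time_eq_0_iff)
qed

theorem theorem2p5:
  fixes \<Omega> :: "'a::euclidean_space set"
    and \<alpha> :: real
    and E :: "'x::complete_space \<Rightarrow> ereal"
    and u ub :: "'a \<Rightarrow> 'x"
  assumes "0 < \<alpha>" "\<alpha> \<le> 1"
    and "bounded_C2_holder_domain \<alpha> \<Omega>"
    and "\<forall>x. E x \<noteq> - \<infinity>"
    and "lower_semicontinuous E"
    and "closure {x. E x < \<infinity>} = UNIV"
    and "\<exists>S. EVI0_flow E S"
    and "harmonic_map \<Omega> u"
    and "is_trace \<Omega> u ub"
    and "L1_ereal (boundary_measure \<Omega>) (\<lambda>x. E (ub x))"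
  shows "esssup (domain_measure \<Omega>) (\<lambda>x. E (u x)) \<le> esssup (boundary_measure \<Omega>) (\<lambda>x. E (ub x)) \<and>
    (\<bar>esssup (domain_measure \<Omega>) (\<lambda>x. E (u x))\<bar> \<noteq> \<infinity> \<longleftrightarrow>
     \<bar>esssup (boundary_measure \<Omega>) (\<lambda>x. E (ub x))\<bar> \<noteq> \<infinity>)"
proof -
  obtain S where S: "EVI0_flow E S" using assms(7) by blast
  have "\<exists>v. E v < \<infinity>" using assms(6) by (metis (mono_tags, lifting) Collect_empty_eq UNIV_not_empty closure_empty)
  then interpret EVI_flow E S using assms(4,5) S by unfold_locales auto
  have \<Omega>: "open \<Omega>" "bounded \<Omega>" "\<Omega> \<noteq> {}" using assms(3) by (auto simp: bounded_C2_holder_domain_def)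
  define l where "l = esssup (domain_measure \<Omega>) (\<lambda>x. E (u x))"
  define r where "r = esssup (boundary_measure \<Omega>) (\<lambda>x. E (ub x))"
  have um: "(\<lambda>x. E (u x)) \<in> borel_measurable (domain_measure \<Omega>)"
    using assms(8) measurable_compose[OF _ lsc_borel_measurable[OF assms(5)]]
    by (auto simp: harmonic_map_def H1_map_def L2_map_def)
  have bm: "(\<lambda>x. E (ub x)) \<in> borel_measurable (boundary_measure \<Omega>)" using assms(10) by (simp add: L1_ereal_def)
  have l: "AE x in domain_measure \<Omega>. E (u x) \<le> l" unfolding l_def by (rule esssup_AE)
  have r: "AE x in boundary_measure \<Omega>. E (ub x) \<le> r" unfolding r_def by (rule esssup_AE)
  have "emeasure (domain_measure \<Omega>) (space (domain_measure \<Omega>)) \<noteq> 0"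
  proof -
    have "\<not> (AE x in domain_measure \<Omega>. False)"
      using AE_lborel_open_witness[OF \<Omega>(1,3), of "\<lambda>x. x \<notin> \<Omega>"] by (auto simp: AE_domain_measure[OF \<Omega>(1)])
    then show ?thesis by (simp add: AE_False_iff)
  qed
  then obtain x where "E (u x) \<le> l" by (rule AE_witness[OF _ l])
  then have lmi: "l \<noteq> - \<infinity>" using not_minf[of "u x"] by auto
  obtain y where "E (ub y) \<le> r" by (rule AE_witness[OF boundary_measure_nonzero[OF \<Omega>] r])
  then have rmi: "r \<noteq> - \<infinity>" using not_minf[of "ub y"] by auto
  have le: "l \<le> r"
  proof (cases r)
    case (real M)
    then have "AE x in domain_measure \<Omega>. E (u x) \<le> r"
      using harmonic_map_sublevel[OF assms(3,1,8,9), of M] r by simp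
    then show ?thesis unfolding l_def by (intro esssup_I um)
  qed (use rmi in auto)
  have "r < \<infinity>" if "l < \<infinity>"
  proof -
    have "AE x in boundary_measure \<Omega>. ub x \<in> {y. E y \<le> l}"
      by (rule trace_in_closed[OF assms(3,1,9) lsc_closed_sublevel[OF assms(5)]]) (use l in simp)
    then have "r \<le> l" unfolding r_def by (intro esssup_I bm) simp
    then show ?thesis using that by (rule le_less_trans)
  qed
  then have "\<bar>l\<bar> \<noteq> \<infinity> \<longleftrightarrow> \<bar>r\<bar> \<noteq> \<infinity>" using le lmi rmi by (cases l; cases r) auto
  with le show ?thesis unfolding l_def r_def by blast
qed

end
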